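(* Let $J\in\{I,J_1,J_+\}$. For each closure space $X$ the singular simplicial chain complex $C^J_\bullet(X)$ and the singular cubical chain complex $C^{(J,\times)}_\bullet(X)$ are chain homotopy equivalent: $C^J_\bullet(X)\simeq C^{(J,\times)}_\bullet(X)$.
   Context: A closure space $(X,c)$ is a set $X$ with a map $c:\mathcal P(X)\to\mathcal P(X)$ such that $c(\emptyset)=\emptyset$, $A\subseteq c(A)$, and $c(A\cup B)=c(A)\cup c(B)$. The interior is $i(A)=X\setminus c(X\setminus A)$, and $V$ is a neighborhood of $x$ if $x\in i(V)$. A map $f:(X,c)\to(Y,d)$ is continuous if $f(c(A))\subseteq d(f(A))$ for all $A\subseteq X$. Topological spaces are closure spaces via the topological closure. The product $X\times Y$ is the set product with the closure for which the sets $U\times V$ ($U$ a neighborhood of $x$, $V$ of $y$) form a neighborhood base at $(x,y)$ (the categorical product). Spaces: $I=[0,1]$ with the usual topology; $J_1=\{0,1\}$ with the indiscrete closure; $J_+=\{0,1\}$ with $c(\{0\})=\{0,1\}$, $c(\{1\})=\{1\}$. Singular simplices: $|\Delta^n|^{I}$ is the standard topological $n$-simplex; $|\Delta^n|^{J_1}$ is $\{0,\dots,n\}$ with the indiscrete closure; $|\Delta^n|^{J_+}$ is $\{0,\dots,n\}$ with $c(\{i\})=\{j: j\ge i\}$. $C^J_n(X)$ is the free abelian group on continuous maps $\sigma:|\Delta^n|^J\to X$, with $\partial\sigma=\sum_{i=0}^n(-1)^i\sigma\circ d^i$, $d^i$ the $i$-th face inclusion. Singular cubes: $J^{\times n}$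 is the $n$-fold product (a point if $n=0$). Let $Q_n(X)$ be the free abelian group on continuous maps $\sigma:J^{\times n}\to X$ and $D_n(X)$ the subgroup generated by the degenerate $\sigma$, i.e. those that do not depend on their $i$-th coordinate for some $1\le i\le n$. Then $C^{(J,\times)}_n(X)=Q_n(X)/D_n(X)$, with $\partial\sigma=\sum_{i=1}^n(-1)^i(A_i\sigma-B_i\sigma)$, where $A_i\sigma$ (resp. $B_i\sigma$) is $\sigma$ with $0$ (resp. $1$) inserted in the $i$-th coordinate. *)

theory Defs
  imports "HOL-Homology.Simplices"
begin

section \<open>Closure spaces\<close>

text \<open>
  The underlying set is an explicit carrier, so that the empty space is included.
  The values of the closure outside the power set of the carrier are irrelevant.
\<close>

record 'a cspace =
  points :: "'a set"
  clos :: "'a set \<Rightarrow> 'a set"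

definition closure_space :: "'a cspace \<Rightarrow> bool" where
  "closure_space X \<longleftrightarrow>
     clos X {} = {} \<and>
     (\<forall>A. A \<subseteq> points X \<longrightarrow> A \<subseteq> clos X A \<and> clos X A \<subseteq> points X) \<and>
     (\<forall>A B. A \<subseteq> points X \<longrightarrow> B \<subseteq> points X \<longrightarrow> clos X (A \<union> B) = clos X A \<union> clos X B)"

definition cs_interior :: "'a cspace \<Rightarrow> 'a set \<Rightarrow> 'a set" where
  "cs_interior X A = points X - clos X (points X - A)"

definition cs_nbhd :: "'a cspace \<Rightarrow> 'a \<Rightarrow> 'a set \<Rightarrow> bool" where
  "cs_nbhd X x V \<longleftrightarrow> V \<subseteq> points X \<and> x \<in> cs_interior X V"

definition cs_continuous :: "'a cspace \<Rightarrow> 'b cspace \<Rightarrow> ('a \<Rightarrow> 'b) \<Rightarrow> bool" where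
  "cs_continuous X Y f \<longleftrightarrow>
     f ` points X \<subseteq> points Y \<and>
     (\<forall>A. A \<subseteq> points X \<longrightarrow> f ` clos X A \<subseteq> clos Y (f ` A))"

definition top_cspace :: "'a topology \<Rightarrow> 'a cspace" where
  "top_cspace T = \<lparr>points = topspace T, clos = (\<lambda>A. T closure_of A)\<rparr>"

definition indiscrete_cspace :: "'a set \<Rightarrow> 'a cspace" where
  "indiscrete_cspace S = \<lparr>points = S, clos = (\<lambda>A. if A = {} then {} else S)\<rparr>"

text \<open>
  The \<open>n\<close>-fold product of \<open>J\<close>, with coordinates indexed by \<open>1, \<dots>, n\<close>. The closure is the one
  for which the boxes with neighbourhoods as sides form a neighbourhood base at each point:
  a point lies in the closure of \<open>A\<close> iff each of its basic neighbourhoods meets \<open>A\<close>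
  (see \<open>cs_nbhd_cs_power\<close> below).
\<close>

definition cs_power :: "'a cspace \<Rightarrow> nat \<Rightarrow> (nat \<Rightarrow> 'a) cspace" where
  "cs_power J n =
     \<lparr>points = (\<Pi>\<^sub>E i\<in>{1..n}. points J),
      clos = (\<lambda>A. {x \<in> (\<Pi>\<^sub>E i\<in>{1..n}. points J).
                     \<forall>U. (\<forall>i\<in>{1..n}. cs_nbhd J (x i) (U i)) \<longrightarrow> (\<Pi>\<^sub>E i\<in>{1..n}. U i) \<inter> A \<noteq> {}})\<rparr>"


section \<open>Chain complexes of abelian groups\<close>

text \<open>
  Complexes are non-negatively graded; \<open>bdry C n\<close> is the map from degree \<open>n\<close> to degree \<open>n - 1\<close>
  for \<open>n \<ge> 1\<close>. The differential out of degree \<open>0\<close> is zero, and \<open>bdry C 0\<close> is never used.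
\<close>

record 'a ccomplex =
  grp :: "nat \<Rightarrow> 'a monoid"
  bdry :: "nat \<Rightarrow> 'a \<Rightarrow> 'a"

definition chain_complex :: "'a ccomplex \<Rightarrow> bool" where
  "chain_complex C \<longleftrightarrow>
     (\<forall>n. comm_group (grp C n)) \<and>
     (\<forall>n. bdry C (Suc n) \<in> hom (grp C (Suc n)) (grp C n)) \<and>
     (\<forall>n. \<forall>c\<in>carrier (grp C (Suc (Suc n))). bdry C (Suc n) (bdry C (Suc (Suc n)) c) = \<one>\<^bsub>grp C n\<^esub>)"

definition chain_morphism :: "'a ccomplex \<Rightarrow> 'b ccomplex \<Rightarrow> (nat \<Rightarrow> 'a \<Rightarrow> 'b) \<Rightarrow> bool" where
  "chain_morphism C D f \<longleftrightarrow>
     (\<forall>n. f n \<in> hom (grp C n) (grp D n)) \<and>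
     (\<forall>n. \<forall>c\<in>carrier (grp C (Suc n)). f n (bdry C (Suc n) c) = bdry D (Suc n) (f (Suc n) c))"

definition chain_homotopic ::
    "'a ccomplex \<Rightarrow> 'b ccomplex \<Rightarrow> (nat \<Rightarrow> 'a \<Rightarrow> 'b) \<Rightarrow> (nat \<Rightarrow> 'a \<Rightarrow> 'b) \<Rightarrow> bool" where
  "chain_homotopic C D f g \<longleftrightarrow>
     (\<exists>h. (\<forall>n. h n \<in> hom (grp C n) (grp D (Suc n))) \<and>
          (\<forall>c\<in>carrier (grp C 0).
             f 0 c \<otimes>\<^bsub>grp D 0\<^esub> inv\<^bsub>grp D 0\<^esub> (g 0 c) = bdry D (Suc 0) (h 0 c)) \<and>
          (\<forall>n. \<forall>c\<in>carrier (grp C (Suc n)).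
             f (Suc n) c \<otimes>\<^bsub>grp D (Suc n)\<^esub> inv\<^bsub>grp D (Suc n)\<^esub> (g (Suc n) c) =
             bdry D (Suc (Suc n)) (h (Suc n) c) \<otimes>\<^bsub>grp D (Suc n)\<^esub> h n (bdry C (Suc n) c)))"

definition chain_homotopy_equivalent :: "'a ccomplex \<Rightarrow> 'b ccomplex \<Rightarrow> bool"
    (infix \<open>\<simeq>\<^sub>c\<close> 50) where
  "C \<simeq>\<^sub>c D \<longleftrightarrow>
     chain_complex C \<and> chain_complex D \<and>
     (\<exists>f g. chain_morphism C D f \<and> chain_morphism D C g \<and>
        chain_homotopic C C (\<lambda>n. g n \<circ> f n) (\<lambda>n. id) \<and>
        chain_homotopic D D (\<lambda>n. f n \<circ> g n) (\<lambda>n. id))"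


section \<open>Singular simplices and cubes\<close>

text \<open>
  Singular simplices and cubes are normalised to be \<open>undefined\<close> outside their domain, so that each
  map of spaces is represented by exactly one HOL function.
\<close>

definition sing_maps :: "'b cspace \<Rightarrow> 'a cspace \<Rightarrow> ('b \<Rightarrow> 'a) set" where
  "sing_maps K X = {\<sigma>. cs_continuous K X \<sigma> \<and> \<sigma> \<in> extensional (points K)}"

text \<open>
  \<open>\<Delta> n\<close> is the model \<open>n\<close>-simplex, and \<open>\<delta> i : \<Delta> (n - 1) \<rightarrow> \<Delta> n\<close> its \<open>i\<close>-th face inclusion, given
  by a formula that does not depend on \<open>n\<close>.
\<close>

definition simplicial_complex ::
    "(nat \<Rightarrow> 'b cspace) \<Rightarrow> (nat \<Rightarrow> 'b \<Rightarrow> 'b) \<Rightarrow> 'a cspace \<Rightarrow> (('b \<Rightarrow> 'a) \<Rightarrow>\<^sub>0 int) ccomplex" where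
  "simplicial_complex \<Delta> \<delta> X =
     \<lparr>grp = (\<lambda>n. free_Abelian_group (sing_maps (\<Delta> n) X)),
      bdry = (\<lambda>n. frag_extend (\<lambda>\<sigma>. \<Sum>i=0..n.
                frag_cmul ((-1) ^ i) (frag_of (restrict (\<sigma> \<circ> \<delta> i) (points (\<Delta> (n - 1)))))))\<rparr>"

definition insert_coord :: "nat \<Rightarrow> 'b \<Rightarrow> (nat \<Rightarrow> 'b) \<Rightarrow> (nat \<Rightarrow> 'b)" where
  "insert_coord i t a = (\<lambda>j. if j < i then a j else if j = i then t else a (j - 1))"

definition cube_face :: "'b cspace \<Rightarrow> nat \<Rightarrow> nat \<Rightarrow> 'b \<Rightarrow> ((nat \<Rightarrow> 'b) \<Rightarrow> 'a) \<Rightarrow> ((nat \<Rightarrow> 'b) \<Rightarrow> 'a)" where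
  "cube_face J n i t \<sigma> = restrict (\<sigma> \<circ> insert_coord i t) (points (cs_power J (n - 1)))"

definition cube_boundary ::
    "'b::{zero,one} cspace \<Rightarrow> nat \<Rightarrow> (((nat \<Rightarrow> 'b) \<Rightarrow> 'a) \<Rightarrow>\<^sub>0 int) \<Rightarrow> (((nat \<Rightarrow> 'b) \<Rightarrow> 'a) \<Rightarrow>\<^sub>0 int)" where
  "cube_boundary J n =
     frag_extend (\<lambda>\<sigma>. \<Sum>i=1..n.
       frag_cmul ((-1) ^ i) (frag_of (cube_face J n i 0 \<sigma>) - frag_of (cube_face J n i 1 \<sigma>)))"

definition cube_group :: "'b cspace \<Rightarrow> 'a cspace \<Rightarrow> nat \<Rightarrow> (((nat \<Rightarrow> 'b) \<Rightarrow> 'a) \<Rightarrow>\<^sub>0 int) monoid" where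
  "cube_group J X n = free_Abelian_group (sing_maps (cs_power J n) X)"

definition degenerate_cubes :: "'b cspace \<Rightarrow> 'a cspace \<Rightarrow> nat \<Rightarrow> ((nat \<Rightarrow> 'b) \<Rightarrow> 'a) set" where
  "degenerate_cubes J X n =
     {\<sigma> \<in> sing_maps (cs_power J n) X.
        \<exists>i\<in>{1..n}. \<forall>x\<in>points (cs_power J n). \<forall>t\<in>points J. \<sigma> (x(i := t)) = \<sigma> x}"

definition degenerate_group :: "'b cspace \<Rightarrow> 'a cspace \<Rightarrow> nat \<Rightarrow> (((nat \<Rightarrow> 'b) \<Rightarrow> 'a) \<Rightarrow>\<^sub>0 int) set" where
  "degenerate_group J X n = generate (cube_group J X n) (frag_of ` degenerate_cubes J X n)"

text \<open>
  The boundary on the quotient is the induced one: it sends a coset \<open>K\<close> to the coset of \<open>\<partial>c\<close> for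
  any \<open>c \<in> K\<close>.
\<close>

definition cubical_complex ::
    "'b::{zero,one} cspace \<Rightarrow> 'a cspace \<Rightarrow> (((nat \<Rightarrow> 'b) \<Rightarrow> 'a) \<Rightarrow>\<^sub>0 int) set ccomplex" where
  "cubical_complex J X =
     \<lparr>grp = (\<lambda>n. cube_group J X n Mod degenerate_group J X n),
      bdry = (\<lambda>n K. the_elem
        ((\<lambda>c. degenerate_group J X (n - 1) #>\<^bsub>cube_group J X (n - 1)\<^esub> cube_boundary J n c) ` K))\<rparr>"


section \<open>The three intervals and their simplices\<close>

definition interval_I :: "real cspace" where
  "interval_I = top_cspace (top_of_set {0..1})"

definition interval_J1 :: "nat cspace" where
  "interval_J1 = indiscrete_cspace {0, 1}"

definition interval_Jplus :: "nat cspace" where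
  "interval_Jplus = \<lparr>points = {0, 1}, clos = (\<lambda>A. if 0 \<in> A then {0, 1} else A)\<rparr>"

definition simplex_I :: "nat \<Rightarrow> (nat \<Rightarrow> real) cspace" where
  "simplex_I n = top_cspace (subtopology (powertop_real UNIV) (standard_simplex n))"

definition simplex_J1 :: "nat \<Rightarrow> nat cspace" where
  "simplex_J1 n = indiscrete_cspace {0..n}"

definition simplex_Jplus :: "nat \<Rightarrow> nat cspace" where
  "simplex_Jplus n = \<lparr>points = {0..n}, clos = (\<lambda>A. {j\<in>{0..n}. \<exists>i\<in>A. i \<le> j})\<rparr>"

definition vertex_face :: "nat \<Rightarrow> nat \<Rightarrow> nat" where
  "vertex_face i j = (if j < i then j else Suc j)"

definition simplicial_chains_I :: "'a cspace \<Rightarrow> (((nat \<Rightarrow> real) \<Rightarrow> 'a) \<Rightarrow>\<^sub>0 int) ccomplex" where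
  "simplicial_chains_I X = simplicial_complex simplex_I simplical_face X"

definition simplicial_chains_J1 :: "'a cspace \<Rightarrow> ((nat \<Rightarrow> 'a) \<Rightarrow>\<^sub>0 int) ccomplex" where
  "simplicial_chains_J1 X = simplicial_complex simplex_J1 vertex_face X"

definition simplicial_chains_Jplus :: "'a cspace \<Rightarrow> ((nat \<Rightarrow> 'a) \<Rightarrow>\<^sub>0 int) ccomplex" where
  "simplicial_chains_Jplus X = simplicial_complex simplex_Jplus vertex_face X"


section \<open>Consistency of the definitions\<close>

lemma closure_space_top_cspace: "closure_space (top_cspace T)"
  by (auto simp: closure_space_def top_cspace_def closure_of_subset_topspace
      dest: closure_of_subset subsetD[OF closure_of_subset_topspace])

lemma cs_continuous_top_cspace:
  "cs_continuous (top_cspace S) (top_cspace T) f \<longleftrightarrow> continuous_map S T f"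
proof
  assume "cs_continuous (top_cspace S) (top_cspace T) f"
  then show "continuous_map S T f"
    by (simp add: continuous_map_eq_image_closure_subset_alt cs_continuous_def top_cspace_def
        image_subset_iff_funcset)
next
  assume "continuous_map S T f"
  then show "cs_continuous (top_cspace S) (top_cspace T) f"
    using continuous_map_image_closure_subset[of S T f] continuous_map_image_subset_topspace[of S T f]
    by (simp add: cs_continuous_def top_cspace_def)
qed

lemma closure_space_indiscrete: "closure_space (indiscrete_cspace S)"
  by (auto simp: closure_space_def indiscrete_cspace_def)

lemma closure_space_simplex_Jplus: "closure_space (simplex_Jplus n)"
  by (auto simp: closure_space_def simplex_Jplus_def)

lemma closure_space_interval_Jplus: "closure_space interval_Jplus"
  by (auto simp: closure_space_def interval_Jplus_def)

lemma cs_nbhd_Int: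
  assumes "closure_space X" "cs_nbhd X x U" "cs_nbhd X x V"
  shows "cs_nbhd X x (U \<inter> V)"
proof -
  have "clos X (points X - U \<inter> V) = clos X (points X - U) \<union> clos X (points X - V)"
    using assms(1) unfolding closure_space_def by (metis Diff_Int Diff_subset)
  then show ?thesis
    using assms(2,3) by (auto simp: cs_nbhd_def cs_interior_def)
qed

lemma cs_nbhd_mem:
  assumes "closure_space X" "cs_nbhd X x U"
  shows "x \<in> U"
  using assms by (auto simp: closure_space_def cs_nbhd_def cs_interior_def)

lemma cs_nbhd_cs_power:
  assumes "x \<in> points (cs_power J n)"
  shows "cs_nbhd (cs_power J n) x V \<longleftrightarrow>
     V \<subseteq> points (cs_power J n) \<and>
     (\<exists>U. (\<forall>i\<in>{1..n}. cs_nbhd J (x i) (U i)) \<and> (\<Pi>\<^sub>E i\<in>{1..n}. U i) \<subseteq> V)"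
proof -
  let ?P = "points (cs_power J n)"
  have box: "(\<Pi>\<^sub>E i\<in>{1..n}. U i) \<subseteq> ?P"
    if "\<forall>i\<in>{1..n}. cs_nbhd J (x i) (U i)" for U
    using that by (force simp: cs_power_def cs_nbhd_def PiE_iff)
  have clos: "x \<in> clos (cs_power J n) A \<longleftrightarrow>
      (\<forall>U. (\<forall>i\<in>{1..n}. cs_nbhd J (x i) (U i)) \<longrightarrow> (\<Pi>\<^sub>E i\<in>{1..n}. U i) \<inter> A \<noteq> {})" for A
    using assms by (simp add: cs_power_def)
  have "cs_nbhd (cs_power J n) x V \<longleftrightarrow> V \<subseteq> ?P \<and> x \<notin> clos (cs_power J n) (?P - V)"
    using assms by (simp add: cs_nbhd_def cs_interior_def)
  also have "\<dots> \<longleftrightarrow> V \<subseteq> ?P \<and>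
      (\<exists>U. (\<forall>i\<in>{1..n}. cs_nbhd J (x i) (U i)) \<and> (\<Pi>\<^sub>E i\<in>{1..n}. U i) \<inter> (?P - V) = {})"
    unfolding clos by blast
  also have "\<dots> \<longleftrightarrow> V \<subseteq> ?P \<and>
      (\<exists>U. (\<forall>i\<in>{1..n}. cs_nbhd J (x i) (U i)) \<and> (\<Pi>\<^sub>E i\<in>{1..n}. U i) \<subseteq> V)"
  proof -
    have "(\<Pi>\<^sub>E i\<in>{1..n}. U i) \<inter> (?P - V) = {} \<longleftrightarrow> (\<Pi>\<^sub>E i\<in>{1..n}. U i) \<subseteq> V"
      if "\<forall>i\<in>{1..n}. cs_nbhd J (x i) (U i)" for U
      using box[OF that] by blast
    then show ?thesis
      by (intro conj_cong iff_exI refl)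
  qed
  finally show ?thesis .
qed

lemma closure_space_cs_power:
  assumes J: "closure_space J"
  shows "closure_space (cs_power J n)"
proof -
  define P where "P = points (cs_power J n)"
  define c where "c = clos (cs_power J n)"
  define B where "B = (\<lambda>x U. \<forall>i\<in>{1..n}. cs_nbhd J (x i) (U i))"
  have P: "P = (\<Pi>\<^sub>E i\<in>{1..n}. points J)"
    by (simp add: P_def cs_power_def)
  have c: "x \<in> c A \<longleftrightarrow> x \<in> P \<and> (\<forall>U. B x U \<longrightarrow> (\<Pi>\<^sub>E i\<in>{1..n}. U i) \<inter> A \<noteq> {})" for x A
    by (simp add: c_def P B_def cs_power_def)
  have "cs_nbhd J y (points J)" if "y \<in> points J" for y
    using J that by (simp add: cs_nbhd_def cs_interior_def closure_space_def)
  then have univ: "B x (\<lambda>_. points J)" if "x \<in> P" for x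
    using that unfolding B_def P by (meson PiE_mem)
  have mem: "x \<in> (\<Pi>\<^sub>E i\<in>{1..n}. U i)" if "x \<in> P" "B x U" for x U
    using that cs_nbhd_mem[OF J] unfolding B_def P by (simp add: PiE_iff)
  have Int: "B x (\<lambda>i. U i \<inter> V i)" if "B x U" "B x V" for x U V
    using that cs_nbhd_Int[OF J] unfolding B_def by blast
  have "x \<notin> c {}" for x
    using univ[of x] c[of x "{}"] by (metis Int_empty_right)
  then have "c {} = {}"
    by blast
  moreover have "A \<subseteq> c A" if "A \<subseteq> P" for A
  proof
    fix x assume "x \<in> A"
    then have "x \<in> (\<Pi>\<^sub>E i\<in>{1..n}. U i) \<inter> A" if "B x U" for U
      using mem[of x U] that \<open>A \<subseteq> P\<close> by auto
    then have "B x U \<longrightarrow> (\<Pi>\<^sub>E i\<in>{1..n}. U i) \<inter> A \<noteq> {}" for U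
      by (metis empty_iff)
    then show "x \<in> c A"
      using \<open>x \<in> A\<close> \<open>A \<subseteq> P\<close> c[of x A] by auto
  qed
  moreover have "c A \<subseteq> P" for A
    by (rule subsetI) (simp add: c)
  moreover have "c (A \<union> A') = c A \<union> c A'" for A A'
  proof (intro equalityI subsetI)
    fix x assume x: "x \<in> c (A \<union> A')"
    show "x \<in> c A \<union> c A'"
    proof (rule ccontr)
      assume "x \<notin> c A \<union> c A'"
      then obtain U V where U: "B x U" "(\<Pi>\<^sub>E i\<in>{1..n}. U i) \<inter> A = {}"
        and V: "B x V" "(\<Pi>\<^sub>E i\<in>{1..n}. V i) \<inter> A' = {}"
        using x unfolding c Un_iff by auto
      have "(\<Pi>\<^sub>E i\<in>{1..n}. U i \<inter> V i) \<inter> (A \<union> A') \<noteq> {}"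
        using x Int[OF U(1) V(1)] unfolding c by simp
      then show False
        using U(2) V(2) by (simp add: PiE_Int[symmetric]) blast
    qed
  next
    fix x assume "x \<in> c A \<union> c A'"
    then show "x \<in> c (A \<union> A')"
      unfolding c Un_iff Int_Un_distrib by auto
  qed
  ultimately show ?thesis
    unfolding closure_space_def P_def[symmetric] c_def[symmetric] by simp
qed

end

theory Submission
  imports Defs
begin

text \<open>
  The method of acyclic models, carried out in the free preadditive category on closure spaces.
  Both complexes are built from chains on model spaces (simplices or cubes), and natural maps
  between them correspond to universal chains on the models. The normalised cubical complex is the
  image of a natural idempotent on all cubical chains, so it fits the same pattern. If both theories
  are acyclic on all simplices \<open>\<Delta>\<^sup>n\<close> and all cubes \<open>J\<^sup>n\<close>, universal chains for chain maps in both
  directions, and for the homotopies from their composites to the identities, exist by induction on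
  the degree.

  Acyclicity comes from cones: for \<open>I\<close> by contracting a star-shaped set linearly to its centre, for
  \<open>J\<^sub>+\<close> because simplices and cubes contain a point whose closure is everything, and for \<open>J\<^sub>1\<close> because
  all models are indiscrete.
\<close>

section \<open>The preadditive category of closure spaces\<close>

text \<open>Normalisation is essential on the cubical side: in a one-point space all cubes are
  constant and have zero boundary, so the unnormalised complex would have a copy of the integers in
  every degree. The price is a quotient whose elements are no longer combinations of maps out of a
  model. The idempotent pays it: a chain fixed by the idempotent induces a homomorphism out of the
  quotient by precomposition, and a chain found by acyclicity can be projected into normal form
  without changing its boundary.

  Degree 0 needs separate control, since the zero chain is compatible with all boundaries. Universal
  chain maps are therefore built with augmentation 1, which also makes any two of them homotopic.

  A cone may jump. For the two-point intervals the contraction is a switch between a constant and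
  the identity, and the direction of \<open>J\<^sub>+\<close> matters: time 0, whose closure is the
  whole interval, is sent to a point whose closure is the whole model.\<close>

lemma cs_continuous_cong:
  assumes "closure_space K" "\<And>x. x \<in> points K \<Longrightarrow> f x = g x"
  shows "cs_continuous K X f \<longleftrightarrow> cs_continuous K X g"
proof -
  have "f ` A = g ` A" if "A \<subseteq> points K" for A
    using assms(2) that by (intro image_cong) auto
  moreover have "clos K A \<subseteq> points K" if "A \<subseteq> points K" for A
    using assms(1) that by (auto simp: closure_space_def)
  ultimately show ?thesis
    unfolding cs_continuous_def by (metis order_refl)
qed

lemma cs_continuousD:
  "cs_continuous Y X f \<Longrightarrow> A \<subseteq> points Y \<Longrightarrow> x \<in> clos Y A \<Longrightarrow> f x \<in> clos X (f ` A)"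
  unfolding cs_continuous_def by blast

lemma cs_continuous_compose:
  assumes g: "cs_continuous K L g" and f: "cs_continuous L X f"
  shows "cs_continuous K X (\<lambda>x. f (g x))"
  unfolding cs_continuous_def
proof (intro conjI allI impI)
  show "(\<lambda>x. f (g x)) ` points K \<subseteq> points X"
    using f g by (fastforce simp: cs_continuous_def)
next
  fix A assume A: "A \<subseteq> points K"
  then have "g ` A \<subseteq> points L"
    using g by (auto simp: cs_continuous_def)
  then have "f ` clos L (g ` A) \<subseteq> clos X (f ` g ` A)"
    using f by (simp add: cs_continuous_def)
  moreover have "g ` clos K A \<subseteq> clos L (g ` A)"
    using g A by (simp add: cs_continuous_def)
  ultimately show "(\<lambda>x. f (g x)) ` clos K A \<subseteq> clos X ((\<lambda>x. f (g x)) ` A)"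
    by (auto simp: image_image)
qed

lemma cs_continuous_id: "cs_continuous K K (\<lambda>x. x)"
  by (simp add: cs_continuous_def)

lemma restrict_in_sing_maps:
  "closure_space K \<Longrightarrow> restrict f (points K) \<in> sing_maps K X \<longleftrightarrow> cs_continuous K X f"
  using cs_continuous_cong[of K "restrict f (points K)" f X] by (auto simp: sing_maps_def)

lemma compose_in_sing_maps:
  assumes "closure_space K" "f \<in> sing_maps L X" "g \<in> sing_maps K L"
  shows "compose (points K) f g \<in> sing_maps K X"
  unfolding compose_def using assms
  by (subst restrict_in_sing_maps) (auto simp: sing_maps_def intro: cs_continuous_compose)

lemma sing_maps_funcset: "g \<in> sing_maps K L \<Longrightarrow> g \<in> points K \<rightarrow> points L"
  by (auto simp: sing_maps_def cs_continuous_def)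

lemma sing_maps_extensional: "g \<in> sing_maps K L \<Longrightarrow> g \<in> extensional (points K)"
  by (auto simp: sing_maps_def)

text \<open>The carrier of the free abelian group as a plain set: its operation is addition of
  finitely supported functions, so chains can be handled with ordinary \<open>+\<close> and
  \<open>-\<close>.\<close>

definition chains :: "'k cspace \<Rightarrow> 'a cspace \<Rightarrow> (('k \<Rightarrow> 'a) \<Rightarrow>\<^sub>0 int) set" where
  "chains K X = {c. Poly_Mapping.keys c \<subseteq> sing_maps K X}"

lemma carrier_chains: "carrier (free_Abelian_group (sing_maps K X)) = chains K X"
  by (auto simp: chains_def)

lemma chains_0 [simp]: "0 \<in> chains K X"
  by (simp add: chains_def)

lemma chains_of [simp]: "frag_of \<sigma> \<in> chains K X \<longleftrightarrow> \<sigma> \<in> sing_maps K X"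
  by (simp add: chains_def)

lemma chains_add [intro]: "c \<in> chains K X \<Longrightarrow> d \<in> chains K X \<Longrightarrow> c + d \<in> chains K X"
  using keys_add[of c d] by (auto simp: chains_def)

lemma chains_diff [intro]: "c \<in> chains K X \<Longrightarrow> d \<in> chains K X \<Longrightarrow> c - d \<in> chains K X"
  using keys_diff[of c d] by (auto simp: chains_def)

lemma chains_cmul [intro]: "c \<in> chains K X \<Longrightarrow> frag_cmul a c \<in> chains K X"
  using keys_cmul[of a c] by (auto simp: chains_def)

lemma chains_sum [intro]: "(\<And>i. i \<in> I \<Longrightarrow> c i \<in> chains K X) \<Longrightarrow> sum c I \<in> chains K X"
  by (induction I rule: infinite_finite_induct) auto

lemma chains_frag_extend:
  "(\<And>\<sigma>. \<sigma> \<in> sing_maps L Y \<Longrightarrow> f \<sigma> \<in> chains K X) \<Longrightarrow> c \<in> chains L Y \<Longrightarrow> frag_extend f c \<in> chains K X"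
  unfolding frag_extend_def by (intro chains_sum chains_cmul) (auto simp: chains_def)

lemma chains_induct [consumes 1, case_names zero of diff]:
  assumes "c \<in> chains K X" "P 0" "\<And>\<sigma>. \<sigma> \<in> sing_maps K X \<Longrightarrow> P (frag_of \<sigma>)"
    "\<And>a b. P a \<Longrightarrow> P b \<Longrightarrow> P (a - b)"
  shows "P c"
  using assms unfolding chains_def by (auto intro: frag_induction)

text \<open>
  A chain in \<open>X\<close> is a formal integer combination of maps from a model space, i.e. a morphism of the
  free preadditive category on closure spaces and continuous maps; \<open>\<odot>\<close> is composition there.
  Since maps are normalised outside their domain, composition is indexed by the source space.
\<close>

definition fcomp ::
    "(('k \<Rightarrow> 'a) \<Rightarrow>\<^sub>0 int) \<Rightarrow> 'j cspace \<Rightarrow> (('j \<Rightarrow> 'k) \<Rightarrow>\<^sub>0 int) \<Rightarrow> (('j \<Rightarrow> 'a) \<Rightarrow>\<^sub>0 int)"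
    (\<open>(_ \<odot>\<^bsub>_\<^esub> _)\<close> [70, 0, 71] 70) where
  "c \<odot>\<^bsub>K\<^esub> u = frag_extend (\<lambda>\<sigma>. frag_extend (\<lambda>g. frag_of (compose (points K) \<sigma> g)) u) c"

lemma fcomp_of [simp]: "frag_of \<sigma> \<odot>\<^bsub>K\<^esub> frag_of g = frag_of (compose (points K) \<sigma> g)"
  by (simp add: fcomp_def)

lemma fcomp_0_left [simp]: "0 \<odot>\<^bsub>K\<^esub> u = 0"
  by (simp add: fcomp_def)

lemma fcomp_0_right [simp]: "c \<odot>\<^bsub>K\<^esub> 0 = 0"
  by (simp add: fcomp_def frag_extend_eq_0)

lemma fcomp_add_left: "(c + d) \<odot>\<^bsub>K\<^esub> u = c \<odot>\<^bsub>K\<^esub> u + d \<odot>\<^bsub>K\<^esub> u"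
  by (simp add: fcomp_def frag_extend_add)

lemma fcomp_diff_left: "(c - d) \<odot>\<^bsub>K\<^esub> u = c \<odot>\<^bsub>K\<^esub> u - d \<odot>\<^bsub>K\<^esub> u"
  by (simp add: fcomp_def frag_extend_diff)

lemma fcomp_minus_left: "(- c) \<odot>\<^bsub>K\<^esub> u = - (c \<odot>\<^bsub>K\<^esub> u)"
  by (simp add: fcomp_def frag_extend_minus)

lemma fcomp_cmul_left: "frag_cmul a c \<odot>\<^bsub>K\<^esub> u = frag_cmul a (c \<odot>\<^bsub>K\<^esub> u)"
  by (simp add: fcomp_def frag_extend_cmul)

lemma fcomp_diff_right: "c \<odot>\<^bsub>K\<^esub> (u - v) = c \<odot>\<^bsub>K\<^esub> u - c \<odot>\<^bsub>K\<^esub> v"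
proof (induction c rule: frag_induction[OF subset_UNIV])
  case (2 \<sigma>)
  show ?case
    by (simp add: fcomp_def frag_extend_diff)
qed (simp_all add: fcomp_diff_left)

lemma fcomp_minus_right: "c \<odot>\<^bsub>K\<^esub> (- u) = - (c \<odot>\<^bsub>K\<^esub> u)"
  using fcomp_diff_right[of c K 0 u] by simp

lemma fcomp_add_right: "c \<odot>\<^bsub>K\<^esub> (u + v) = c \<odot>\<^bsub>K\<^esub> u + c \<odot>\<^bsub>K\<^esub> v"
  using fcomp_diff_right[of c K u "- v"] by (simp add: fcomp_minus_right)

lemma fcomp_sum_left: "finite I \<Longrightarrow> sum c I \<odot>\<^bsub>K\<^esub> u = (\<Sum>i\<in>I. c i \<odot>\<^bsub>K\<^esub> u)"
  by (induction I rule: finite_induct) (simp_all add: fcomp_add_left)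

lemma fcomp_sum_right: "finite I \<Longrightarrow> c \<odot>\<^bsub>K\<^esub> sum u I = (\<Sum>i\<in>I. c \<odot>\<^bsub>K\<^esub> u i)"
  by (induction I rule: finite_induct) (simp_all add: fcomp_add_right)

lemma fcomp_cmul_right: "c \<odot>\<^bsub>K\<^esub> frag_cmul a u = frag_cmul a (c \<odot>\<^bsub>K\<^esub> u)"
  unfolding fcomp_def frag_extend_cmul
  by (simp add: frag_extend_def[of _ c] frag_cmul_sum mult.commute)

lemma fcomp_chains [intro]:
  assumes "closure_space K" "c \<in> chains L X" "u \<in> chains K L"
  shows "c \<odot>\<^bsub>K\<^esub> u \<in> chains K X"
  unfolding fcomp_def
  by (rule chains_frag_extend[OF chains_frag_extend])
    (use assms in \<open>auto intro: compose_in_sing_maps\<close>)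


text \<open>Composition of normalised maps restricts to the source carrier, so associativity relies
  on the innermost maps landing in the carrier of \<open>L\<close>; the assumption on
  \<open>v\<close> provides this.\<close>

lemma fcomp_assoc:
  assumes v: "v \<in> chains K L"
  shows "(c \<odot>\<^bsub>L\<^esub> u) \<odot>\<^bsub>K\<^esub> v = c \<odot>\<^bsub>K\<^esub> (u \<odot>\<^bsub>K\<^esub> v)"
proof (induction c rule: frag_induction[OF subset_UNIV])
  case (2 \<sigma>)
  show ?case
  proof (induction u rule: frag_induction[OF subset_UNIV])
    case (2 g)
    show ?case
      using v by (induction rule: chains_induct)
        (simp_all add: fcomp_diff_right compose_assoc[OF sing_maps_funcset])
  qed (simp_all add: fcomp_diff_right fcomp_diff_left)
qed (simp_all add: fcomp_diff_left)

definition idc :: "'k cspace \<Rightarrow> (('k \<Rightarrow> 'k) \<Rightarrow>\<^sub>0 int)" where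
  "idc K = frag_of (\<lambda>x\<in>points K. x)"

lemma idc_chains [simp, intro]: "closure_space K \<Longrightarrow> idc K \<in> chains K K"
  by (simp add: idc_def restrict_in_sing_maps cs_continuous_id)

lemma fcomp_idc_right: "c \<in> chains K X \<Longrightarrow> c \<odot>\<^bsub>K\<^esub> idc K = c"
  by (induction rule: chains_induct)
    (simp_all add: idc_def fcomp_diff_left compose_Id[OF sing_maps_funcset sing_maps_extensional])

lemma fcomp_idc_left: "u \<in> chains K L \<Longrightarrow> idc L \<odot>\<^bsub>K\<^esub> u = u"
  by (induction rule: chains_induct)
    (simp_all add: idc_def fcomp_diff_right Id_compose[OF sing_maps_funcset sing_maps_extensional])

text \<open>The sum of the coefficients. Collapsing every generator to \<open>()\<close> and reading
  off the single coefficient lets additivity come from \<open>frag_extend\<close>.\<close>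

definition aug :: "(('k \<Rightarrow> 'a) \<Rightarrow>\<^sub>0 int) \<Rightarrow> int" where
  "aug c = Poly_Mapping.lookup (frag_extend (\<lambda>_. frag_of ()) c) ()"

lemma aug_of [simp]: "aug (frag_of \<sigma>) = 1"
  by (simp add: aug_def)

lemma aug_0 [simp]: "aug 0 = 0"
  by (simp add: aug_def)

lemma aug_diff: "aug (c - d) = aug c - aug d"
  by (simp add: aug_def frag_extend_diff lookup_minus)

lemma aug_idc [simp]: "aug (idc K) = 1"
  by (simp add: idc_def)

text \<open>A composite of two generators is again one generator. Hence a universal chain acts on
  augmentations by scaling, and a factor of augmentation 0 forces 0.\<close>

lemma aug_fcomp: "aug (c \<odot>\<^bsub>K\<^esub> u) = aug c * aug u"
proof (induction c rule: frag_induction[OF subset_UNIV])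
  case (2 \<sigma>)
  show ?case
    by (induction u rule: frag_induction[OF subset_UNIV]) (simp_all add: fcomp_diff_right aug_diff)
qed (simp_all add: fcomp_diff_left aug_diff left_diff_distrib)

section \<open>Acyclic models\<close>

text \<open>Exactness of the augmented normalised complex of \<open>M\<close>, apart from
  surjectivity of the augmentation. Cycles of positive degree are taken in normal form; the bounding
  chain \<open>e\<close> is not, since it can be projected there afterwards without changing its
  boundary.\<close>

definition model_acyclic ::
    "(nat \<Rightarrow> 'k cspace) \<Rightarrow> (nat \<Rightarrow> ('k \<Rightarrow> 'k) \<Rightarrow>\<^sub>0 int) \<Rightarrow> (nat \<Rightarrow> ('k \<Rightarrow> 'k) \<Rightarrow>\<^sub>0 int) \<Rightarrow> 'm cspace \<Rightarrow> bool" where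
  "model_acyclic K \<nu> \<beta> M \<longleftrightarrow>
     (\<forall>c\<in>chains (K 0) M. aug c = 0 \<longrightarrow> (\<exists>e\<in>chains (K (Suc 0)) M. e \<odot>\<^bsub>K 0\<^esub> \<beta> 0 = c)) \<and>
     (\<forall>m. \<forall>c\<in>chains (K (Suc m)) M. c \<odot>\<^bsub>K (Suc m)\<^esub> \<nu> (Suc m) = c \<longrightarrow> c \<odot>\<^bsub>K m\<^esub> \<beta> m = 0 \<longrightarrow>
        (\<exists>e\<in>chains (K (Suc (Suc m))) M. e \<odot>\<^bsub>K (Suc m)\<^esub> \<beta> (Suc m) = c))"

text \<open>In the spirit of Yoneda, a natural map from \<open>K\<close>-chains to
  \<open>L\<close>-chains is precomposition with the image of the identity of the model, a chain on
  \<open>L n\<close> in \<open>K n\<close>; hence the reversed direction of \<open>u n\<close>. The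
  conditions on \<open>\<nu>\<close> and \<open>\<mu>\<close> let it descend to normal forms and
  land in them; the last condition is compatibility with the boundaries.\<close>

definition natural_chain_map where
  "natural_chain_map K \<nu> \<beta> L \<mu> \<gamma> u \<longleftrightarrow>
     (\<forall>n. u n \<in> chains (L n) (K n) \<and> \<nu> n \<odot>\<^bsub>L n\<^esub> u n = u n \<and> u n \<odot>\<^bsub>L n\<^esub> \<mu> n = u n \<and>
          u (Suc n) \<odot>\<^bsub>L n\<^esub> \<gamma> n = \<beta> n \<odot>\<^bsub>L n\<^esub> u n)"

text \<open>
  Natural operations on chains are precompositions with universal chains between model spaces: the
  boundary of \<open>c\<close> is \<open>c \<odot> b n\<close>. The idempotent \<open>\<nu> n\<close> encodes normalisation: a chain \<open>c\<close> counts as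
  degenerate iff \<open>c \<odot> \<nu> n = 0\<close>.
\<close>

locale model_theory =
  fixes K :: "nat \<Rightarrow> 'k cspace"
    and \<nu> b :: "nat \<Rightarrow> ('k \<Rightarrow> 'k) \<Rightarrow>\<^sub>0 int"
  assumes space [simp, intro]: "closure_space (K n)"
    and b_chains [simp, intro]: "b n \<in> chains (K n) (K (Suc n))"
    and nu_chains [simp, intro]: "\<nu> n \<in> chains (K n) (K n)"
    and b_b: "b (Suc n) \<odot>\<^bsub>K n\<^esub> b n = 0"
    and nu_nu: "\<nu> n \<odot>\<^bsub>K n\<^esub> \<nu> n = \<nu> n"
    and nu_b_nu: "\<nu> (Suc n) \<odot>\<^bsub>K n\<^esub> (b n \<odot>\<^bsub>K n\<^esub> \<nu> n) = b n \<odot>\<^bsub>K n\<^esub> \<nu> n"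
    and nu_0: "\<nu> 0 = idc (K 0)"
    and aug_b: "aug (b 0) = 0"
begin

text \<open>The differential of the normalised complex: \<open>c \<odot> \<beta> n\<close> depends
  only on the normal form of \<open>c\<close> (by \<open>nu_beta\<close>) and is itself in normal
  form (by \<open>beta_nu\<close>).\<close>

definition \<beta> :: "nat \<Rightarrow> ('k \<Rightarrow> 'k) \<Rightarrow>\<^sub>0 int" where
  "\<beta> n = b n \<odot>\<^bsub>K n\<^esub> \<nu> n"

lemma beta_chains [simp, intro]: "\<beta> n \<in> chains (K n) (K (Suc n))"
  unfolding \<beta>_def by (rule fcomp_chains) auto

lemma beta_nu: "\<beta> n \<odot>\<^bsub>K n\<^esub> \<nu> n = \<beta> n"
  by (simp add: \<beta>_def fcomp_assoc nu_nu)

lemma nu_beta: "\<nu> (Suc n) \<odot>\<^bsub>K n\<^esub> \<beta> n = \<beta> n"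
  by (simp add: \<beta>_def nu_b_nu)

text \<open>The middle \<open>\<nu>\<close> is absorbed by the \<open>\<beta>\<close> to its right,
  so the product reduces to \<open>(b (Suc n) \<odot> b n) \<odot> \<nu> n\<close>, which
  \<open>b_b\<close> kills.\<close>

lemma beta_beta: "\<beta> (Suc n) \<odot>\<^bsub>K n\<^esub> \<beta> n = 0"
proof -
  have "\<beta> (Suc n) \<odot>\<^bsub>K n\<^esub> \<beta> n = b (Suc n) \<odot>\<^bsub>K n\<^esub> (\<nu> (Suc n) \<odot>\<^bsub>K n\<^esub> \<beta> n)"
    unfolding \<beta>_def[of "Suc n"] by (rule fcomp_assoc) auto
  also have "\<dots> = (b (Suc n) \<odot>\<^bsub>K n\<^esub> b n) \<odot>\<^bsub>K n\<^esub> \<nu> n"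
    unfolding nu_beta unfolding \<beta>_def by (rule fcomp_assoc[symmetric]) auto
  finally show ?thesis
    by (simp add: b_b)
qed

lemma aug_beta: "aug (\<beta> 0) = 0"
  by (simp add: \<beta>_def aug_fcomp aug_b)

lemma natural_chain_map_nu: "natural_chain_map K \<nu> \<beta> K \<nu> \<beta> \<nu>"
  by (simp add: natural_chain_map_def nu_nu nu_beta beta_nu)

text \<open>Applied to a chain with vanishing normal form, this shows that its boundary is
  degenerate too.\<close>

lemma fcomp_nu_b_nu:
  assumes "c \<in> chains (K (Suc n)) X"
  shows "(c \<odot>\<^bsub>K (Suc n)\<^esub> \<nu> (Suc n)) \<odot>\<^bsub>K n\<^esub> (b n \<odot>\<^bsub>K n\<^esub> \<nu> n) = c \<odot>\<^bsub>K n\<^esub> (b n \<odot>\<^bsub>K n\<^esub> \<nu> n)"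
  by (subst fcomp_assoc) (auto simp: nu_b_nu)

end

locale two_model_theories =
  S: model_theory K \<nu> b + T: model_theory L \<mu> d
  for K :: "nat \<Rightarrow> 'k cspace" and \<nu> b and L :: "nat \<Rightarrow> 'l cspace" and \<mu> d
begin

text \<open>Each extension problem lives on one model: \<open>S.\<beta> n \<odot> u n\<close> is a
  normalised cycle of \<open>L\<close>-chains in \<open>K (Suc n)\<close>, and acyclicity bounds it.
  Augmentation 1 excludes the zero solution.\<close>

lemma natural_chain_map_exists:
  assumes ac: "\<And>n. model_acyclic L \<mu> T.\<beta> (K n)" and p: "p \<in> sing_maps (L 0) (K 0)"
  shows "\<exists>u. natural_chain_map K \<nu> S.\<beta> L \<mu> T.\<beta> u \<and> aug (u 0) = 1"
proof -
  \<comment> \<open>Dependent choice hands only the current \<open>u\<close> to the next step, so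
    the cycle condition for \<open>S.\<beta> n \<odot> u\<close> is stored in the invariant instead
    of being derived from the preceding term.\<close>
  define P where "P n u \<longleftrightarrow> u \<in> chains (L n) (K n) \<and> \<nu> n \<odot>\<^bsub>L n\<^esub> u = u \<and> u \<odot>\<^bsub>L n\<^esub> \<mu> n = u \<and>
     (n = 0 \<longrightarrow> aug u = 1) \<and> (\<forall>m. n = Suc m \<longrightarrow> S.\<beta> n \<odot>\<^bsub>L m\<^esub> (u \<odot>\<^bsub>L m\<^esub> T.\<beta> m) = 0)"
    for n and u :: "('l \<Rightarrow> 'k) \<Rightarrow>\<^sub>0 int"
  define Q where "Q n u v \<longleftrightarrow> v \<odot>\<^bsub>L n\<^esub> T.\<beta> n = S.\<beta> n \<odot>\<^bsub>L n\<^esub> u"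
    for n and u v :: "('l \<Rightarrow> 'k) \<Rightarrow>\<^sub>0 int"
  have "\<exists>u. \<forall>n. P n (u n) \<and> Q n (u n) (u (Suc n))"
  proof (rule dependent_nat_choice)
    show "\<exists>u. P 0 u"
      using p by (intro exI[of _ "frag_of p"])
        (simp add: P_def S.nu_0 T.nu_0 fcomp_idc_left fcomp_idc_right)
  next
    fix u n assume u: "P n u"
    define c where "c = S.\<beta> n \<odot>\<^bsub>L n\<^esub> u"
    have uc: "u \<in> chains (L n) (K n)"
      using u by (simp add: P_def)
    then have c: "c \<in> chains (L n) (K (Suc n))"
      unfolding c_def by auto
    have cmu: "c \<odot>\<^bsub>L n\<^esub> \<mu> n = c"
      using u by (simp add: c_def fcomp_assoc P_def)
    have nuc: "\<nu> (Suc n) \<odot>\<^bsub>L n\<^esub> c = c"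
      using uc by (simp add: c_def S.nu_beta flip: fcomp_assoc)
    have "\<exists>e\<in>chains (L (Suc n)) (K (Suc n)). e \<odot>\<^bsub>L n\<^esub> T.\<beta> n = c"
    proof (cases n)
      case 0
      \<comment> \<open>In degree 0 the augmentation takes the place of a boundary; it vanishes
        because \<open>S.\<beta> 0\<close> has augmentation 0.\<close>
      then have "aug c = 0"
        by (simp add: c_def aug_fcomp S.aug_beta)
      then show ?thesis
        using ac[of "Suc n"] c 0 by (simp add: model_acyclic_def)
    next
      case (Suc m)
      have "c \<odot>\<^bsub>L m\<^esub> T.\<beta> m = 0"
        using u Suc by (simp add: c_def P_def fcomp_assoc)
      then show ?thesis
        using ac[of "Suc n"] c cmu Suc by (simp add: model_acyclic_def)
    qed
    then obtain e where e: "e \<in> chains (L (Suc n)) (K (Suc n))" "e \<odot>\<^bsub>L n\<^esub> T.\<beta> n = c"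
      by blast
    \<comment> \<open>\<open>e\<close> bounds \<open>c\<close> but may be out of normal form.
      Projecting on both sides repairs this, and the boundary is still \<open>c\<close> because
      \<open>\<mu>\<close> is absorbed by \<open>T.\<beta>\<close> and \<open>\<nu>\<close> fixes
      \<open>c\<close>.\<close>
    define v where "v = \<nu> (Suc n) \<odot>\<^bsub>L (Suc n)\<^esub> (e \<odot>\<^bsub>L (Suc n)\<^esub> \<mu> (Suc n))"
    have v: "v \<in> chains (L (Suc n)) (K (Suc n))"
      unfolding v_def using e by auto
    have "v \<odot>\<^bsub>L n\<^esub> T.\<beta> n = \<nu> (Suc n) \<odot>\<^bsub>L n\<^esub> (e \<odot>\<^bsub>L n\<^esub> (\<mu> (Suc n) \<odot>\<^bsub>L n\<^esub> T.\<beta> n))"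
      by (simp add: v_def fcomp_assoc)
    also have "\<dots> = c"
      by (simp add: T.nu_beta e nuc)
    finally have vc: "v \<odot>\<^bsub>L n\<^esub> T.\<beta> n = c" .
    have vmu: "v \<odot>\<^bsub>L (Suc n)\<^esub> \<mu> (Suc n) = v"
      by (simp add: v_def fcomp_assoc T.nu_nu)
    have "e \<odot>\<^bsub>L (Suc n)\<^esub> \<mu> (Suc n) \<in> chains (L (Suc n)) (K (Suc n))"
      using e by auto
    then have nuv: "\<nu> (Suc n) \<odot>\<^bsub>L (Suc n)\<^esub> v = v"
      by (simp add: v_def S.nu_nu flip: fcomp_assoc)
    have "S.\<beta> (Suc n) \<odot>\<^bsub>L n\<^esub> c = 0"
      using uc by (simp add: c_def S.beta_beta flip: fcomp_assoc)
    then show "\<exists>v. P (Suc n) v \<and> Q n u v"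
      using v vmu nuv vc by (intro exI[of _ v]) (simp add: P_def Q_def c_def)
  qed
  then show ?thesis
    unfolding natural_chain_map_def P_def Q_def by blast
qed

lemma natural_chain_map_comp:
  assumes u: "natural_chain_map K \<nu> S.\<beta> L \<mu> T.\<beta> u" and v: "natural_chain_map L \<mu> T.\<beta> K \<nu> S.\<beta> v"
  shows "natural_chain_map K \<nu> S.\<beta> K \<nu> S.\<beta> (\<lambda>n. u n \<odot>\<^bsub>K n\<^esub> v n)"
  unfolding natural_chain_map_def
proof (intro allI conjI)
  have uc: "u n \<in> chains (L n) (K n)" and nuu: "\<nu> n \<odot>\<^bsub>L n\<^esub> u n = u n"
    and ub: "u (Suc n) \<odot>\<^bsub>L n\<^esub> T.\<beta> n = S.\<beta> n \<odot>\<^bsub>L n\<^esub> u n" for n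
    using u by (auto simp: natural_chain_map_def)
  have vc: "v n \<in> chains (K n) (L n)" and vnu: "v n \<odot>\<^bsub>K n\<^esub> \<nu> n = v n"
    and vb: "v (Suc n) \<odot>\<^bsub>K n\<^esub> S.\<beta> n = T.\<beta> n \<odot>\<^bsub>K n\<^esub> v n" for n
    using v by (auto simp: natural_chain_map_def)
  show "u n \<odot>\<^bsub>K n\<^esub> v n \<in> chains (K n) (K n)" for n
    using uc vc by auto
  show "\<nu> n \<odot>\<^bsub>K n\<^esub> (u n \<odot>\<^bsub>K n\<^esub> v n) = u n \<odot>\<^bsub>K n\<^esub> v n" for n
    using fcomp_assoc[OF vc, of "\<nu> n" n "u n"] by (simp add: nuu)
  show "u n \<odot>\<^bsub>K n\<^esub> v n \<odot>\<^bsub>K n\<^esub> \<nu> n = u n \<odot>\<^bsub>K n\<^esub> v n" for n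
    by (simp add: fcomp_assoc vnu)
  fix n
  have "u (Suc n) \<odot>\<^bsub>K (Suc n)\<^esub> v (Suc n) \<odot>\<^bsub>K n\<^esub> S.\<beta> n = (u (Suc n) \<odot>\<^bsub>L n\<^esub> T.\<beta> n) \<odot>\<^bsub>K n\<^esub> v n"
    using vc by (simp add: fcomp_assoc vb)
  then show "u (Suc n) \<odot>\<^bsub>K (Suc n)\<^esub> v (Suc n) \<odot>\<^bsub>K n\<^esub> S.\<beta> n = S.\<beta> n \<odot>\<^bsub>K n\<^esub> (u n \<odot>\<^bsub>K n\<^esub> v n)"
    using vc by (simp add: ub fcomp_assoc)
qed

text \<open>The part of \<open>u - v\<close> that the homotopy built so far leaves over is a
  normalised cycle on a model, hence a boundary. Equality of augmentations starts this in degree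
  0.\<close>

lemma natural_homotopy_exists:
  assumes ac: "\<And>n. model_acyclic L \<mu> T.\<beta> (K n)"
    and u: "natural_chain_map K \<nu> S.\<beta> L \<mu> T.\<beta> u" and v: "natural_chain_map K \<nu> S.\<beta> L \<mu> T.\<beta> v"
    and aug: "aug (u 0) = aug (v 0)"
  shows "\<exists>h. (\<forall>n. h n \<in> chains (L (Suc n)) (K n) \<and> \<nu> n \<odot>\<^bsub>L (Suc n)\<^esub> h n = h n) \<and>
    u 0 - v 0 = h 0 \<odot>\<^bsub>L 0\<^esub> T.\<beta> 0 \<and>
    (\<forall>n. u (Suc n) - v (Suc n) = h (Suc n) \<odot>\<^bsub>L (Suc n)\<^esub> T.\<beta> (Suc n) + S.\<beta> n \<odot>\<^bsub>L (Suc n)\<^esub> h n)"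
proof -
  have uc: "u n \<in> chains (L n) (K n)" and vc: "v n \<in> chains (L n) (K n)" for n
    using u v by (auto simp: natural_chain_map_def)
  have umu: "u n \<odot>\<^bsub>L n\<^esub> \<mu> n = u n" and vmu: "v n \<odot>\<^bsub>L n\<^esub> \<mu> n = v n"
    and nuu: "\<nu> n \<odot>\<^bsub>L n\<^esub> u n = u n" and nuv: "\<nu> n \<odot>\<^bsub>L n\<^esub> v n = v n"
    and ub: "u (Suc n) \<odot>\<^bsub>L n\<^esub> T.\<beta> n = S.\<beta> n \<odot>\<^bsub>L n\<^esub> u n"
    and vb: "v (Suc n) \<odot>\<^bsub>L n\<^esub> T.\<beta> n = S.\<beta> n \<odot>\<^bsub>L n\<^esub> v n" for n
    using u v by (auto simp: natural_chain_map_def)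
  \<comment> \<open>Again the invariant carries the condition that makes the next obstruction a
    cycle. It speaks of \<open>u n - v n - h \<odot> T.\<beta> n\<close>, which in positive degree
    is the contribution of the preceding homotopy, so that \<open>S.beta_beta\<close> preserves
    it.\<close>
  define P where "P n h \<longleftrightarrow> h \<in> chains (L (Suc n)) (K n) \<and> \<nu> n \<odot>\<^bsub>L (Suc n)\<^esub> h = h \<and>
     h \<odot>\<^bsub>L (Suc n)\<^esub> \<mu> (Suc n) = h \<and> S.\<beta> n \<odot>\<^bsub>L n\<^esub> (u n - v n - h \<odot>\<^bsub>L n\<^esub> T.\<beta> n) = 0 \<and>
     (n = 0 \<longrightarrow> u 0 - v 0 = h \<odot>\<^bsub>L 0\<^esub> T.\<beta> 0)"
    for n and h :: "('l \<Rightarrow> 'k) \<Rightarrow>\<^sub>0 int"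
  define Q where "Q n h h' \<longleftrightarrow>
     u (Suc n) - v (Suc n) = h' \<odot>\<^bsub>L (Suc n)\<^esub> T.\<beta> (Suc n) + S.\<beta> n \<odot>\<^bsub>L (Suc n)\<^esub> h"
    for n and h h' :: "('l \<Rightarrow> 'k) \<Rightarrow>\<^sub>0 int"
  have normalise: "\<exists>h\<in>chains (L (Suc n)) (K n). \<nu> n \<odot>\<^bsub>L (Suc n)\<^esub> h = h \<and>
     h \<odot>\<^bsub>L (Suc n)\<^esub> \<mu> (Suc n) = h \<and> h \<odot>\<^bsub>L n\<^esub> T.\<beta> n = c"
    if c: "\<nu> n \<odot>\<^bsub>L n\<^esub> c = c" and e: "e \<in> chains (L (Suc n)) (K n)" "e \<odot>\<^bsub>L n\<^esub> T.\<beta> n = c" for n c e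
  proof (intro bexI conjI)
    let ?h = "\<nu> n \<odot>\<^bsub>L (Suc n)\<^esub> (e \<odot>\<^bsub>L (Suc n)\<^esub> \<mu> (Suc n))"
    have e': "e \<odot>\<^bsub>L (Suc n)\<^esub> \<mu> (Suc n) \<in> chains (L (Suc n)) (K n)"
      using e by auto
    then show "?h \<in> chains (L (Suc n)) (K n)"
      by auto
    show "\<nu> n \<odot>\<^bsub>L (Suc n)\<^esub> ?h = ?h"
      using e' by (simp add: S.nu_nu flip: fcomp_assoc)
    show "?h \<odot>\<^bsub>L (Suc n)\<^esub> \<mu> (Suc n) = ?h"
      by (simp add: fcomp_assoc T.nu_nu)
    show "?h \<odot>\<^bsub>L n\<^esub> T.\<beta> n = c"
      by (simp add: fcomp_assoc T.nu_beta e c)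
  qed
  have "\<exists>h. \<forall>n. P n (h n) \<and> Q n (h n) (h (Suc n))"
  proof (rule dependent_nat_choice)
    have "aug (u 0 - v 0) = 0" "u 0 - v 0 \<in> chains (L 0) (K 0)"
      using aug uc vc by (auto simp: aug_diff)
    then obtain e where e: "e \<in> chains (L (Suc 0)) (K 0)" "e \<odot>\<^bsub>L 0\<^esub> T.\<beta> 0 = u 0 - v 0"
      using ac[of 0] unfolding model_acyclic_def by blast
    have "\<nu> 0 \<odot>\<^bsub>L 0\<^esub> (u 0 - v 0) = u 0 - v 0"
      by (simp add: fcomp_diff_right nuu nuv)
    from normalise[OF this e] show "\<exists>h. P 0 h"
      by (auto simp: P_def)
  next
    fix h n assume h: "P n h"
    have hc: "h \<in> chains (L (Suc n)) (K n)"
      using h by (simp add: P_def)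
    define c where "c = u (Suc n) - v (Suc n) - S.\<beta> n \<odot>\<^bsub>L (Suc n)\<^esub> h"
    have c: "c \<in> chains (L (Suc n)) (K (Suc n))"
      unfolding c_def using uc vc hc by (intro chains_diff) auto
    have cmu: "c \<odot>\<^bsub>L (Suc n)\<^esub> \<mu> (Suc n) = c"
      using h by (simp add: c_def fcomp_diff_left umu vmu fcomp_assoc P_def)
    have nuc: "\<nu> (Suc n) \<odot>\<^bsub>L (Suc n)\<^esub> c = c"
      using hc by (simp add: c_def fcomp_diff_right nuu nuv S.nu_beta flip: fcomp_assoc)
    have "c \<odot>\<^bsub>L n\<^esub> T.\<beta> n = S.\<beta> n \<odot>\<^bsub>L n\<^esub> (u n - v n - h \<odot>\<^bsub>L n\<^esub> T.\<beta> n)"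
      using hc by (simp add: c_def fcomp_diff_left fcomp_diff_right ub vb fcomp_assoc)
    also have "\<dots> = 0"
      using h by (simp add: P_def)
    finally obtain e where e: "e \<in> chains (L (Suc (Suc n))) (K (Suc n))"
        "e \<odot>\<^bsub>L (Suc n)\<^esub> T.\<beta> (Suc n) = c"
      using ac[of "Suc n"] c cmu unfolding model_acyclic_def by blast
    obtain h' where h': "h' \<in> chains (L (Suc (Suc n))) (K (Suc n))"
        "\<nu> (Suc n) \<odot>\<^bsub>L (Suc (Suc n))\<^esub> h' = h'" "h' \<odot>\<^bsub>L (Suc (Suc n))\<^esub> \<mu> (Suc (Suc n)) = h'"
        "h' \<odot>\<^bsub>L (Suc n)\<^esub> T.\<beta> (Suc n) = c"
      using normalise[OF nuc e] by blast
    have "S.\<beta> (Suc n) \<odot>\<^bsub>L (Suc n)\<^esub> (u (Suc n) - v (Suc n) - c)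
        = (S.\<beta> (Suc n) \<odot>\<^bsub>K n\<^esub> S.\<beta> n) \<odot>\<^bsub>L (Suc n)\<^esub> h"
      using hc by (simp add: c_def fcomp_assoc)
    then have "P (Suc n) h'"
      using h' by (simp add: P_def S.beta_beta)
    moreover have "Q n h h'"
      unfolding Q_def h'(4) by (simp add: c_def)
    ultimately show "\<exists>h'. P (Suc n) h' \<and> Q n h h'"
      by blast
  qed
  then show ?thesis
    unfolding P_def Q_def by blast
qed

end

section \<open>Complexes presented by a model theory\<close>

text \<open>Chains on the models present the complex: \<open>\<pi>\<close> identifies exactly those
  with the same normal form and turns precomposition with \<open>b\<close> into the boundary. For
  the simplicial complex \<open>\<pi>\<close> is the identity, for the cubical one the map to
  cosets.\<close>

locale presentation = model_theory K \<nu> b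
  for K :: "nat \<Rightarrow> 'k cspace" and \<nu> b +
  fixes X :: "'a cspace" and E :: "'e ccomplex" and \<pi> :: "nat \<Rightarrow> (('k \<Rightarrow> 'a) \<Rightarrow>\<^sub>0 int) \<Rightarrow> 'e"
  assumes grp: "comm_group (grp E n)"
    and proj_hom: "\<pi> n \<in> hom (free_Abelian_group (sing_maps (K n) X)) (grp E n)"
    and proj_surj: "\<pi> n ` chains (K n) X = carrier (grp E n)"
    and proj_ker: "c \<in> chains (K n) X \<Longrightarrow> \<pi> n c = \<one>\<^bsub>grp E n\<^esub> \<longleftrightarrow> c \<odot>\<^bsub>K n\<^esub> \<nu> n = 0"
    and bdry_proj: "c \<in> chains (K (Suc n)) X \<Longrightarrow> bdry E (Suc n) (\<pi> (Suc n) c) = \<pi> n (c \<odot>\<^bsub>K n\<^esub> b n)"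
begin

lemma group_grp: "group (grp E n)"
  using grp comm_group_def by blast

lemma proj_closed [simp, intro]: "c \<in> chains (K n) X \<Longrightarrow> \<pi> n c \<in> carrier (grp E n)"
  using proj_surj by blast

lemma proj_add:
  "c \<in> chains (K n) X \<Longrightarrow> c' \<in> chains (K n) X \<Longrightarrow> \<pi> n (c + c') = \<pi> n c \<otimes>\<^bsub>grp E n\<^esub> \<pi> n c'"
  using hom_mult[OF proj_hom] by (simp add: chains_def)

lemma proj_0 [simp]: "\<pi> n 0 = \<one>\<^bsub>grp E n\<^esub>"
  by (simp add: proj_ker)

lemma proj_diff:
  assumes c: "c \<in> chains (K n) X" and c': "c' \<in> chains (K n) X"
  shows "\<pi> n (c - c') = \<pi> n c \<otimes>\<^bsub>grp E n\<^esub> inv\<^bsub>grp E n\<^esub> \<pi> n c'"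
proof -
  interpret group "grp E n"
    by (rule group_grp)
  have "\<pi> n c = \<pi> n (c - c') \<otimes>\<^bsub>grp E n\<^esub> \<pi> n c'"
    using proj_add[of "c - c'" n c'] c c' by (simp add: chains_diff)
  then show ?thesis
    using c c' by (simp add: inv_solve_right chains_diff)
qed

lemma proj_eq_iff:
  assumes "c \<in> chains (K n) X" "c' \<in> chains (K n) X"
  shows "\<pi> n c = \<pi> n c' \<longleftrightarrow> c \<odot>\<^bsub>K n\<^esub> \<nu> n = c' \<odot>\<^bsub>K n\<^esub> \<nu> n"
proof -
  interpret group "grp E n"
    by (rule group_grp)
  have "\<pi> n c = \<pi> n c' \<longleftrightarrow> \<pi> n (c - c') = \<one>\<^bsub>grp E n\<^esub>"
    using assms by (simp add: proj_diff) (metis inv_closed inv_equality inv_inv proj_closed r_inv)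
  then show ?thesis
    using assms by (simp add: proj_ker chains_diff fcomp_diff_left)
qed

lemma proj_nu: "c \<in> chains (K n) X \<Longrightarrow> \<pi> n (c \<odot>\<^bsub>K n\<^esub> \<nu> n) = \<pi> n c"
  by (subst proj_eq_iff) (auto simp: fcomp_assoc nu_nu)

lemma bdry_hom: "bdry E (Suc n) \<in> hom (grp E (Suc n)) (grp E n)"
proof (rule homI)
  fix x assume "x \<in> carrier (grp E (Suc n))"
  then obtain c where c: "c \<in> chains (K (Suc n)) X" "x = \<pi> (Suc n) c"
    using proj_surj by blast
  then show "bdry E (Suc n) x \<in> carrier (grp E n)"
    by (auto simp: bdry_proj)
  fix y assume "y \<in> carrier (grp E (Suc n))"
  then obtain c' where c': "c' \<in> chains (K (Suc n)) X" "y = \<pi> (Suc n) c'"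
    using proj_surj by blast
  have "bdry E (Suc n) (\<pi> (Suc n) (c + c')) = \<pi> n (c \<odot>\<^bsub>K n\<^esub> b n) \<otimes>\<^bsub>grp E n\<^esub> \<pi> n (c' \<odot>\<^bsub>K n\<^esub> b n)"
    unfolding bdry_proj[OF chains_add[OF c(1) c'(1)]] fcomp_add_left
    using c c' by (intro proj_add) auto
  then show "bdry E (Suc n) (x \<otimes>\<^bsub>grp E (Suc n)\<^esub> y) = bdry E (Suc n) x \<otimes>\<^bsub>grp E n\<^esub> bdry E (Suc n) y"
    unfolding c(2) c'(2) proj_add[OF c(1) c'(1), symmetric] bdry_proj[OF c(1)] bdry_proj[OF c'(1)] .
qed

lemma chain_complex: "chain_complex E"
  unfolding chain_complex_def
proof (intro conjI allI ballI)
  fix n c assume "c \<in> carrier (grp E (Suc (Suc n)))"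
  then obtain c' where c': "c' \<in> chains (K (Suc (Suc n))) X" "c = \<pi> (Suc (Suc n)) c'"
    using proj_surj by blast
  have "c' \<odot>\<^bsub>K (Suc n)\<^esub> b (Suc n) \<in> chains (K (Suc n)) X"
    using c' by auto
  then show "bdry E (Suc n) (bdry E (Suc (Suc n)) c) = \<one>\<^bsub>grp E n\<^esub>"
    using c' by (simp add: bdry_proj fcomp_assoc b_b)
qed (auto simp: grp bdry_hom)

end

locale two_presentations =
  S: presentation K \<nu> b X E \<pi> + T: presentation L \<mu> d X F \<rho>
  for K :: "nat \<Rightarrow> 'k cspace" and \<nu> b and X :: "'a cspace" and E :: "'e ccomplex" and \<pi>
  and L :: "nat \<Rightarrow> 'l cspace" and \<mu> d and F :: "'f ccomplex" and \<rho>
begin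

text \<open>A homomorphism out of the quotient is defined on chosen representatives. The choice is
  harmless because \<open>w = \<nu> n \<odot> w\<close> makes \<open>c \<odot> w\<close> depend only
  on the normal form of \<open>c\<close>, which \<open>\<pi> n c\<close> determines.\<close>

lemma induced_hom:
  assumes w: "w \<in> chains (L m) (K n)" and nuw: "\<nu> n \<odot>\<^bsub>L m\<^esub> w = w"
  shows "\<exists>f. f \<in> hom (grp E n) (grp F m) \<and> (\<forall>c\<in>chains (K n) X. f (\<pi> n c) = \<rho> m (c \<odot>\<^bsub>L m\<^esub> w))"
proof (intro exI conjI ballI)
  define s where "s e = (SOME c. c \<in> chains (K n) X \<and> \<pi> n c = e)" for e
  have s: "s e \<in> chains (K n) X \<and> \<pi> n (s e) = e" if "e \<in> carrier (grp E n)" for e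
    unfolding s_def by (rule someI_ex) (use that S.proj_surj[of n] in \<open>metis imageE\<close>)
  define f where "f e = \<rho> m (s e \<odot>\<^bsub>L m\<^esub> w)" for e
  show f: "f (\<pi> n c) = \<rho> m (c \<odot>\<^bsub>L m\<^esub> w)" if c: "c \<in> chains (K n) X" for c
  proof -
    have "s (\<pi> n c) \<odot>\<^bsub>K n\<^esub> \<nu> n = c \<odot>\<^bsub>K n\<^esub> \<nu> n"
      using s[of "\<pi> n c"] c S.proj_eq_iff[of "s (\<pi> n c)" n c] by simp
    then have "s (\<pi> n c) \<odot>\<^bsub>L m\<^esub> w = c \<odot>\<^bsub>L m\<^esub> w"
      using fcomp_assoc[OF w, of "s (\<pi> n c)" "\<nu> n"] fcomp_assoc[OF w, of c "\<nu> n"] nuw by simp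
    then show ?thesis
      by (simp add: f_def)
  qed
  show "f \<in> hom (grp E n) (grp F m)"
  proof (rule homI)
    fix x assume x: "x \<in> carrier (grp E n)"
    then show "f x \<in> carrier (grp F m)"
      using s[of x] w by (auto simp: f_def)
    fix y assume y: "y \<in> carrier (grp E n)"
    have "f (x \<otimes>\<^bsub>grp E n\<^esub> y) = f (\<pi> n (s x + s y))"
      using x y s by (simp add: S.proj_add)
    also have "\<dots> = \<rho> m (s x \<odot>\<^bsub>L m\<^esub> w + s y \<odot>\<^bsub>L m\<^esub> w)"
      using x y s by (simp add: f chains_add fcomp_add_left)
    also have "\<dots> = f x \<otimes>\<^bsub>grp F m\<^esub> f y"
      unfolding f_def using s[OF x] s[OF y] w by (intro T.proj_add) auto
    finally show "f (x \<otimes>\<^bsub>grp E n\<^esub> y) = f x \<otimes>\<^bsub>grp F m\<^esub> f y" .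
  qed
qed

lemma induced_chain_morphism:
  assumes u: "natural_chain_map K \<nu> S.\<beta> L \<mu> T.\<beta> u"
  shows "\<exists>f. chain_morphism E F f \<and> (\<forall>n. \<forall>c\<in>chains (K n) X. f n (\<pi> n c) = \<rho> n (c \<odot>\<^bsub>L n\<^esub> u n))"
proof -
  have uc: "u n \<in> chains (L n) (K n)" and umu: "u n \<odot>\<^bsub>L n\<^esub> \<mu> n = u n"
    and nuu: "\<nu> n \<odot>\<^bsub>L n\<^esub> u n = u n"
    and ub: "u (Suc n) \<odot>\<^bsub>L n\<^esub> T.\<beta> n = S.\<beta> n \<odot>\<^bsub>L n\<^esub> u n" for n
    using u by (auto simp: natural_chain_map_def)
  have "\<forall>n. \<exists>f. f \<in> hom (grp E n) (grp F n) \<and> (\<forall>c\<in>chains (K n) X. f (\<pi> n c) = \<rho> n (c \<odot>\<^bsub>L n\<^esub> u n))"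
    using induced_hom uc nuu by blast
  then obtain f where f: "\<And>n. f n \<in> hom (grp E n) (grp F n)"
    "\<And>n c. c \<in> chains (K n) X \<Longrightarrow> f n (\<pi> n c) = \<rho> n (c \<odot>\<^bsub>L n\<^esub> u n)"
    by metis
  have "f n (bdry E (Suc n) e) = bdry F (Suc n) (f (Suc n) e)"
    if e: "e \<in> carrier (grp E (Suc n))" for n e
  proof -
    obtain c where c: "c \<in> chains (K (Suc n)) X" "e = \<pi> (Suc n) c"
      using S.proj_surj e by blast
    have cu: "c \<odot>\<^bsub>L (Suc n)\<^esub> u (Suc n) \<in> chains (L (Suc n)) X"
      using c uc by auto
    have "(c \<odot>\<^bsub>L (Suc n)\<^esub> u (Suc n)) \<odot>\<^bsub>L n\<^esub> d n \<odot>\<^bsub>L n\<^esub> \<mu> n = c \<odot>\<^bsub>L n\<^esub> (u (Suc n) \<odot>\<^bsub>L n\<^esub> T.\<beta> n)"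
      by (simp add: T.\<beta>_def fcomp_assoc)
    also have "\<dots> = c \<odot>\<^bsub>L n\<^esub> (b n \<odot>\<^bsub>L n\<^esub> u n)"
      unfolding ub S.\<beta>_def using uc by (simp add: fcomp_assoc nuu)
    finally have eq: "(c \<odot>\<^bsub>L (Suc n)\<^esub> u (Suc n)) \<odot>\<^bsub>L n\<^esub> d n \<odot>\<^bsub>L n\<^esub> \<mu> n = (c \<odot>\<^bsub>K n\<^esub> b n) \<odot>\<^bsub>L n\<^esub> u n"
      using uc by (simp add: fcomp_assoc)
    have "c \<odot>\<^bsub>K n\<^esub> b n \<in> chains (K n) X"
      using c by auto
    then have "f n (bdry E (Suc n) e) = \<rho> n ((c \<odot>\<^bsub>K n\<^esub> b n) \<odot>\<^bsub>L n\<^esub> u n)"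
      using c by (simp add: S.bdry_proj f(2))
    \<comment> \<open>The two chains are matched only after composing with \<open>\<mu> n\<close>;
      the projection \<open>\<rho>\<close> does not see the difference.\<close>
    also have "\<dots> = \<rho> n ((c \<odot>\<^bsub>L (Suc n)\<^esub> u (Suc n)) \<odot>\<^bsub>L n\<^esub> d n)"
      unfolding eq[symmetric] by (rule T.proj_nu) (use cu in auto)
    finally show ?thesis
      using c cu by (simp add: f(2) T.bdry_proj)
  qed
  then show ?thesis
    using f unfolding chain_morphism_def by blast
qed

lemma induced_chain_homotopy:
  assumes h: "\<And>n. h n \<in> chains (L (Suc n)) (K n)" "\<And>n. \<nu> n \<odot>\<^bsub>L (Suc n)\<^esub> h n = h n"
    and h0: "u 0 - v 0 = h 0 \<odot>\<^bsub>L 0\<^esub> T.\<beta> 0"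
    and hs: "\<And>n. u (Suc n) - v (Suc n) =
                   h (Suc n) \<odot>\<^bsub>L (Suc n)\<^esub> T.\<beta> (Suc n) + S.\<beta> n \<odot>\<^bsub>L (Suc n)\<^esub> h n"
    and u: "\<And>n. u n \<in> chains (L n) (K n)" and v: "\<And>n. v n \<in> chains (L n) (K n)"
    and f: "\<And>n c. c \<in> chains (K n) X \<Longrightarrow> f n (\<pi> n c) = \<rho> n (c \<odot>\<^bsub>L n\<^esub> u n)"
    and g: "\<And>n c. c \<in> chains (K n) X \<Longrightarrow> g n (\<pi> n c) = \<rho> n (c \<odot>\<^bsub>L n\<^esub> v n)"
  shows "chain_homotopic E F f g"
proof -
  have "\<forall>n. \<exists>H. H \<in> hom (grp E n) (grp F (Suc n)) \<and>
      (\<forall>c\<in>chains (K n) X. H (\<pi> n c) = \<rho> (Suc n) (c \<odot>\<^bsub>L (Suc n)\<^esub> h n))"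
    using induced_hom h by blast
  then obtain H where H: "\<And>n. H n \<in> hom (grp E n) (grp F (Suc n))"
    "\<And>n c. c \<in> chains (K n) X \<Longrightarrow> H n (\<pi> n c) = \<rho> (Suc n) (c \<odot>\<^bsub>L (Suc n)\<^esub> h n)"
    by metis
  have fg: "f n (\<pi> n c) \<otimes>\<^bsub>grp F n\<^esub> inv\<^bsub>grp F n\<^esub> g n (\<pi> n c) = \<rho> n (c \<odot>\<^bsub>L n\<^esub> (u n - v n))"
    if c: "c \<in> chains (K n) X" for n c
    using c u v by (simp add: f g fcomp_diff_right T.proj_diff fcomp_chains)
  have bh: "bdry F (Suc n) (H n (\<pi> n c)) = \<rho> n (c \<odot>\<^bsub>L n\<^esub> (h n \<odot>\<^bsub>L n\<^esub> T.\<beta> n))"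
    if c: "c \<in> chains (K n) X" for n c
  proof -
    have ch: "c \<odot>\<^bsub>L (Suc n)\<^esub> h n \<in> chains (L (Suc n)) X"
      using c h by auto
    then have "bdry F (Suc n) (H n (\<pi> n c)) = \<rho> n ((c \<odot>\<^bsub>L (Suc n)\<^esub> h n) \<odot>\<^bsub>L n\<^esub> d n)"
      using c by (simp add: H(2) T.bdry_proj)
    also have "\<dots> = \<rho> n ((c \<odot>\<^bsub>L (Suc n)\<^esub> h n) \<odot>\<^bsub>L n\<^esub> d n \<odot>\<^bsub>L n\<^esub> \<mu> n)"
      by (rule T.proj_nu[symmetric]) (use ch in auto)
    finally show ?thesis
      by (simp add: T.\<beta>_def fcomp_assoc)
  qed
  show ?thesis
    unfolding chain_homotopic_def
  proof (intro exI[of _ H] conjI allI ballI)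
    fix e assume "e \<in> carrier (grp E 0)"
    then obtain c where c: "c \<in> chains (K 0) X" "e = \<pi> 0 c"
      using S.proj_surj by blast
    then show "f 0 e \<otimes>\<^bsub>grp F 0\<^esub> inv\<^bsub>grp F 0\<^esub> g 0 e = bdry F (Suc 0) (H 0 e)"
      using fg bh h0 by simp
  next
    fix n e assume "e \<in> carrier (grp E (Suc n))"
    then obtain c where c: "c \<in> chains (K (Suc n)) X" "e = \<pi> (Suc n) c"
      using S.proj_surj by blast
    have cb: "c \<odot>\<^bsub>K n\<^esub> b n \<in> chains (K n) X"
      using c by auto
    then have "H n (bdry E (Suc n) e) = \<rho> (Suc n) ((c \<odot>\<^bsub>K n\<^esub> b n) \<odot>\<^bsub>L (Suc n)\<^esub> h n)"
      using c by (simp add: S.bdry_proj H(2))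
    also have "(c \<odot>\<^bsub>K n\<^esub> b n) \<odot>\<^bsub>L (Suc n)\<^esub> h n = c \<odot>\<^bsub>L (Suc n)\<^esub> (S.\<beta> n \<odot>\<^bsub>L (Suc n)\<^esub> h n)"
      using h by (simp add: S.\<beta>_def fcomp_assoc)
    finally have Hb: "H n (bdry E (Suc n) e) = \<rho> (Suc n) (c \<odot>\<^bsub>L (Suc n)\<^esub> (S.\<beta> n \<odot>\<^bsub>L (Suc n)\<^esub> h n))" .
    have "\<rho> (Suc n) (c \<odot>\<^bsub>L (Suc n)\<^esub> (h (Suc n) \<odot>\<^bsub>L (Suc n)\<^esub> T.\<beta> (Suc n) + S.\<beta> n \<odot>\<^bsub>L (Suc n)\<^esub> h n)) =
        \<rho> (Suc n) (c \<odot>\<^bsub>L (Suc n)\<^esub> (h (Suc n) \<odot>\<^bsub>L (Suc n)\<^esub> T.\<beta> (Suc n))) \<otimes>\<^bsub>grp F (Suc n)\<^esub>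
        \<rho> (Suc n) (c \<odot>\<^bsub>L (Suc n)\<^esub> (S.\<beta> n \<odot>\<^bsub>L (Suc n)\<^esub> h n))"
      unfolding fcomp_add_right
      by (intro T.proj_add fcomp_chains[OF T.space c(1)] fcomp_chains[OF T.space h(1)]
          fcomp_chains[OF T.space S.beta_chains h(1)] T.beta_chains)
    then show "f (Suc n) e \<otimes>\<^bsub>grp F (Suc n)\<^esub> inv\<^bsub>grp F (Suc n)\<^esub> g (Suc n) e =
        bdry F (Suc (Suc n)) (H (Suc n) e) \<otimes>\<^bsub>grp F (Suc n)\<^esub> H n (bdry E (Suc n) e)"
      using c fg bh hs Hb by simp
  qed (use H in auto)
qed

end

lemma (in presentation) self: "two_presentations K \<nu> b X E \<pi> K \<nu> b E \<pi>"
  by unfold_locales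

text \<open>On \<open>E\<close> the identity is induced by \<open>\<nu>\<close>, since
  \<open>\<pi>\<close> identifies \<open>c \<odot> \<nu> n\<close> with \<open>c\<close>. So the
  homotopy to construct runs between \<open>u \<odot> v\<close> and \<open>\<nu>\<close>, two
  natural chain maps of augmentation 1.\<close>

lemma (in two_presentations) comp_homotopic_id:
  assumes ac: "\<And>n. model_acyclic K \<nu> S.\<beta> (K n)"
    and u: "natural_chain_map K \<nu> S.\<beta> L \<mu> T.\<beta> u" "aug (u 0) = 1"
    and v: "natural_chain_map L \<mu> T.\<beta> K \<nu> S.\<beta> v" "aug (v 0) = 1"
    and f: "\<And>n c. c \<in> chains (K n) X \<Longrightarrow> f n (\<pi> n c) = \<rho> n (c \<odot>\<^bsub>L n\<^esub> u n)"
    and g: "\<And>n c. c \<in> chains (L n) X \<Longrightarrow> g n (\<rho> n c) = \<pi> n (c \<odot>\<^bsub>K n\<^esub> v n)"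
  shows "chain_homotopic E E (\<lambda>n. g n \<circ> f n) (\<lambda>n. id)"
proof -
  interpret P: two_presentations K \<nu> b X E \<pi> K \<nu> b E \<pi>
    by (rule S.self)
  interpret PM: two_model_theories K \<nu> b K \<nu> b ..
  interpret ST: two_model_theories K \<nu> b L \<mu> d ..
  let ?w = "\<lambda>n. u n \<odot>\<^bsub>K n\<^esub> v n"
  have w: "natural_chain_map K \<nu> S.\<beta> K \<nu> S.\<beta> ?w"
    using ST.natural_chain_map_comp u v by blast
  have "aug (?w 0) = aug (\<nu> 0)"
    using u v by (simp add: aug_fcomp S.nu_0)
  from PM.natural_homotopy_exists[OF ac w S.natural_chain_map_nu this]
  obtain h where h: "\<And>n. h n \<in> chains (K (Suc n)) (K n)" "\<And>n. \<nu> n \<odot>\<^bsub>K (Suc n)\<^esub> h n = h n"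
    and h0: "?w 0 - \<nu> 0 = h 0 \<odot>\<^bsub>K 0\<^esub> S.\<beta> 0"
    and hs: "\<And>n. ?w (Suc n) - \<nu> (Suc n) =
                   h (Suc n) \<odot>\<^bsub>K (Suc n)\<^esub> S.\<beta> (Suc n) + S.\<beta> n \<odot>\<^bsub>K (Suc n)\<^esub> h n"
    by blast
  have uc: "u n \<in> chains (L n) (K n)" and vc: "v n \<in> chains (K n) (L n)" for n
    using u v by (auto simp: natural_chain_map_def)
  show ?thesis
  proof (rule P.induced_chain_homotopy[where u = ?w and v = \<nu>, OF h h0 hs])
    fix n c assume c: "c \<in> chains (K n) X"
    then have "c \<odot>\<^bsub>L n\<^esub> u n \<in> chains (L n) X"
      using uc by auto
    then show "(g n \<circ> f n) (\<pi> n c) = \<pi> n (c \<odot>\<^bsub>K n\<^esub> (u n \<odot>\<^bsub>K n\<^esub> v n))"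
      using c vc by (simp add: f g fcomp_assoc)
    show "id (\<pi> n c) = \<pi> n (c \<odot>\<^bsub>K n\<^esub> \<nu> n)"
      using c by (simp add: S.proj_nu)
  qed (use uc vc in auto)
qed

text \<open>\<open>LK\<close> extends \<open>p\<close> to the chain map from \<open>E\<close> to
  \<open>F\<close>, and \<open>KL\<close> extends \<open>q\<close> to the one back;
  \<open>KK\<close> and \<open>LL\<close> give the homotopies for the two composites. Starting from
  single maps \<open>p\<close> and \<open>q\<close> fixes the augmentations to 1.\<close>

theorem (in two_presentations) acyclic_models_equivalence:
  assumes KK: "\<And>n. model_acyclic K \<nu> S.\<beta> (K n)" and KL: "\<And>n. model_acyclic K \<nu> S.\<beta> (L n)"
    and LK: "\<And>n. model_acyclic L \<mu> T.\<beta> (K n)" and LL: "\<And>n. model_acyclic L \<mu> T.\<beta> (L n)"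
    and p: "p \<in> sing_maps (L 0) (K 0)" and q: "q \<in> sing_maps (K 0) (L 0)"
  shows "E \<simeq>\<^sub>c F"
proof -
  interpret ST: two_model_theories K \<nu> b L \<mu> d ..
  interpret TS: two_model_theories L \<mu> d K \<nu> b ..
  interpret R: two_presentations L \<mu> d X F \<rho> K \<nu> b E \<pi> ..
  obtain u where u: "natural_chain_map K \<nu> S.\<beta> L \<mu> T.\<beta> u" "aug (u 0) = 1"
    using ST.natural_chain_map_exists[OF LK p] by blast
  obtain v where v: "natural_chain_map L \<mu> T.\<beta> K \<nu> S.\<beta> v" "aug (v 0) = 1"
    using TS.natural_chain_map_exists[OF KL q] by blast
  obtain f where f: "chain_morphism E F f"
      "\<And>n c. c \<in> chains (K n) X \<Longrightarrow> f n (\<pi> n c) = \<rho> n (c \<odot>\<^bsub>L n\<^esub> u n)"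
    using induced_chain_morphism[OF u(1)] by blast
  obtain g where g: "chain_morphism F E g"
      "\<And>n c. c \<in> chains (L n) X \<Longrightarrow> g n (\<rho> n c) = \<pi> n (c \<odot>\<^bsub>K n\<^esub> v n)"
    using R.induced_chain_morphism[OF v(1)] by blast
  show ?thesis
    unfolding chain_homotopy_equivalent_def
    using S.chain_complex T.chain_complex f(1) g(1)
      comp_homotopic_id[OF KK u v f(2) g(2)] R.comp_homotopic_id[OF LL v u g(2) f(2)]
    by blast
qed

section \<open>Alternating sums of faces and contracting cones\<close>

text \<open>Pairing \<open>(i, j)\<close> for \<open>j < i\<close> with \<open>(j, i - 1)\<close>
  matches equal chains with opposite signs, since the index sum drops by one. Simplicial and cubical
  boundaries both square to zero by this cancellation.\<close>

lemma alternating_sum_eq_0: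
  fixes g :: "nat \<Rightarrow> nat \<Rightarrow> 'a \<Rightarrow>\<^sub>0 int"
  assumes g: "\<And>i j. j < i \<Longrightarrow> i \<le> Suc r \<Longrightarrow> g i j = g j (i - 1)"
  shows "(\<Sum>i\<le>Suc r. \<Sum>j\<le>r. frag_cmul ((-1) ^ (i + j)) (g i j)) = 0"
proof -
  define h where "h = (\<lambda>(i, j). frag_cmul ((-1) ^ (i + j)) (g i j))"
  define A where "A = {(i, j). i \<le> Suc r \<and> j < i}"
  define B where "B = {(i, j). i \<le> j \<and> j \<le> r}"
  have "A \<subseteq> {..Suc r} \<times> {..Suc r}" "B \<subseteq> {..Suc r} \<times> {..Suc r}"
    by (auto simp: A_def B_def)
  then have fin: "finite A" "finite B"
    by (meson finite_SigmaI finite_atMost finite_subset)+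
  have "(\<Sum>i\<le>Suc r. \<Sum>j\<le>r. h (i, j)) = sum h ({..Suc r} \<times> {..r})"
    by (simp add: sum.cartesian_product)
  also have "{..Suc r} \<times> {..r} = A \<union> B"
  proof (rule Set.set_eqI)
    fix p :: "nat \<times> nat"
    obtain i j where "p = (i, j)"
      by (cases p)
    then show "p \<in> {..Suc r} \<times> {..r} \<longleftrightarrow> p \<in> A \<union> B"
      by (simp add: A_def B_def) linarith
  qed
  also have "sum h (A \<union> B) = sum h A + sum h B"
    by (rule sum.union_disjoint[OF fin]) (auto simp: A_def B_def)
  also have "sum h A = (\<Sum>p\<in>B. - h p)"
  proof (rule sum.reindex_bij_witness[where i = "\<lambda>(a, b). (Suc b, a)" and j = "\<lambda>(i, j). (j, i - 1)"])
    fix p assume "p \<in> A"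
    then obtain i j where p: "p = (i, j)" "j < i" "i \<le> Suc r"
      by (auto simp: A_def)
    then have "(-1) ^ (i + j) = - ((-1) ^ (j + (i - 1)) :: int)"
      by (cases i) (auto simp: add.commute)
    then show "- h (case p of (i, j) \<Rightarrow> (j, i - 1)) = h p"
      using p g[of j i] by (simp add: h_def)
  qed (auto simp: A_def B_def)
  finally show ?thesis
    by (simp add: h_def sum_negf)
qed

lemma alternating_fcomp_eq_0:
  assumes "\<And>i j. j < i \<Longrightarrow> i \<le> Suc r \<Longrightarrow> F i \<odot>\<^bsub>K\<^esub> G j = F j \<odot>\<^bsub>K\<^esub> G (i - 1)"
  shows "(\<Sum>i\<le>Suc r. frag_cmul ((-1) ^ i) (F i)) \<odot>\<^bsub>K\<^esub> (\<Sum>j\<le>r. frag_cmul ((-1) ^ j) (G j)) = 0"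
proof -
  have "(\<Sum>i\<le>Suc r. frag_cmul ((-1) ^ i) (F i)) \<odot>\<^bsub>K\<^esub> (\<Sum>j\<le>r. frag_cmul ((-1) ^ j) (G j)) =
      (\<Sum>i\<le>Suc r. \<Sum>j\<le>r. frag_cmul ((-1) ^ (i + j)) (F i \<odot>\<^bsub>K\<^esub> G j))"
    unfolding fcomp_sum_left[OF finite_atMost]
    by (simp add: fcomp_sum_right fcomp_cmul_left fcomp_cmul_right frag_cmul_sum power_add
        mult.commute del: sum.atMost_Suc)
  then show ?thesis
    using alternating_sum_eq_0[of r "\<lambda>i j. F i \<odot>\<^bsub>K\<^esub> G j"] assms by simp
qed

text \<open>Face 0 undoes the cone and gives \<open>d\<close>. Shifting the index of the other faces
  flips their signs, so the boundary of the cone is \<open>d\<close> minus the cone of the boundary.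
  For simplices \<open>d\<close> is the original simplex, for cubes the difference of the two ends
  of a homotopy.\<close>

lemma alternating_cone:
  assumes F0: "c \<odot>\<^bsub>K\<^esub> F 0 = d" and FS: "\<And>i. i \<le> r \<Longrightarrow> c \<odot>\<^bsub>K\<^esub> F (Suc i) = frag_extend k (s \<odot>\<^bsub>L\<^esub> G i)"
  shows "c \<odot>\<^bsub>K\<^esub> (\<Sum>i\<le>Suc r. frag_cmul ((-1) ^ i) (F i)) =
    d - frag_extend k (s \<odot>\<^bsub>L\<^esub> (\<Sum>i\<le>r. frag_cmul ((-1) ^ i) (G i)))"
proof -
  have "c \<odot>\<^bsub>K\<^esub> (\<Sum>i\<le>Suc r. frag_cmul ((-1) ^ i) (F i)) =
      d + (\<Sum>i\<le>r. frag_cmul (- ((-1) ^ i)) (frag_extend k (s \<odot>\<^bsub>L\<^esub> G i)))"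
    unfolding sum.atMost_Suc_shift fcomp_add_right fcomp_sum_right[OF finite_atMost] fcomp_cmul_right
    by (simp add: F0 FS)
  also have "(\<Sum>i\<le>r. frag_cmul (- ((-1) ^ i)) (frag_extend k (s \<odot>\<^bsub>L\<^esub> G i))) =
      - frag_extend k (s \<odot>\<^bsub>L\<^esub> (\<Sum>i\<le>r. frag_cmul ((-1) ^ i) (G i)))"
    by (simp add: fcomp_sum_right fcomp_cmul_right frag_extend_sum frag_extend_cmul
        minus_frag_cmul[symmetric] sum_negf o_def del: minus_frag_cmul)
  finally show ?thesis
    by simp
qed

text \<open>\<open>k\<close> extends to a contracting homotopy: the boundary of a cone is the chain
  itself minus the cone of its boundary, with \<open>w\<close> as the correction in degree 0. In
  positive degrees this is asked only modulo degenerate chains, and \<open>degenerate\<close> lets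
  \<open>k\<close> descend to the quotient.\<close>

lemma (in model_theory) model_acyclic_cone:
  fixes M :: "'m cspace"
  assumes k: "\<And>m \<sigma>. \<sigma> \<in> sing_maps (K m) M \<Longrightarrow> k m \<sigma> \<in> sing_maps (K (Suc m)) M"
    and base: "\<And>\<sigma>. \<sigma> \<in> sing_maps (K 0) M \<Longrightarrow> frag_of (k 0 \<sigma>) \<odot>\<^bsub>K 0\<^esub> b 0 = frag_of \<sigma> - w"
    and step: "\<And>m \<sigma>. \<sigma> \<in> sing_maps (K (Suc m)) M \<Longrightarrow>
      frag_of (k (Suc m) \<sigma>) \<odot>\<^bsub>K (Suc m)\<^esub> b (Suc m) \<odot>\<^bsub>K (Suc m)\<^esub> \<nu> (Suc m) =
      (frag_of \<sigma> - frag_extend (\<lambda>\<tau>. frag_of (k m \<tau>)) (frag_of \<sigma> \<odot>\<^bsub>K m\<^esub> b m)) \<odot>\<^bsub>K (Suc m)\<^esub> \<nu> (Suc m)"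
    and degenerate: "\<And>m c. c \<in> chains (K m) M \<Longrightarrow> c \<odot>\<^bsub>K m\<^esub> \<nu> m = 0 \<Longrightarrow>
      frag_extend (\<lambda>\<tau>. frag_of (k m \<tau>)) c \<odot>\<^bsub>K (Suc m)\<^esub> \<nu> (Suc m) = 0"
  shows "model_acyclic K \<nu> \<beta> M"
  unfolding model_acyclic_def
proof (intro conjI ballI impI allI)
  let ?k = "\<lambda>m. frag_extend (\<lambda>\<tau>. frag_of (k m \<tau>))"
  have kc: "?k m c \<in> chains (K (Suc m)) M" if "c \<in> chains (K m) M" for m c
    by (rule chains_frag_extend[OF _ that]) (simp add: k)
  {
    fix c assume c: "c \<in> chains (K 0) M" "aug c = 0"
    \<comment> \<open>Each generator contributes one copy of \<open>w\<close>, so the error is the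
      augmentation times \<open>w\<close>, which is zero here.\<close>
    have "?k 0 c \<odot>\<^bsub>K 0\<^esub> b 0 = c - frag_cmul (aug c) w"
      using c(1) by (induction rule: chains_induct)
        (simp_all add: base frag_extend_diff fcomp_diff_left aug_diff frag_cmul_diff_distrib algebra_simps)
    then have "?k 0 c \<odot>\<^bsub>K 0\<^esub> \<beta> 0 = c"
      using c fcomp_idc_right[OF b_chains[of 0]] by (simp add: \<beta>_def nu_0)
    then show "\<exists>e\<in>chains (K (Suc 0)) M. e \<odot>\<^bsub>K 0\<^esub> \<beta> 0 = c"
      using kc c by blast
  next
    fix m c assume c: "c \<in> chains (K (Suc m)) M" "c \<odot>\<^bsub>K (Suc m)\<^esub> \<nu> (Suc m) = c" "c \<odot>\<^bsub>K m\<^esub> \<beta> m = 0"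
    have "?k (Suc m) c \<odot>\<^bsub>K (Suc m)\<^esub> b (Suc m) \<odot>\<^bsub>K (Suc m)\<^esub> \<nu> (Suc m) =
        c \<odot>\<^bsub>K (Suc m)\<^esub> \<nu> (Suc m) - ?k m (c \<odot>\<^bsub>K m\<^esub> b m) \<odot>\<^bsub>K (Suc m)\<^esub> \<nu> (Suc m)"
      using c(1) by (induction rule: chains_induct) (simp_all add: step frag_extend_diff fcomp_diff_left)
    also have "\<dots> = c - ?k m (c \<odot>\<^bsub>K m\<^esub> b m) \<odot>\<^bsub>K (Suc m)\<^esub> \<nu> (Suc m)"
      by (simp add: c)
    \<comment> \<open>The cycle hypothesis says only that the boundary of \<open>c\<close> is
      degenerate, so what has to vanish is the normal form of its cone.\<close>
    also have "?k m (c \<odot>\<^bsub>K m\<^esub> b m) \<odot>\<^bsub>K (Suc m)\<^esub> \<nu> (Suc m) = 0"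
      using c by (intro degenerate) (auto simp: \<beta>_def fcomp_assoc)
    finally have "?k (Suc m) c \<odot>\<^bsub>K (Suc m)\<^esub> \<beta> (Suc m) = c"
      by (simp add: \<beta>_def fcomp_assoc)
    then show "\<exists>e\<in>chains (K (Suc (Suc m))) M. e \<odot>\<^bsub>K (Suc m)\<^esub> \<beta> (Suc m) = c"
      using kc c by blast
  }
qed

section \<open>Simplicial chains\<close>

text \<open>The boundary of the identity simplex of \<open>\<Delta> (Suc n)\<close>, hence the
  universal chain that computes the boundary of every simplex.\<close>

definition simplicial_faces :: "(nat \<Rightarrow> 'c cspace) \<Rightarrow> (nat \<Rightarrow> 'c \<Rightarrow> 'c) \<Rightarrow> nat \<Rightarrow> ('c \<Rightarrow> 'c) \<Rightarrow>\<^sub>0 int" where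
  "simplicial_faces \<Delta> \<delta> n =
     (\<Sum>i\<le>Suc n. frag_cmul ((-1) ^ i) (frag_of (restrict (\<delta> i) (points (\<Delta> n)))))"

locale simplicial_models =
  fixes \<Delta> :: "nat \<Rightarrow> 'c cspace" and \<delta> :: "nat \<Rightarrow> 'c \<Rightarrow> 'c"
  assumes closure_space_simplex: "closure_space (\<Delta> n)"
    and continuous_face: "i \<le> Suc n \<Longrightarrow> cs_continuous (\<Delta> n) (\<Delta> (Suc n)) (\<delta> i)"
    and face_face: "j < i \<Longrightarrow> \<delta> i (\<delta> j x) = \<delta> j (\<delta> (i - 1) x)"
begin

lemma face_sing_maps: "i \<le> Suc n \<Longrightarrow> restrict (\<delta> i) (points (\<Delta> n)) \<in> sing_maps (\<Delta> n) (\<Delta> (Suc n))"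
  by (simp add: restrict_in_sing_maps closure_space_simplex continuous_face)

lemma face_points: "i \<le> Suc n \<Longrightarrow> x \<in> points (\<Delta> n) \<Longrightarrow> \<delta> i x \<in> points (\<Delta> (Suc n))"
  using continuous_face by (auto simp: cs_continuous_def)

sublocale model_theory \<Delta> "\<lambda>n. idc (\<Delta> n)" "simplicial_faces \<Delta> \<delta>"
proof
  fix n
  show chains: "simplicial_faces \<Delta> \<delta> n \<in> chains (\<Delta> n) (\<Delta> (Suc n))" for n
    unfolding simplicial_faces_def
    by (intro chains_sum chains_cmul) (simp add: face_sing_maps)
  show "simplicial_faces \<Delta> \<delta> (Suc n) \<odot>\<^bsub>\<Delta> n\<^esub> simplicial_faces \<Delta> \<delta> n = 0"
    unfolding simplicial_faces_def
  proof (rule alternating_fcomp_eq_0)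
    fix i j assume ij: "j < i" "i \<le> Suc (Suc n)"
    then have "compose (points (\<Delta> n)) (restrict (\<delta> i) (points (\<Delta> (Suc n)))) (restrict (\<delta> j) (points (\<Delta> n))) =
        compose (points (\<Delta> n)) (restrict (\<delta> j) (points (\<Delta> (Suc n)))) (restrict (\<delta> (i - 1)) (points (\<Delta> n)))"
      by (intro ext) (auto simp: compose_def face_points face_face[OF ij(1)])
    then show "frag_of (restrict (\<delta> i) (points (\<Delta> (Suc n)))) \<odot>\<^bsub>\<Delta> n\<^esub> frag_of (restrict (\<delta> j) (points (\<Delta> n))) =
        frag_of (restrict (\<delta> j) (points (\<Delta> (Suc n)))) \<odot>\<^bsub>\<Delta> n\<^esub> frag_of (restrict (\<delta> (i - 1)) (points (\<Delta> n)))"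
      by simp
  qed
  show "idc (\<Delta> (Suc n)) \<odot>\<^bsub>\<Delta> n\<^esub> (simplicial_faces \<Delta> \<delta> n \<odot>\<^bsub>\<Delta> n\<^esub> idc (\<Delta> n)) =
      simplicial_faces \<Delta> \<delta> n \<odot>\<^bsub>\<Delta> n\<^esub> idc (\<Delta> n)"
    using chains[of n] by (simp add: fcomp_idc_right fcomp_idc_left)
qed (simp_all add: closure_space_simplex fcomp_idc_right[OF idc_chains] simplicial_faces_def aug_diff)

lemma presentation_simplicial_complex:
  fixes X :: "'x cspace"
  shows "presentation \<Delta> (\<lambda>n. idc (\<Delta> n)) (simplicial_faces \<Delta> \<delta>) X (simplicial_complex \<Delta> \<delta> X) (\<lambda>n c. c)"
proof (intro presentation.intro presentation_axioms.intro model_theory_axioms)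
  fix n
  show "comm_group (grp (simplicial_complex \<Delta> \<delta> X) n)"
    by (simp add: simplicial_complex_def abelian_free_Abelian_group)
  show "(\<lambda>c. c) \<in> hom (free_Abelian_group (sing_maps (\<Delta> n) X)) (grp (simplicial_complex \<Delta> \<delta> X) n)"
    by (auto simp: hom_def simplicial_complex_def)
  show "(\<lambda>c. c) ` chains (\<Delta> n) X = carrier (grp (simplicial_complex \<Delta> \<delta> X) n)"
    by (simp add: simplicial_complex_def carrier_chains)
  fix c
  show "(c = \<one>\<^bsub>grp (simplicial_complex \<Delta> \<delta> X) n\<^esub>) = (c \<odot>\<^bsub>\<Delta> n\<^esub> idc (\<Delta> n) = 0)"
    if "c \<in> chains (\<Delta> n) X"
    using that by (simp add: simplicial_complex_def fcomp_idc_right)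
  have "compose (points (\<Delta> n)) \<sigma> (restrict (\<delta> i) (points (\<Delta> n))) = restrict (\<sigma> \<circ> \<delta> i) (points (\<Delta> n))"
    for \<sigma> :: "'c \<Rightarrow> 'x" and i
    by (auto simp: compose_def)
  then show "bdry (simplicial_complex \<Delta> \<delta> X) (Suc n) c = c \<odot>\<^bsub>\<Delta> n\<^esub> simplicial_faces \<Delta> \<delta> n"
    by (induction c rule: frag_induction[OF subset_UNIV])
      (simp_all add: fcomp_diff_left simplicial_complex_def frag_extend_diff simplicial_faces_def
        fcomp_sum_right fcomp_cmul_right atLeast0AtMost del: sum.atMost_Suc)
qed

text \<open>The hypotheses describe a cone whose apex is the new vertex 0: face 0 gives
  \<open>\<sigma>\<close> back, face \<open>Suc i\<close> is the cone of face \<open>i\<close>, and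
  the remaining face of a coned vertex is the fixed apex \<open>w\<close>.\<close>

lemma model_acyclic_simplicial_cone:
  fixes M :: "'m cspace"
  assumes k: "\<And>m \<sigma>. \<sigma> \<in> sing_maps (\<Delta> m) M \<Longrightarrow> k m \<sigma> \<in> sing_maps (\<Delta> (Suc m)) M"
    and face_0: "\<And>m \<sigma>. \<sigma> \<in> sing_maps (\<Delta> m) M \<Longrightarrow> compose (points (\<Delta> m)) (k m \<sigma>) (\<delta> 0) = \<sigma>"
    and face_1: "\<And>\<sigma>. \<sigma> \<in> sing_maps (\<Delta> 0) M \<Longrightarrow> compose (points (\<Delta> 0)) (k 0 \<sigma>) (\<delta> 1) = w"
    and face_Suc: "\<And>m \<sigma> i. \<sigma> \<in> sing_maps (\<Delta> (Suc m)) M \<Longrightarrow> i \<le> Suc m \<Longrightarrow>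
      compose (points (\<Delta> (Suc m))) (k (Suc m) \<sigma>) (\<delta> (Suc i)) = k m (compose (points (\<Delta> m)) \<sigma> (\<delta> i))"
  shows "model_acyclic \<Delta> (\<lambda>n. idc (\<Delta> n)) \<beta> M"
proof (rule model_acyclic_cone[where k = k and w = "frag_of w"])
  have restr: "compose A f (restrict g A) = compose A f g" for A and f :: "'c \<Rightarrow> 'm" and g :: "'c \<Rightarrow> 'c"
    by (auto simp: compose_def)
  show "frag_of (k 0 \<sigma>) \<odot>\<^bsub>\<Delta> 0\<^esub> simplicial_faces \<Delta> \<delta> 0 = frag_of \<sigma> - frag_of w"
    if "\<sigma> \<in> sing_maps (\<Delta> 0) M" for \<sigma>
    using that face_0[of \<sigma> 0] face_1[of \<sigma>]
    by (simp add: simplicial_faces_def fcomp_diff_right restr)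
  show "frag_of (k (Suc m) \<sigma>) \<odot>\<^bsub>\<Delta> (Suc m)\<^esub> simplicial_faces \<Delta> \<delta> (Suc m) \<odot>\<^bsub>\<Delta> (Suc m)\<^esub> idc (\<Delta> (Suc m)) =
      (frag_of \<sigma> - frag_extend (\<lambda>\<tau>. frag_of (k m \<tau>)) (frag_of \<sigma> \<odot>\<^bsub>\<Delta> m\<^esub> simplicial_faces \<Delta> \<delta> m))
       \<odot>\<^bsub>\<Delta> (Suc m)\<^esub> idc (\<Delta> (Suc m))"
    if "\<sigma> \<in> sing_maps (\<Delta> (Suc m)) M" for m \<sigma>
  proof -
    have "frag_of (k (Suc m) \<sigma>) \<odot>\<^bsub>\<Delta> (Suc m)\<^esub> simplicial_faces \<Delta> \<delta> (Suc m) =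
      frag_of \<sigma> - frag_extend (\<lambda>\<tau>. frag_of (k m \<tau>)) (frag_of \<sigma> \<odot>\<^bsub>\<Delta> m\<^esub> simplicial_faces \<Delta> \<delta> m)"
      unfolding simplicial_faces_def
      by (rule alternating_cone) (use that face_0 face_Suc in \<open>simp_all add: restr\<close>)
    then show ?thesis
      by simp
  qed
  show "frag_extend (\<lambda>\<tau>. frag_of (k m \<tau>)) c \<odot>\<^bsub>\<Delta> (Suc m)\<^esub> idc (\<Delta> (Suc m)) = 0"
    if "c \<in> chains (\<Delta> m) M" "c \<odot>\<^bsub>\<Delta> m\<^esub> idc (\<Delta> m) = 0" for m c
    using that by (simp add: fcomp_idc_right)
qed (fact k)

end

section \<open>Maps into products\<close>

lemma
  assumes "closure_space X"
  shows clos_empty: "clos X {} = {}"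
    and clos_subset_points: "A \<subseteq> points X \<Longrightarrow> clos X A \<subseteq> points X"
    and subset_clos: "A \<subseteq> points X \<Longrightarrow> A \<subseteq> clos X A"
  using assms[unfolded closure_space_def] by (simp_all only:)

lemma clos_mono:
  assumes "closure_space X" "A \<subseteq> B" "B \<subseteq> points X"
  shows "clos X A \<subseteq> clos X B"
proof -
  have "clos X (A \<union> B) = clos X A \<union> clos X B"
    using assms unfolding closure_space_def by (meson order_trans)
  then show ?thesis
    using assms(2) by (metis Un_absorb1 Un_upper1)
qed

lemma cs_nbhd_points: "closure_space X \<Longrightarrow> x \<in> points X \<Longrightarrow> cs_nbhd X x (points X)"
  by (simp add: cs_nbhd_def cs_interior_def closure_space_def)

text \<open>The factor \<open>points X\<close> gives the empty intersection its value; the empty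
  family occurs for the cube of dimension 0.\<close>

lemma cs_nbhd_INT:
  assumes "closure_space X" "x \<in> points X" "finite I" "\<And>i. i \<in> I \<Longrightarrow> cs_nbhd X x (V i)"
  shows "cs_nbhd X x (points X \<inter> (\<Inter>i\<in>I. V i))"
  using assms(3,4)
proof (induction I)
  case empty
  then show ?case
    using assms by (simp add: cs_nbhd_points)
next
  case (insert i I)
  then have "cs_nbhd X x (V i \<inter> (points X \<inter> (\<Inter>i\<in>I. V i)))"
    by (intro cs_nbhd_Int[OF assms(1), of _ "V i"]) auto
  then show ?case
    by (simp add: Int_ac)
qed

lemma cs_nbhd_meets_clos:
  assumes X: "closure_space X" and x: "x \<in> clos X A" "A \<subseteq> points X" and V: "cs_nbhd X x V"
  shows "V \<inter> A \<noteq> {}"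
proof
  assume "V \<inter> A = {}"
  then have "A \<subseteq> points X - V"
    using x(2) by blast
  then have "clos X A \<subseteq> clos X (points X - V)"
    using X by (intro clos_mono) auto
  then show False
    using x V by (auto simp: cs_nbhd_def cs_interior_def)
qed

lemma cs_nbhd_vimage:
  assumes X: "closure_space X" and f: "cs_continuous Y X f" and y: "y \<in> points Y"
    and U: "cs_nbhd X (f y) U"
  shows "cs_nbhd Y y {z \<in> points Y. f z \<in> U}"
proof -
  let ?A = "points Y - {z \<in> points Y. f z \<in> U}"
  have A: "f ` ?A \<subseteq> points X - U"
    using f by (auto simp: cs_continuous_def)
  have "f ` clos Y ?A \<subseteq> clos X (f ` ?A)"
    using f by (simp add: cs_continuous_def)
  also have "\<dots> \<subseteq> clos X (points X - U)"
    using A X by (intro clos_mono) auto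
  finally have "y \<notin> clos Y ?A"
    using U by (auto simp: cs_nbhd_def cs_interior_def)
  then show ?thesis
    using y by (auto simp: cs_nbhd_def cs_interior_def)
qed

lemma cs_continuous_const:
  assumes "closure_space Y" "closure_space X" "w \<in> points X"
  shows "cs_continuous Y X (\<lambda>_. w)"
  unfolding cs_continuous_def
proof (intro conjI allI impI)
  fix A assume "A \<subseteq> points Y"
  have "w \<in> clos X {w}"
    using assms subset_clos[of X "{w}"] by simp
  then show "(\<lambda>_. w) ` clos Y A \<subseteq> clos X ((\<lambda>_. w) ` A)"
    by (cases "A = {}") (auto simp: clos_empty[OF assms(1)] image_constant_conv)
qed (use assms in auto)

lemma points_cs_power: "points (cs_power J n) = (\<Pi>\<^sub>E i\<in>{1..n}. points J)"
  by (simp add: cs_power_def)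

lemma cs_continuous_proj:
  assumes J: "closure_space J" and i: "i \<in> {1..n}"
  shows "cs_continuous (cs_power J n) J (\<lambda>x. x i)"
  unfolding cs_continuous_def
proof (intro conjI allI impI)
  show "(\<lambda>x. x i) ` points (cs_power J n) \<subseteq> points J"
    using i by (auto simp: points_cs_power PiE_iff)
  fix A assume A: "A \<subseteq> points (cs_power J n)"
  show "(\<lambda>x. x i) ` clos (cs_power J n) A \<subseteq> clos J ((\<lambda>x. x i) ` A)"
  proof clarify
    fix x assume x: "x \<in> clos (cs_power J n) A"
    then have xP: "x \<in> points (cs_power J n)"
      by (simp add: cs_power_def)
    show "x i \<in> clos J ((\<lambda>x. x i) ` A)"
    proof (rule ccontr)
      let ?B = "(\<lambda>x. x i) ` A"
      assume neg: "x i \<notin> clos J ?B"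
      have "?B \<subseteq> points J"
        using A i unfolding points_cs_power by (meson PiE_mem image_subsetI subsetD)
      then have "points J - (points J - ?B) = ?B"
        by blast
      then have nb: "cs_nbhd J (x i) (points J - ?B)"
        using neg xP i by (auto simp: cs_nbhd_def cs_interior_def points_cs_power)
      \<comment> \<open>If the projected point lay outside the closure, the complement of the
        projected set would be a neighbourhood of it, and the box constraining coordinate
        \<open>i\<close> alone would miss \<open>A\<close>.\<close>
      let ?U = "\<lambda>j. if j = i then points J - ?B else points J"
      have "\<forall>j\<in>{1..n}. cs_nbhd J (x j) (?U j)"
        using nb xP by (auto intro: cs_nbhd_points[OF J] simp: points_cs_power PiE_iff)
      then have "(\<Pi>\<^sub>E j\<in>{1..n}. ?U j) \<inter> A \<noteq> {}"
        using x unfolding cs_power_def by simp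
      then obtain a where a: "a \<in> (\<Pi>\<^sub>E j\<in>{1..n}. ?U j)" "a \<in> A"
        by blast
      then show False
        using PiE_mem[OF a(1) i] by auto
    qed
  qed
qed

text \<open>Universal property of the product: a basic box pulls back to an intersection of one
  neighbourhood per coordinate, which is a neighbourhood because there are finitely many
  coordinates.\<close>

lemma cs_continuous_into_power:
  assumes Y: "closure_space Y" and J: "closure_space J"
    and f: "\<And>y. y \<in> points Y \<Longrightarrow> f y \<in> points (cs_power J n)"
    and cont: "\<And>i. i \<in> {1..n} \<Longrightarrow> cs_continuous Y J (\<lambda>y. f y i)"
  shows "cs_continuous Y (cs_power J n) f"
  unfolding cs_continuous_def
proof (intro conjI allI impI)
  fix A assume A: "A \<subseteq> points Y"
  show "f ` clos Y A \<subseteq> clos (cs_power J n) (f ` A)"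
  proof clarify
    fix y assume y: "y \<in> clos Y A"
    then have yP: "y \<in> points Y"
      using clos_subset_points[OF Y A] by blast
    have "(\<Pi>\<^sub>E i\<in>{1..n}. U i) \<inter> f ` A \<noteq> {}" if U: "\<forall>i\<in>{1..n}. cs_nbhd J (f y i) (U i)" for U
    proof -
      have "cs_nbhd Y y (points Y \<inter> (\<Inter>i\<in>{1..n}. {z \<in> points Y. f z i \<in> U i}))"
        using U by (intro cs_nbhd_INT Y yP cs_nbhd_vimage[OF J cont]) auto
      from cs_nbhd_meets_clos[OF Y y A this] obtain a
        where a: "a \<in> A" "a \<in> points Y" "\<forall>i\<in>{1..n}. f a i \<in> U i"
        by blast
      then have "f a \<in> (\<Pi>\<^sub>E i\<in>{1..n}. U i)"
        using f[OF a(2)] by (auto simp: points_cs_power PiE_iff)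
      then show ?thesis
        using a by blast
    qed
    then show "f y \<in> clos (cs_power J n) (f ` A)"
      using f[OF yP] by (simp add: cs_power_def)
  qed
qed (use f in auto)

section \<open>Cubical chains\<close>

text \<open>Coordinates are numbered from 1, so index 0 has to stay \<open>undefined\<close> for the
  result to be a point of the smaller cube.\<close>

definition tail_coords :: "(nat \<Rightarrow> 'b) \<Rightarrow> (nat \<Rightarrow> 'b)" where
  "tail_coords x = (\<lambda>j. if j = 0 then undefined else x (Suc j))"

definition cface :: "'b cspace \<Rightarrow> nat \<Rightarrow> nat \<Rightarrow> 'b \<Rightarrow> ((nat \<Rightarrow> 'b) \<Rightarrow> (nat \<Rightarrow> 'b)) \<Rightarrow>\<^sub>0 int" where
  "cface J n i t = frag_of (restrict (insert_coord i t) (points (cs_power J n)))"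

definition czero :: "'b::zero cspace \<Rightarrow> nat \<Rightarrow> nat \<Rightarrow> ((nat \<Rightarrow> 'b) \<Rightarrow> (nat \<Rightarrow> 'b)) \<Rightarrow>\<^sub>0 int" where
  "czero J n i = frag_of (restrict (\<lambda>x. x(i := 0)) (points (cs_power J n)))"

text \<open>The boundary of the identity cube. Numbering directions from 0 shifts the sign by one;
  taking the 1-face minus the 0-face absorbs it, so that the general alternating-sum lemmas
  apply.\<close>

definition cubical_faces :: "'b::{zero,one} cspace \<Rightarrow> nat \<Rightarrow> ((nat \<Rightarrow> 'b) \<Rightarrow> (nat \<Rightarrow> 'b)) \<Rightarrow>\<^sub>0 int" where
  "cubical_faces J n = (\<Sum>i\<le>n. frag_cmul ((-1) ^ i) (cface J n (Suc i) 1 - cface J n (Suc i) 0))"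

text \<open>
  The product of the operators \<open>1 - e\<^sub>i\<close>, where \<open>e\<^sub>i\<close> sets the \<open>i\<close>-th coordinate to \<open>0\<close>, kills exactly the
  degenerate chains: \<open>e\<^sub>i\<close> fixes the cubes not depending on coordinate \<open>i\<close>, and every \<open>\<sigma> \<odot> e\<^sub>i\<close> is degenerate.
\<close>

primrec normaliser :: "'b::zero cspace \<Rightarrow> nat \<Rightarrow> nat \<Rightarrow> ((nat \<Rightarrow> 'b) \<Rightarrow> (nat \<Rightarrow> 'b)) \<Rightarrow>\<^sub>0 int" where
  "normaliser J n 0 = idc (cs_power J n)"
| "normaliser J n (Suc k) =
     normaliser J n k \<odot>\<^bsub>cs_power J n\<^esub> (idc (cs_power J n) - czero J n (Suc k))"

lemma fcomp_restrict:
  assumes "\<And>x. x \<in> points K \<Longrightarrow> g x \<in> points L"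
  shows "frag_of (restrict f (points L)) \<odot>\<^bsub>K\<^esub> frag_of (restrict g (points K)) =
    frag_of (restrict (\<lambda>x. f (g x)) (points K))"
proof -
  have "compose (points K) (restrict f (points L)) (restrict g (points K)) = restrict (\<lambda>x. f (g x)) (points K)"
    using assms by (auto simp: compose_def)
  then show ?thesis
    by simp
qed

locale cubical_models =
  fixes J :: "'b::{zero,one} cspace"
  assumes J: "closure_space J" and zero: "0 \<in> points J" and one: "1 \<in> points J"
begin

lemma closure_space_cube: "closure_space (cs_power J n)"
  by (rule closure_space_cs_power) (rule J)

lemma insert_points:
  assumes "1 \<le> i" "i \<le> Suc n" "t \<in> points J" "x \<in> points (cs_power J n)"
  shows "insert_coord i t x \<in> points (cs_power J (Suc n))"
proof -
  have x: "\<And>j. j \<in> {1..n} \<Longrightarrow> x j \<in> points J" "\<And>j. j \<notin> {1..n} \<Longrightarrow> x j = undefined"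
    using assms(4) by (auto simp: points_cs_power PiE_iff extensional_def)
  have "insert_coord i t x j \<in> points J" if "j \<in> {1..Suc n}" for j
    using assms(1-3) that x(1)[of j] x(1)[of "j - 1"] by (cases j) (auto simp: insert_coord_def)
  moreover have "insert_coord i t x j = undefined" if "j \<notin> {1..Suc n}" for j
    using assms(1-3) that x(2)[of j] x(2)[of "j - 1"] by (cases j) (auto simp: insert_coord_def)
  ultimately show ?thesis
    unfolding points_cs_power by (rule PiE_I)
qed

lemma insert_sing_maps:
  assumes "1 \<le> i" "i \<le> Suc n" "t \<in> points J"
  shows "restrict (insert_coord i t) (points (cs_power J n)) \<in> sing_maps (cs_power J n) (cs_power J (Suc n))"
  unfolding restrict_in_sing_maps[OF closure_space_cube]
proof (rule cs_continuous_into_power)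
  fix j assume j: "j \<in> {1..Suc n}"
  consider "j < i" | "j = i" | "j > i"
    by linarith
  then show "cs_continuous (cs_power J n) J (\<lambda>y. insert_coord i t y j)"
    using j assms by cases
      (auto simp: insert_coord_def intro!: cs_continuous_proj cs_continuous_const J closure_space_cube)
qed (use assms J closure_space_cube insert_points in auto)

lemma cface_chains [simp, intro]:
  "1 \<le> i \<Longrightarrow> i \<le> Suc n \<Longrightarrow> t \<in> points J \<Longrightarrow> cface J n i t \<in> chains (cs_power J n) (cs_power J (Suc n))"
  by (simp add: cface_def insert_sing_maps)

lemma update_points:
  "i \<in> {1..n} \<Longrightarrow> t \<in> points J \<Longrightarrow> x \<in> points (cs_power J n) \<Longrightarrow> x(i := t) \<in> points (cs_power J n)"
  by (auto simp: points_cs_power PiE_iff extensional_def)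

lemma zero_sing_maps:
  assumes "i \<in> {1..n}"
  shows "restrict (\<lambda>x. x(i := 0)) (points (cs_power J n)) \<in> sing_maps (cs_power J n) (cs_power J n)"
  unfolding restrict_in_sing_maps[OF closure_space_cube]
proof (rule cs_continuous_into_power)
  fix j assume j: "j \<in> {1..n}"
  show "cs_continuous (cs_power J n) J (\<lambda>y. (y(i := 0)) j)"
    using j by (cases "j = i") (auto intro!: cs_continuous_proj cs_continuous_const J closure_space_cube zero)
qed (use assms J closure_space_cube update_points zero in auto)

lemma czero_chains [simp, intro]: "i \<in> {1..n} \<Longrightarrow> czero J n i \<in> chains (cs_power J n) (cs_power J n)"
  unfolding czero_def chains_of by (rule zero_sing_maps)

lemma tail_points: "x \<in> points (cs_power J (Suc n)) \<Longrightarrow> tail_coords x \<in> points (cs_power J n)"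
  by (auto simp: tail_coords_def points_cs_power PiE_iff extensional_def)

lemma tail_continuous: "cs_continuous (cs_power J (Suc n)) (cs_power J n) tail_coords"
proof (rule cs_continuous_into_power)
  fix j assume j: "j \<in> {1..n}"
  then show "cs_continuous (cs_power J (Suc n)) J (\<lambda>y. tail_coords y j)"
    by (auto simp: tail_coords_def intro!: cs_continuous_proj J)
qed (use J closure_space_cube tail_points in auto)

lemma czero_czero: "i \<in> {1..n} \<Longrightarrow> czero J n i \<odot>\<^bsub>cs_power J n\<^esub> czero J n i = czero J n i"
  unfolding czero_def by (subst fcomp_restrict) (auto intro!: update_points zero)

lemma czero_commute:
  assumes "i \<in> {1..n}" "j \<in> {1..n}"
  shows "czero J n i \<odot>\<^bsub>cs_power J n\<^esub> czero J n j = czero J n j \<odot>\<^bsub>cs_power J n\<^esub> czero J n i"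
proof (cases "i = j")
  case False
  then have "(\<lambda>x. x(j := 0::'b, i := 0)) = (\<lambda>x. x(i := 0, j := 0))"
    by (auto simp: fun_eq_iff)
  moreover have "czero J n i \<odot>\<^bsub>cs_power J n\<^esub> czero J n j =
      frag_of (restrict (\<lambda>x. x(j := 0, i := 0)) (points (cs_power J n)))"
    unfolding czero_def by (rule fcomp_restrict) (intro update_points assms zero)
  moreover have "czero J n j \<odot>\<^bsub>cs_power J n\<^esub> czero J n i =
      frag_of (restrict (\<lambda>x. x(i := 0, j := 0)) (points (cs_power J n)))"
    unfolding czero_def by (rule fcomp_restrict) (intro update_points assms zero)
  ultimately show ?thesis
    by simp
qed simp

text \<open>Resetting the inserted coordinate forgets the inserted value, so the operator for
  coordinate \<open>i\<close> cannot tell the two faces in direction \<open>i\<close> apart.\<close>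

lemma czero_cface_same:
  assumes "i \<in> {1..Suc n}" "t \<in> points J"
  shows "czero J (Suc n) i \<odot>\<^bsub>cs_power J n\<^esub> cface J n i t = cface J n i 0"
proof -
  have "(\<lambda>x. (insert_coord i t x)(i := 0)) = insert_coord i 0"
    by (auto simp: insert_coord_def fun_eq_iff)
  moreover have "czero J (Suc n) i \<odot>\<^bsub>cs_power J n\<^esub> cface J n i t =
      frag_of (restrict (\<lambda>x. (insert_coord i t x)(i := 0)) (points (cs_power J n)))"
    unfolding czero_def cface_def by (rule fcomp_restrict) (use assms insert_points in auto)
  ultimately show ?thesis
    by (simp add: cface_def)
qed

text \<open>Resetting a coordinate after an insertion elsewhere amounts to resetting it before; its
  number drops by one when it lies beyond the inserted one.\<close>

lemma czero_cface:
  assumes "i \<in> {1..Suc n}" "j \<in> {1..Suc n}" "i \<noteq> j" "t \<in> points J"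
  shows "\<exists>k\<in>{1..n}. czero J (Suc n) i \<odot>\<^bsub>cs_power J n\<^esub> cface J n j t = cface J n j t \<odot>\<^bsub>cs_power J n\<^esub> czero J n k"
proof
  let ?k = "if j < i then i - 1 else i"
  show k: "?k \<in> {1..n}"
    using assms by auto
  have "(\<lambda>x. (insert_coord j t x)(i := 0)) = (\<lambda>x. insert_coord j t (x(?k := 0)))"
    using assms by (auto simp: insert_coord_def fun_eq_iff)
  moreover have "czero J (Suc n) i \<odot>\<^bsub>cs_power J n\<^esub> cface J n j t =
      frag_of (restrict (\<lambda>x. (insert_coord j t x)(i := 0)) (points (cs_power J n)))"
    unfolding czero_def cface_def by (rule fcomp_restrict) (use assms insert_points in auto)
  moreover have "cface J n j t \<odot>\<^bsub>cs_power J n\<^esub> czero J n ?k =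
      frag_of (restrict (\<lambda>x. insert_coord j t (x(?k := 0))) (points (cs_power J n)))"
    unfolding czero_def cface_def by (rule fcomp_restrict) (intro update_points k zero)
  ultimately show "czero J (Suc n) i \<odot>\<^bsub>cs_power J n\<^esub> cface J n j t = cface J n j t \<odot>\<^bsub>cs_power J n\<^esub> czero J n ?k"
    by simp
qed

lemma cface_cface:
  assumes "1 \<le> j" "j < i" "i \<le> Suc (Suc n)" "s \<in> points J" "t \<in> points J"
  shows "cface J (Suc n) i s \<odot>\<^bsub>cs_power J n\<^esub> cface J n j t =
    cface J (Suc n) j t \<odot>\<^bsub>cs_power J n\<^esub> cface J n (i - 1) s"
proof -
  have "(\<lambda>x. insert_coord i s (insert_coord j t x)) = (\<lambda>x. insert_coord j t (insert_coord (i - 1) s x))"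
    using assms by (auto simp: insert_coord_def fun_eq_iff)
  moreover have "cface J (Suc n) i s \<odot>\<^bsub>cs_power J n\<^esub> cface J n j t =
      frag_of (restrict (\<lambda>x. insert_coord i s (insert_coord j t x)) (points (cs_power J n)))"
    unfolding cface_def by (rule fcomp_restrict) (use assms insert_points in auto)
  moreover have "cface J (Suc n) j t \<odot>\<^bsub>cs_power J n\<^esub> cface J n (i - 1) s =
      frag_of (restrict (\<lambda>x. insert_coord j t (insert_coord (i - 1) s x)) (points (cs_power J n)))"
    unfolding cface_def by (rule fcomp_restrict) (use assms insert_points in auto)
  ultimately show ?thesis
    by simp
qed

lemma cubical_faces_chains: "cubical_faces J n \<in> chains (cs_power J n) (cs_power J (Suc n))"
  unfolding cubical_faces_def
  by (intro chains_sum chains_cmul chains_diff cface_chains) (auto simp: zero one)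

lemma cubical_faces_cubical_faces: "cubical_faces J (Suc n) \<odot>\<^bsub>cs_power J n\<^esub> cubical_faces J n = 0"
  unfolding cubical_faces_def
proof (rule alternating_fcomp_eq_0)
  fix i j assume "j < i" "i \<le> Suc n"
  then have "cface J (Suc n) (Suc i) s \<odot>\<^bsub>cs_power J n\<^esub> cface J n (Suc j) t =
      cface J (Suc n) (Suc j) t \<odot>\<^bsub>cs_power J n\<^esub> cface J n (Suc (i - 1)) s"
    if "s \<in> points J" "t \<in> points J" for s t
    using cface_cface[of "Suc j" "Suc i" n s t] that by simp
  then show "(cface J (Suc n) (Suc i) 1 - cface J (Suc n) (Suc i) 0) \<odot>\<^bsub>cs_power J n\<^esub>
        (cface J n (Suc j) 1 - cface J n (Suc j) 0) =
      (cface J (Suc n) (Suc j) 1 - cface J (Suc n) (Suc j) 0) \<odot>\<^bsub>cs_power J n\<^esub>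
        (cface J n (Suc (i - 1)) 1 - cface J n (Suc (i - 1)) 0)"
    by (simp add: fcomp_diff_left fcomp_diff_right zero one algebra_simps)
qed

lemma normaliser_chains [simp, intro]: "k \<le> n \<Longrightarrow> normaliser J n k \<in> chains (cs_power J n) (cs_power J n)"
proof (induction k)
  case (Suc k)
  have "idc (cs_power J n) - czero J n (Suc k) \<in> chains (cs_power J n) (cs_power J n)"
    by (intro chains_diff idc_chains czero_chains closure_space_cube) (use Suc in auto)
  then show ?case
    using Suc by (auto intro: fcomp_chains closure_space_cube)
qed (simp add: closure_space_cube)

lemma czero_normaliser_commute:
  assumes i: "i \<in> {1..n}" and k: "k \<le> n"
  shows "czero J n i \<odot>\<^bsub>cs_power J n\<^esub> normaliser J n k = normaliser J n k \<odot>\<^bsub>cs_power J n\<^esub> czero J n i"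
  using k
proof (induction k)
  case 0
  then show ?case
    using i by (simp add: fcomp_idc_left[OF czero_chains] fcomp_idc_right[OF czero_chains])
next
  case (Suc k)
  let ?C = "cs_power J n"
  have k: "Suc k \<in> {1..n}"
    using Suc by simp
  have d: "idc ?C - czero J n (Suc k) \<in> chains ?C ?C"
    by (intro chains_diff idc_chains czero_chains closure_space_cube k)
  have "czero J n i \<odot>\<^bsub>?C\<^esub> normaliser J n (Suc k) =
      (czero J n i \<odot>\<^bsub>?C\<^esub> normaliser J n k) \<odot>\<^bsub>?C\<^esub> (idc ?C - czero J n (Suc k))"
    by (simp add: fcomp_assoc[OF d])
  also have "\<dots> = normaliser J n k \<odot>\<^bsub>?C\<^esub> (czero J n i \<odot>\<^bsub>?C\<^esub> (idc ?C - czero J n (Suc k)))"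
    using Suc by (simp add: fcomp_assoc[OF d])
  also have "czero J n i \<odot>\<^bsub>?C\<^esub> (idc ?C - czero J n (Suc k)) = (idc ?C - czero J n (Suc k)) \<odot>\<^bsub>?C\<^esub> czero J n i"
    using i k by (simp add: fcomp_diff_left fcomp_diff_right czero_commute[of i n "Suc k"]
        fcomp_idc_left[OF czero_chains] fcomp_idc_right[OF czero_chains])
  finally show ?case
    using i by (simp add: fcomp_assoc[OF czero_chains])
qed

text \<open>A coordinate operator is idempotent, so its own factor \<open>idc - czero\<close> kills
  it; commutativity brings it to that factor.\<close>

lemma czero_normaliser:
  assumes i: "i \<in> {1..k}" and k: "k \<le> n"
  shows "czero J n i \<odot>\<^bsub>cs_power J n\<^esub> normaliser J n k = 0"
  using i k
proof (induction k)
  case (Suc k)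
  let ?C = "cs_power J n"
  have k: "Suc k \<in> {1..n}"
    using Suc by simp
  have d: "idc ?C - czero J n (Suc k) \<in> chains ?C ?C"
    by (intro chains_diff idc_chains czero_chains closure_space_cube k)
  have eq: "czero J n i \<odot>\<^bsub>?C\<^esub> normaliser J n (Suc k) =
      (czero J n i \<odot>\<^bsub>?C\<^esub> normaliser J n k) \<odot>\<^bsub>?C\<^esub> (idc ?C - czero J n (Suc k))"
    by (simp add: fcomp_assoc[OF d])
  show ?case
  proof (cases "i = Suc k")
    case True
    have "(czero J n i \<odot>\<^bsub>?C\<^esub> normaliser J n k) \<odot>\<^bsub>?C\<^esub> (idc ?C - czero J n (Suc k)) =
        normaliser J n k \<odot>\<^bsub>?C\<^esub> (czero J n i \<odot>\<^bsub>?C\<^esub> (idc ?C - czero J n (Suc k)))"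
      using Suc True by (simp add: czero_normaliser_commute fcomp_assoc[OF d])
    then show ?thesis
      using k True eq
      by (simp add: fcomp_diff_right czero_czero fcomp_idc_right[OF czero_chains])
  next
    case False
    then show ?thesis
      using Suc eq by simp
  qed
qed simp

text \<open>Expanding the product of the factors \<open>idc - czero\<close> writes \<open>c\<close>
  minus its normal form as a sum of chains \<open>d \<odot> czero J n i\<close>. The predicate
  \<open>P\<close> replaces this explicit sum: any additive property of such chains passes to the
  difference. Idempotence, membership in the degenerate group and the behaviour of cones all follow
  this way.\<close>

lemma id_minus_normaliser:
  assumes c: "c \<in> chains (cs_power J n) X" and k: "k \<le> n"
    and P0: "P 0" and P_add: "\<And>a b. P a \<Longrightarrow> P b \<Longrightarrow> P (a + b)"
    and P: "\<And>d i. d \<in> chains (cs_power J n) X \<Longrightarrow> i \<in> {1..n} \<Longrightarrow> P (d \<odot>\<^bsub>cs_power J n\<^esub> czero J n i)"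
  shows "P (c - c \<odot>\<^bsub>cs_power J n\<^esub> normaliser J n k)"
  using k
proof (induction k)
  case 0
  then show ?case
    by (simp add: fcomp_idc_right[OF c] P0)
next
  case (Suc k)
  let ?C = "cs_power J n"
  have k: "Suc k \<in> {1..n}"
    using Suc by simp
  have d: "idc ?C - czero J n (Suc k) \<in> chains ?C ?C"
    by (intro chains_diff idc_chains czero_chains closure_space_cube k)
  have ck: "c \<odot>\<^bsub>?C\<^esub> normaliser J n k \<in> chains ?C X"
    using Suc c by (intro fcomp_chains closure_space_cube) auto
  have "c \<odot>\<^bsub>?C\<^esub> normaliser J n (Suc k) = c \<odot>\<^bsub>?C\<^esub> normaliser J n k \<odot>\<^bsub>?C\<^esub> (idc ?C - czero J n (Suc k))"
    by (simp add: fcomp_assoc[OF d])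
  also have "\<dots> = c \<odot>\<^bsub>?C\<^esub> normaliser J n k - c \<odot>\<^bsub>?C\<^esub> normaliser J n k \<odot>\<^bsub>?C\<^esub> czero J n (Suc k)"
    by (simp add: fcomp_diff_right fcomp_idc_right[OF ck])
  finally have "c \<odot>\<^bsub>?C\<^esub> normaliser J n (Suc k) =
      c \<odot>\<^bsub>?C\<^esub> normaliser J n k - c \<odot>\<^bsub>?C\<^esub> normaliser J n k \<odot>\<^bsub>?C\<^esub> czero J n (Suc k)" .
  then have eq: "c - c \<odot>\<^bsub>?C\<^esub> normaliser J n (Suc k) =
      (c - c \<odot>\<^bsub>?C\<^esub> normaliser J n k) + c \<odot>\<^bsub>?C\<^esub> normaliser J n k \<odot>\<^bsub>?C\<^esub> czero J n (Suc k)"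
    by simp
  show ?case
    unfolding eq by (rule P_add) (use Suc P[OF ck k] in auto)
qed

text \<open>In a direction other than \<open>i\<close>, the operator for \<open>i\<close> passes
  through the face and is killed by the normaliser; in direction \<open>i\<close> it makes the two
  faces equal and they cancel. This is the reason why boundaries of degenerate chains are
  degenerate.\<close>

lemma czero_faces_normaliser:
  assumes i: "i \<in> {1..Suc n}"
  shows "czero J (Suc n) i \<odot>\<^bsub>cs_power J n\<^esub> (cubical_faces J n \<odot>\<^bsub>cs_power J n\<^esub> normaliser J n n) = 0"
proof -
  let ?C = "cs_power J n"
  have zero_face: "czero J (Suc n) i \<odot>\<^bsub>?C\<^esub> (cface J n j t \<odot>\<^bsub>?C\<^esub> normaliser J n n) = 0"
    if j: "j \<in> {1..Suc n}" "i \<noteq> j" and t: "t \<in> points J" for j t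
  proof -
    obtain k where k: "k \<in> {1..n}" "czero J (Suc n) i \<odot>\<^bsub>?C\<^esub> cface J n j t = cface J n j t \<odot>\<^bsub>?C\<^esub> czero J n k"
      using czero_cface[OF i j t] by blast
    have "czero J (Suc n) i \<odot>\<^bsub>?C\<^esub> (cface J n j t \<odot>\<^bsub>?C\<^esub> normaliser J n n) =
        cface J n j t \<odot>\<^bsub>?C\<^esub> (czero J n k \<odot>\<^bsub>?C\<^esub> normaliser J n n)"
      using k by (simp flip: fcomp_assoc[OF normaliser_chains])
    then show ?thesis
      using k by (simp add: czero_normaliser)
  qed
  have same: "czero J (Suc n) i \<odot>\<^bsub>?C\<^esub> (cface J n i t \<odot>\<^bsub>?C\<^esub> normaliser J n n) = cface J n i 0 \<odot>\<^bsub>?C\<^esub> normaliser J n n"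
    if "t \<in> points J" for t
    using that i by (simp add: czero_cface_same flip: fcomp_assoc[OF normaliser_chains])
  have "czero J (Suc n) i \<odot>\<^bsub>?C\<^esub>
      (frag_cmul ((-1) ^ j) (cface J n (Suc j) 1 - cface J n (Suc j) 0) \<odot>\<^bsub>?C\<^esub> normaliser J n n) = 0"
    if "j \<le> n" for j
  proof (cases "i = Suc j")
    case True
    then show ?thesis
      using same zero one by (simp add: fcomp_cmul_left fcomp_cmul_right fcomp_diff_left fcomp_diff_right)
  next
    case False
    then show ?thesis
      using that zero one by (simp add: zero_face fcomp_cmul_left fcomp_cmul_right fcomp_diff_left fcomp_diff_right)
  qed
  then show ?thesis
    by (simp add: cubical_faces_def fcomp_sum_left fcomp_sum_right)
qed

text \<open>Idempotence and compatibility with the boundary both say that the identity minus the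
  normaliser, composed with a certain chain, gives zero. That difference is a sum of chains ending
  in some \<open>czero\<close>, and each \<open>czero\<close> kills both the normaliser and the
  normalised boundary.\<close>

sublocale model_theory "cs_power J" "\<lambda>n. normaliser J n n" "cubical_faces J"
proof
  fix n
  let ?C = "cs_power J"
  have id: "idc (?C n) \<in> chains (?C n) (?C n)"
    by (rule idc_chains) (rule closure_space_cube)
  have "(idc (?C n) - idc (?C n) \<odot>\<^bsub>?C n\<^esub> normaliser J n n) \<odot>\<^bsub>?C n\<^esub> normaliser J n n = 0" for n
    by (rule id_minus_normaliser[where P = "\<lambda>d. d \<odot>\<^bsub>?C n\<^esub> normaliser J n n = 0" and X = "?C n"])
      (auto simp: closure_space_cube fcomp_add_left fcomp_assoc[OF normaliser_chains] czero_normaliser)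
  then show "normaliser J n n \<odot>\<^bsub>?C n\<^esub> normaliser J n n = normaliser J n n"
    by (simp add: fcomp_diff_left fcomp_idc_left[OF normaliser_chains])
  let ?b = "cubical_faces J n \<odot>\<^bsub>?C n\<^esub> normaliser J n n"
  have b: "?b \<in> chains (?C n) (?C (Suc n))"
    by (rule fcomp_chains[OF closure_space_cube cubical_faces_chains normaliser_chains[OF order_refl]])
  have "(idc (?C (Suc n)) - idc (?C (Suc n)) \<odot>\<^bsub>?C (Suc n)\<^esub> normaliser J (Suc n) (Suc n)) \<odot>\<^bsub>?C n\<^esub> ?b = 0"
    by (rule id_minus_normaliser[where P = "\<lambda>d. d \<odot>\<^bsub>?C n\<^esub> ?b = 0" and X = "?C (Suc n)"])
      (auto simp: closure_space_cube fcomp_add_left fcomp_assoc[OF b] czero_faces_normaliser simp del: normaliser.simps)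
  then show "normaliser J (Suc n) (Suc n) \<odot>\<^bsub>?C n\<^esub> ?b = ?b"
    by (simp add: fcomp_diff_left fcomp_idc_left[OF b] fcomp_idc_left[OF normaliser_chains] del: normaliser.simps)
qed (auto simp: closure_space_cube cubical_faces_chains cubical_faces_cubical_faces,
    simp add: cubical_faces_def aug_diff cface_def)

end

section \<open>Degenerate cubes as the kernel of the normaliser\<close>

context cubical_models
begin

lemma degenerate_fcomp_normaliser:
  assumes "\<sigma> \<in> degenerate_cubes J X n"
  shows "frag_of \<sigma> \<odot>\<^bsub>cs_power J n\<^esub> normaliser J n n = 0"
proof -
  let ?C = "cs_power J n"
  obtain i where \<sigma>: "\<sigma> \<in> sing_maps ?C X" and i: "i \<in> {1..n}"
    and eq: "\<And>x t. x \<in> points ?C \<Longrightarrow> t \<in> points J \<Longrightarrow> \<sigma> (x(i := t)) = \<sigma> x"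
    using assms by (auto simp: degenerate_cubes_def)
  have "compose (points ?C) \<sigma> (restrict (\<lambda>x. x(i := 0)) (points ?C)) = \<sigma>"
    using eq zero sing_maps_extensional[OF \<sigma>] by (auto simp: compose_def fun_eq_iff extensional_def)
  then have "frag_of \<sigma> \<odot>\<^bsub>?C\<^esub> normaliser J n n = frag_of \<sigma> \<odot>\<^bsub>?C\<^esub> czero J n i \<odot>\<^bsub>?C\<^esub> normaliser J n n"
    by (simp add: czero_def)
  then show ?thesis
    using i by (simp add: fcomp_assoc[OF nu_chains] czero_normaliser)
qed

lemma fcomp_czero_degenerate:
  assumes "\<sigma> \<in> sing_maps (cs_power J n) X" "i \<in> {1..n}"
  shows "compose (points (cs_power J n)) \<sigma> (restrict (\<lambda>x. x(i := 0)) (points (cs_power J n)))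
    \<in> degenerate_cubes J X n"
  using assms update_points compose_in_sing_maps[OF closure_space_cube assms(1) zero_sing_maps]
  by (auto simp: degenerate_cubes_def compose_def intro!: bexI[of _ i])

lemma subgroup_degenerate: "subgroup (degenerate_group J X n) (cube_group J X n)"
  unfolding degenerate_group_def cube_group_def
  by (rule group.generate_is_subgroup) (auto simp: degenerate_cubes_def)

lemma degenerate_group_iff:
  assumes c: "c \<in> chains (cs_power J n) X"
  shows "c \<in> degenerate_group J X n \<longleftrightarrow> c \<odot>\<^bsub>cs_power J n\<^esub> normaliser J n n = 0"
proof
  let ?C = "cs_power J n"
  assume "c \<in> degenerate_group J X n"
  then have "Poly_Mapping.keys c \<subseteq> sing_maps ?C X \<and> c \<odot>\<^bsub>?C\<^esub> normaliser J n n = 0"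
    unfolding degenerate_group_def
  proof (induction rule: generate.induct)
    case (eng h1 h2)
    then show ?case
      using keys_add[of h1 h2] by (auto simp: cube_group_def fcomp_add_left)
  next
    case (incl h)
    then obtain \<sigma> where "\<sigma> \<in> degenerate_cubes J X n" "h = frag_of \<sigma>"
      by blast
    then show ?case
      by (auto simp: degenerate_fcomp_normaliser) (simp add: degenerate_cubes_def)
  next
    case (inv h)
    then obtain \<sigma> where \<sigma>: "\<sigma> \<in> degenerate_cubes J X n" "h = frag_of \<sigma>"
      by blast
    moreover have "\<sigma> \<in> sing_maps ?C X"
      using \<sigma> by (simp add: degenerate_cubes_def)
    ultimately show ?case
      by (simp add: cube_group_def degenerate_fcomp_normaliser fcomp_minus_left)
  qed (simp add: cube_group_def)
  then show "c \<odot>\<^bsub>?C\<^esub> normaliser J n n = 0"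
    by simp
next
  let ?C = "cs_power J n"
  let ?D = "degenerate_group J X n"
  interpret D: subgroup ?D "cube_group J X n"
    by (rule subgroup_degenerate)
  have add: "a + b \<in> ?D" if "a \<in> ?D" "b \<in> ?D" for a b
    using D.m_closed[OF that] by (simp add: cube_group_def)
  have minus: "- a \<in> ?D" if "a \<in> ?D" for a
    using D.m_inv_closed[OF that] D.subset that by (force simp: cube_group_def carrier_chains chains_def)
  have "d \<odot>\<^bsub>?C\<^esub> czero J n i \<in> ?D" if d: "d \<in> chains ?C X" and i: "i \<in> {1..n}" for d i
    using d
  proof (induction rule: chains_induct)
    case zero
    then show ?case
      using D.one_closed by (simp add: cube_group_def)
  next
    case (of \<sigma>)
    then show ?case
      using fcomp_czero_degenerate[OF of i] unfolding degenerate_group_def czero_def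
      by (auto intro: generate.incl)
  next
    case (diff a b)
    then show ?case
      using add[OF diff.IH(1) minus[OF diff.IH(2)]] by (simp add: fcomp_diff_left)
  qed
  \<comment> \<open>Once the normal form vanishes, this difference is \<open>c\<close>
    itself.\<close>
  then have "c - c \<odot>\<^bsub>?C\<^esub> normaliser J n n \<in> ?D"
    using D.one_closed add
    by (intro id_minus_normaliser[where P = "\<lambda>d. d \<in> ?D", OF c]) (auto simp: cube_group_def)
  then show "c \<in> ?D" if "c \<odot>\<^bsub>?C\<^esub> normaliser J n n = 0"
    using that by simp
qed

lemma cube_boundary_eq: "cube_boundary J (Suc n) c = c \<odot>\<^bsub>cs_power J n\<^esub> cubical_faces J n"
proof (induction c rule: frag_induction[OF subset_UNIV])
  case (2 \<sigma>)
  have "compose (points (cs_power J n)) \<sigma> (restrict (insert_coord i t) (points (cs_power J n))) =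
      cube_face J (Suc n) i t \<sigma>" for i t
    by (auto simp: compose_def cube_face_def)
  then have face: "frag_of \<sigma> \<odot>\<^bsub>cs_power J n\<^esub> cface J n i t = frag_of (cube_face J (Suc n) i t \<sigma>)" for i t
    by (simp add: cface_def)
  have "cube_boundary J (Suc n) (frag_of \<sigma>) = (\<Sum>i\<in>{0..n}. frag_cmul ((-1) ^ Suc i)
      (frag_of (cube_face J (Suc n) (Suc i) 0 \<sigma>) - frag_of (cube_face J (Suc n) (Suc i) 1 \<sigma>)))"
    unfolding cube_boundary_def frag_extend_of One_nat_def sum.shift_bounds_cl_Suc_ivl ..
  also have "\<dots> = (\<Sum>i\<le>n. frag_cmul ((-1) ^ i)
      (frag_of (cube_face J (Suc n) (Suc i) 1 \<sigma>) - frag_of (cube_face J (Suc n) (Suc i) 0 \<sigma>)))"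
    unfolding atLeast0AtMost
    by (intro sum.cong refl poly_mapping_eqI) (simp add: lookup_minus algebra_simps)
  finally show ?case
    by (simp add: cubical_faces_def fcomp_sum_right fcomp_cmul_right fcomp_diff_right face)
qed (simp_all add: cube_boundary_def frag_extend_diff fcomp_diff_left)

text \<open>This makes the boundary on cosets well defined: the normal form of \<open>h\<close> is
  zero, and the normalised boundary depends on that normal form only.\<close>

lemma faces_degenerate:
  assumes "h \<in> degenerate_group J X (Suc n)"
  shows "h \<odot>\<^bsub>cs_power J n\<^esub> cubical_faces J n \<in> degenerate_group J X n"
proof -
  let ?C = "cs_power J"
  have h: "h \<in> chains (?C (Suc n)) X"
    using assms subgroup.subset[OF subgroup_degenerate, of X "Suc n"] by (auto simp: cube_group_def carrier_chains)
  then have hn: "h \<odot>\<^bsub>?C (Suc n)\<^esub> normaliser J (Suc n) (Suc n) = 0"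
    using assms degenerate_group_iff by blast
  have "h \<odot>\<^bsub>?C n\<^esub> cubical_faces J n \<odot>\<^bsub>?C n\<^esub> normaliser J n n = 0"
    using fcomp_nu_b_nu[OF h] unfolding hn by (simp add: fcomp_assoc[OF nu_chains])
  then show ?thesis
    using h by (subst degenerate_group_iff) auto
qed

lemma presentation_cubical_complex:
  fixes X :: "'x cspace"
  shows "presentation (cs_power J) (\<lambda>n. normaliser J n n) (cubical_faces J) X (cubical_complex J X)
    (\<lambda>n c. degenerate_group J X n #>\<^bsub>cube_group J X n\<^esub> c)"
proof (intro presentation.intro presentation_axioms.intro model_theory_axioms)
  fix n
  let ?G = "cube_group J X" and ?D = "degenerate_group J X"
  have carrier: "carrier (?G n) = chains (cs_power J n) X" for n
    by (simp add: cube_group_def carrier_chains)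
  interpret G: comm_group "?G n" for n
    unfolding cube_group_def by (rule abelian_free_Abelian_group)
  have normal: "?D n \<lhd> ?G n" for n
    by (rule G.subgroup_imp_normal) (rule subgroup_degenerate)
  show "comm_group (grp (cubical_complex J X) n)"
    unfolding cubical_complex_def by (simp add: G.abelian_FactGroup subgroup_degenerate)
  show "(\<lambda>c. ?D n #>\<^bsub>?G n\<^esub> c) \<in> hom (free_Abelian_group (sing_maps (cs_power J n) X)) (grp (cubical_complex J X) n)"
    using normal.r_coset_hom_Mod[OF normal] by (simp add: cubical_complex_def cube_group_def)
  show "(\<lambda>c. ?D n #>\<^bsub>?G n\<^esub> c) ` chains (cs_power J n) X = carrier (grp (cubical_complex J X) n)"
    by (auto simp: cubical_complex_def FactGroup_def RCOSETS_def carrier)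
  fix c
  show "(?D n #>\<^bsub>?G n\<^esub> c = \<one>\<^bsub>grp (cubical_complex J X) n\<^esub>) = (c \<odot>\<^bsub>cs_power J n\<^esub> normaliser J n n = 0)"
    if c: "c \<in> chains (cs_power J n) X"
  proof -
    have "?D n #>\<^bsub>?G n\<^esub> c = ?D n \<longleftrightarrow> c \<in> ?D n"
      using group.coset_join1[OF G.is_group[of n], of "?D n" c] group.coset_join2[OF G.is_group[of n], of c "?D n"]
        c subgroup_degenerate by (auto simp: carrier)
    then show ?thesis
      by (simp add: cubical_complex_def FactGroup_def degenerate_group_iff[OF c])
  qed
  show "bdry (cubical_complex J X) (Suc n) (?D (Suc n) #>\<^bsub>?G (Suc n)\<^esub> c) =
      ?D n #>\<^bsub>?G n\<^esub> (c \<odot>\<^bsub>cs_power J n\<^esub> cubical_faces J n)"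
    if c: "c \<in> chains (cs_power J (Suc n)) X"
  proof -
    let ?f = "\<lambda>c. ?D n #>\<^bsub>?G n\<^esub> cube_boundary J (Suc n) c"
    have "?f c' = ?f c" if c': "c' \<in> ?D (Suc n) #>\<^bsub>?G (Suc n)\<^esub> c" for c'
    proof -
      obtain h where h: "h \<in> ?D (Suc n)" "c' = h + c"
        using c' by (auto simp: r_coset_def cube_group_def)
      let ?b = "\<lambda>c. c \<odot>\<^bsub>cs_power J n\<^esub> cubical_faces J n"
      have hb: "?b h \<in> ?D n"
        using h by (simp add: faces_degenerate)
      then have hb': "?b h \<in> carrier (?G n)"
        using subgroup.subset[OF subgroup_degenerate] by blast
      have cb: "?b c \<in> carrier (?G n)"
        using c by (auto simp: carrier)
      have "?D n #>\<^bsub>?G n\<^esub> ?b c' = ?D n #>\<^bsub>?G n\<^esub> (?b h \<otimes>\<^bsub>?G n\<^esub> ?b c)"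
        by (simp add: h fcomp_add_left) (simp add: cube_group_def)
      also have "\<dots> = ?D n #>\<^bsub>?G n\<^esub> ?b h #>\<^bsub>?G n\<^esub> ?b c"
        using G.coset_mult_assoc[OF subgroup.subset[OF subgroup_degenerate] hb' cb] by simp
      also have "?D n #>\<^bsub>?G n\<^esub> ?b h = ?D n"
        using G.coset_join2[OF hb' subgroup_degenerate hb] .
      finally show ?thesis
        by (simp add: cube_boundary_eq)
    qed
    moreover have "c \<in> ?D (Suc n) #>\<^bsub>?G (Suc n)\<^esub> c"
      using c by (intro G.rcos_self subgroup_degenerate) (simp add: carrier)
    \<comment> \<open>The boundary is constant on the coset, so the image in the definition is a
      singleton and \<open>the_elem\<close> returns its element.\<close>
    ultimately have "?f ` (?D (Suc n) #>\<^bsub>?G (Suc n)\<^esub> c) = {?f c}"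
      by blast
    then show ?thesis
      by (simp add: cubical_complex_def cube_boundary_eq)
  qed
qed

section \<open>Cubical cones\<close>

lemma tail_insert_1 [simp]: "x \<in> points (cs_power J n) \<Longrightarrow> tail_coords (insert_coord (Suc 0) t x) = x"
  by (auto simp: tail_coords_def insert_coord_def points_cs_power PiE_iff extensional_def fun_eq_iff)

lemma tail_insert_Suc: "1 \<le> i \<Longrightarrow> tail_coords (insert_coord (Suc i) t x) = insert_coord i t (tail_coords x)"
  by (auto simp: tail_coords_def insert_coord_def fun_eq_iff)

lemma insert_coord_first:
  "insert_coord (Suc 0) t x (Suc 0) = t"
  "1 \<le> i \<Longrightarrow> insert_coord (Suc i) t x (Suc 0) = x (Suc 0)"
  by (auto simp: insert_coord_def)

text \<open>A homotopy from the constant \<open>v\<close> to the identity contracts chains by using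
  time as a new first coordinate: the face at time 1 is \<open>\<sigma>\<close>, the face at time 0
  a constant cube, and all other faces are cones of faces. The constant cube is degenerate in
  positive dimension, so it survives only in degree 0, as the correction \<open>w\<close>.\<close>

lemma model_acyclic_cubical_cone:
  fixes M :: "'m cspace" and H :: "'b \<Rightarrow> 'm \<Rightarrow> 'm"
  assumes H1: "\<And>y. y \<in> points M \<Longrightarrow> H 1 y = y" and H0: "\<And>y. y \<in> points M \<Longrightarrow> H 0 y = v"
    and cont: "\<And>m \<sigma>. cs_continuous (cs_power J m) M \<sigma> \<Longrightarrow>
      cs_continuous (cs_power J (Suc m)) M (\<lambda>x. H (x 1) (\<sigma> (tail_coords x)))"
  shows "model_acyclic (cs_power J) (\<lambda>n. normaliser J n n) \<beta> M"
proof -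
  let ?C = "cs_power J"
  define k where "k m \<sigma> = restrict (\<lambda>x. H (x 1) (\<sigma> (tail_coords x))) (points (?C (Suc m)))"
    for m and \<sigma> :: "(nat \<Rightarrow> 'b) \<Rightarrow> 'm"
  let ?k = "\<lambda>m. frag_extend (\<lambda>\<tau>. frag_of (k m \<tau>))"
  have k: "k m \<sigma> \<in> sing_maps (?C (Suc m)) M" if "\<sigma> \<in> sing_maps (?C m) M" for m \<sigma>
    using that unfolding k_def restrict_in_sing_maps[OF closure_space_cube]
    by (intro cont) (simp add: sing_maps_def)
  have k_first: "frag_of (k m \<sigma>) \<odot>\<^bsub>?C m\<^esub> cface J m 1 t = frag_of (restrict (\<lambda>x. H t (\<sigma> x)) (points (?C m)))"
    if "t \<in> points J" for m \<sigma> t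
    unfolding k_def cface_def using that insert_points[of 1 m t]
    by (subst fcomp_restrict) (auto intro!: arg_cong[where f = frag_of] restrict_ext simp: insert_coord_first)
  have k_Suc: "frag_of (k (Suc m) \<sigma>) \<odot>\<^bsub>?C (Suc m)\<^esub> cface J (Suc m) (Suc i) t = ?k m (frag_of \<sigma> \<odot>\<^bsub>?C m\<^esub> cface J m i t)"
    if i: "1 \<le> i" "i \<le> Suc m" and t: "t \<in> points J" for m \<sigma> i t
  proof -
    have "k m (compose (points (?C m)) \<sigma> (restrict (insert_coord i t) (points (?C m)))) =
        restrict (\<lambda>x. H (x 1) (\<sigma> (insert_coord i t (tail_coords x)))) (points (?C (Suc m)))"
      unfolding k_def by (rule restrict_ext) (simp add: compose_def tail_points)
    then show ?thesis
      unfolding k_def[of "Suc m"] cface_def using i t insert_points[of "Suc i" "Suc m" t]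
      by (subst fcomp_restrict)
        (auto intro!: arg_cong[where f = frag_of] restrict_ext simp: tail_insert_Suc insert_coord_first)
  qed
  \<comment> \<open>Old coordinate \<open>i\<close> is coordinate \<open>Suc i\<close> of the cone,
    so coning preserves independence of a coordinate and carries degenerate chains to degenerate
    ones.\<close>
  have k_czero: "?k m (d \<odot>\<^bsub>?C m\<^esub> czero J m i) = ?k m d \<odot>\<^bsub>?C (Suc m)\<^esub> czero J (Suc m) (Suc i)"
    if d: "d \<in> chains (?C m) M" and i: "i \<in> {1..m}" for m d i
    using d
  proof (induction rule: chains_induct)
    case (of \<sigma>)
    have "tail_coords (x(Suc i := 0)) = (tail_coords x)(i := 0)" for x :: "nat \<Rightarrow> 'b"
      using i by (auto simp: tail_coords_def fun_eq_iff)
    then have "k m (compose (points (?C m)) \<sigma> (restrict (\<lambda>x. x(i := 0)) (points (?C m)))) =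
        restrict (\<lambda>x. H ((x(Suc i := 0)) 1) (\<sigma> (tail_coords (x(Suc i := 0))))) (points (?C (Suc m)))"
      unfolding k_def using i by (intro restrict_ext) (simp add: compose_def tail_points)
    moreover have "frag_of (k m \<sigma>) \<odot>\<^bsub>?C (Suc m)\<^esub> czero J (Suc m) (Suc i) =
        frag_of (restrict (\<lambda>x. H ((x(Suc i := 0)) 1) (\<sigma> (tail_coords (x(Suc i := 0))))) (points (?C (Suc m))))"
      unfolding k_def czero_def by (rule fcomp_restrict) (rule update_points, use i zero in auto)
    ultimately show ?case
      by (simp add: czero_def)
  qed (simp_all add: frag_extend_diff fcomp_diff_left)
  let ?w = "\<lambda>m. restrict (\<lambda>x. v) (points (?C m))"
  have first: "frag_of (k m \<sigma>) \<odot>\<^bsub>?C m\<^esub> (cface J m 1 1 - cface J m 1 0) = frag_of \<sigma> - frag_of (?w m)"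
    if \<sigma>: "\<sigma> \<in> sing_maps (?C m) M" for m \<sigma>
  proof -
    have "restrict (\<lambda>x. H 1 (\<sigma> x)) (points (?C m)) = \<sigma>"
      using H1 sing_maps_funcset[OF \<sigma>] sing_maps_extensional[OF \<sigma>] by (auto simp: fun_eq_iff extensional_def)
    moreover have "restrict (\<lambda>x. H 0 (\<sigma> x)) (points (?C m)) = ?w m"
      using H0 sing_maps_funcset[OF \<sigma>] by (intro restrict_ext) auto
    ultimately show ?thesis
      by (simp add: fcomp_diff_right k_first zero one del: One_nat_def)
  qed
  show ?thesis
  proof (rule model_acyclic_cone[where k = k and w = "frag_of (?w 0)"])
    show "frag_of (k 0 \<sigma>) \<odot>\<^bsub>?C 0\<^esub> cubical_faces J 0 = frag_of \<sigma> - frag_of (?w 0)"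
      if "\<sigma> \<in> sing_maps (?C 0) M" for \<sigma>
      using first[OF that] by (simp add: cubical_faces_def)
    show "frag_of (k (Suc m) \<sigma>) \<odot>\<^bsub>?C (Suc m)\<^esub> cubical_faces J (Suc m) \<odot>\<^bsub>?C (Suc m)\<^esub> normaliser J (Suc m) (Suc m) =
        (frag_of \<sigma> - ?k m (frag_of \<sigma> \<odot>\<^bsub>?C m\<^esub> cubical_faces J m)) \<odot>\<^bsub>?C (Suc m)\<^esub> normaliser J (Suc m) (Suc m)"
      if \<sigma>: "\<sigma> \<in> sing_maps (?C (Suc m)) M" for m \<sigma>
    proof -
      have "frag_of (k (Suc m) \<sigma>) \<odot>\<^bsub>?C (Suc m)\<^esub> cubical_faces J (Suc m) =
          frag_of \<sigma> - frag_of (?w (Suc m)) - ?k m (frag_of \<sigma> \<odot>\<^bsub>?C m\<^esub> cubical_faces J m)"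
        unfolding cubical_faces_def
        by (rule alternating_cone)
          (use first[OF \<sigma>] in \<open>simp_all add: fcomp_diff_right k_Suc zero one frag_extend_diff\<close>)
      moreover have "frag_of (?w (Suc m)) \<odot>\<^bsub>?C (Suc m)\<^esub> normaliser J (Suc m) (Suc m) = 0"
      proof -
        \<comment> \<open>A constant cube of positive dimension is fixed by resetting its first
          coordinate, hence has normal form zero.\<close>
        have "frag_of (?w (Suc m)) \<odot>\<^bsub>?C (Suc m)\<^esub> czero J (Suc m) 1 = frag_of (?w (Suc m))"
          unfolding czero_def by (rule fcomp_restrict) (rule update_points, use zero in auto)
        then show ?thesis
          using czero_normaliser[of 1 "Suc m" "Suc m"] fcomp_assoc[OF nu_chains[of "Suc m"], of "frag_of (?w (Suc m))" "czero J (Suc m) 1"]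
          by (simp del: normaliser.simps)
      qed
      ultimately show ?thesis
        by (simp add: fcomp_diff_left del: normaliser.simps)
    qed
    show "?k m c \<odot>\<^bsub>?C (Suc m)\<^esub> normaliser J (Suc m) (Suc m) = 0"
      if c: "c \<in> chains (?C m) M" "c \<odot>\<^bsub>?C m\<^esub> normaliser J m m = 0" for m c
    proof -
      have "?k m (c - c \<odot>\<^bsub>?C m\<^esub> normaliser J m m) \<odot>\<^bsub>?C (Suc m)\<^esub> normaliser J (Suc m) (Suc m) = 0"
        by (rule id_minus_normaliser[where P = "\<lambda>d. ?k m d \<odot>\<^bsub>?C (Suc m)\<^esub> normaliser J (Suc m) (Suc m) = 0", OF c(1)])
          (auto simp: frag_extend_add fcomp_add_left k_czero fcomp_assoc[OF nu_chains] czero_normaliser simp del: normaliser.simps)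
      then show ?thesis
        by (simp add: c)
    qed
  qed (fact k)
qed

end

abbreviation simplicially_acyclic where
  "simplicially_acyclic \<Delta> \<delta> \<equiv>
     model_acyclic \<Delta> (\<lambda>n. idc (\<Delta> n)) (model_theory.\<beta> \<Delta> (\<lambda>n. idc (\<Delta> n)) (simplicial_faces \<Delta> \<delta>))"

abbreviation cubically_acyclic where
  "cubically_acyclic J \<equiv> model_acyclic (cs_power J) (\<lambda>n. normaliser J n n)
     (model_theory.\<beta> (cs_power J) (\<lambda>n. normaliser J n n) (cubical_faces J))"

lemma simplicial_cubical_equivalence:
  assumes S: "simplicial_models \<Delta> \<delta>" and C: "cubical_models J"
    and SS: "\<And>n. simplicially_acyclic \<Delta> \<delta> (\<Delta> n)"
    and SC: "\<And>n. simplicially_acyclic \<Delta> \<delta> (cs_power J n)"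
    and CS: "\<And>n. cubically_acyclic J (\<Delta> n)"
    and CC: "\<And>n. cubically_acyclic J (cs_power J n)"
    and p: "p \<in> points (\<Delta> 0)"
  shows "simplicial_complex \<Delta> \<delta> X \<simeq>\<^sub>c cubical_complex J X"
proof -
  interpret S: simplicial_models \<Delta> \<delta> by (rule S)
  interpret C: cubical_models J by (rule C)
  interpret two_presentations \<Delta> "\<lambda>n. idc (\<Delta> n)" "simplicial_faces \<Delta> \<delta>" X "simplicial_complex \<Delta> \<delta> X"
    "\<lambda>n c. c" "cs_power J" "\<lambda>n. normaliser J n n" "cubical_faces J" "cubical_complex J X"
    "\<lambda>n c. degenerate_group J X n #>\<^bsub>cube_group J X n\<^esub> c"
    by (intro two_presentations.intro S.presentation_simplicial_complex C.presentation_cubical_complex)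
  \<comment> \<open>The 0-cube has exactly one point, the function that is \<open>undefined\<close>
    at every index.\<close>
  let ?o = "\<lambda>_. undefined"
  have o: "?o \<in> points (cs_power J 0)"
    by (simp add: points_cs_power)
  have "restrict (\<lambda>_. p) (points (cs_power J 0)) \<in> sing_maps (cs_power J 0) (\<Delta> 0)"
    "restrict (\<lambda>_. ?o) (points (\<Delta> 0)) \<in> sing_maps (\<Delta> 0) (cs_power J 0)"
    using p o by (simp_all add: restrict_in_sing_maps S.closure_space_simplex C.closure_space_cube cs_continuous_const)
  then show ?thesis
    by (rule acyclic_models_equivalence[OF SS SC CS CC])
qed

section \<open>The two discrete intervals\<close>

lemma vertex_face_vertex_face: "j < i \<Longrightarrow> vertex_face i (vertex_face j x) = vertex_face j (vertex_face (i - 1) x)"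
  by (auto simp: vertex_face_def)

text \<open>The cone sends the new vertex 0 to \<open>v\<close> and reads \<open>\<sigma>\<close> on
  the remaining vertices, shifted down by one. Everything but its continuity is bookkeeping of face
  indices.\<close>

lemma model_acyclic_vertex_cone:
  fixes M :: "'m cspace"
  assumes S: "simplicial_models \<Delta> vertex_face" and points: "\<And>n. points (\<Delta> n) = {0..n}"
    and cont: "\<And>m \<sigma>. cs_continuous (\<Delta> m) M \<sigma> \<Longrightarrow>
      cs_continuous (\<Delta> (Suc m)) M (\<lambda>x. if x = 0 then v else \<sigma> (x - 1))"
  shows "simplicially_acyclic \<Delta> vertex_face M"
proof -
  interpret simplicial_models \<Delta> vertex_face by (rule S)
  define k where "k m \<sigma> = restrict (\<lambda>x. if x = 0 then v else \<sigma> (x - 1)) (points (\<Delta> (Suc m)))" for m and \<sigma> :: "nat \<Rightarrow> 'm"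
  show ?thesis
  proof (rule model_acyclic_simplicial_cone[where k = k and w = "restrict (\<lambda>_. v) (points (\<Delta> 0))"])
    show "k m \<sigma> \<in> sing_maps (\<Delta> (Suc m)) M" if "\<sigma> \<in> sing_maps (\<Delta> m) M" for m \<sigma>
      using that unfolding k_def restrict_in_sing_maps[OF closure_space_simplex]
      by (intro cont) (simp add: sing_maps_def)
    show "compose (points (\<Delta> m)) (k m \<sigma>) (vertex_face 0) = \<sigma>" if "\<sigma> \<in> sing_maps (\<Delta> m) M" for m \<sigma>
      using sing_maps_extensional[OF that]
      by (auto simp: compose_def k_def points vertex_face_def fun_eq_iff extensional_def)
    show "compose (points (\<Delta> 0)) (k 0 \<sigma>) (vertex_face 1) = restrict (\<lambda>_. v) (points (\<Delta> 0))" for \<sigma>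
      by (auto simp: compose_def k_def points vertex_face_def fun_eq_iff)
    show "compose (points (\<Delta> (Suc m))) (k (Suc m) \<sigma>) (vertex_face (Suc i)) =
        k m (compose (points (\<Delta> m)) \<sigma> (vertex_face i))" for m \<sigma> i
    proof
      fix x
      show "compose (points (\<Delta> (Suc m))) (k (Suc m) \<sigma>) (vertex_face (Suc i)) x =
          k m (compose (points (\<Delta> m)) \<sigma> (vertex_face i)) x"
        by (cases x) (auto simp: compose_def k_def points vertex_face_def)
    qed
  qed
qed

text \<open>For a two-point interval a contraction is merely a switch: constant \<open>v\<close> at
  time 0, the identity otherwise. Whether this jump is continuous is left to
  \<open>cont\<close>.\<close>

lemma model_acyclic_switch_cone:
  fixes J :: "nat cspace"
  assumes C: "cubical_models J"
    and cont: "\<And>m \<sigma>. cs_continuous (cs_power J m) M \<sigma> \<Longrightarrow>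
      cs_continuous (cs_power J (Suc m)) M (\<lambda>x. if x 1 = 0 then v else \<sigma> (tail_coords x))"
  shows "cubically_acyclic J M"
proof -
  interpret cubical_models J by (rule C)
  show ?thesis
    by (rule model_acyclic_cubical_cone[where H = "\<lambda>t y. if t = 0 then v else y" and v = v])
      (use cont in auto)
qed

section \<open>The indiscrete interval\<close>

definition indiscrete :: "'a cspace \<Rightarrow> bool" where
  "indiscrete X \<longleftrightarrow> (\<forall>A. A \<subseteq> points X \<longrightarrow> A \<noteq> {} \<longrightarrow> points X \<subseteq> clos X A)"

lemma cs_continuous_indiscrete:
  assumes Y: "closure_space Y" and X: "indiscrete X" and f: "f ` points Y \<subseteq> points X"
  shows "cs_continuous Y X f"
  unfolding cs_continuous_def
proof (intro conjI allI impI f)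
  fix A assume A: "A \<subseteq> points Y"
  show "f ` clos Y A \<subseteq> clos X (f ` A)"
  proof (cases "A = {}")
    case True
    then show ?thesis
      by (simp add: clos_empty[OF Y])
  next
    case False
    have "f ` A \<subseteq> points X"
      using A f by blast
    then have "points X \<subseteq> clos X (f ` A)"
      using X False by (simp add: indiscrete_def)
    then show ?thesis
      using clos_subset_points[OF Y A] f by blast
  qed
qed

lemma indiscrete_indiscrete_cspace: "indiscrete (indiscrete_cspace S)"
  by (simp add: indiscrete_def indiscrete_cspace_def)

text \<open>By the universal property, the identity from the indiscrete space on the carrier is
  continuous, because every map into the indiscrete \<open>J\<close> is. Its continuity bounds
  closures in the product from below.\<close>

lemma indiscrete_cs_power:
  assumes J: "closure_space J" "indiscrete J"
  shows "indiscrete (cs_power J n)"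
proof -
  let ?P = "points (cs_power J n)"
  have cont: "cs_continuous (indiscrete_cspace ?P) (cs_power J n) (\<lambda>x. x)"
  proof (rule cs_continuous_into_power)
    fix i assume "i \<in> {1..n}"
    then show "cs_continuous (indiscrete_cspace ?P) J (\<lambda>y. y i)"
      by (intro cs_continuous_indiscrete closure_space_indiscrete J)
        (auto simp: points_cs_power indiscrete_cspace_def PiE_iff)
  next
    show "y \<in> ?P" if "y \<in> points (indiscrete_cspace ?P)" for y
      using that by (simp add: indiscrete_cspace_def)
  qed (simp_all add: closure_space_indiscrete J)
  show ?thesis
    unfolding indiscrete_def
  proof (intro allI impI subsetI)
    fix A x assume "A \<subseteq> ?P" "A \<noteq> {}" "x \<in> ?P"
    then show "x \<in> clos (cs_power J n) A"
      using cs_continuousD[OF cont, of A x] by (simp add: indiscrete_cspace_def)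
  qed
qed

lemma interval_J1: "closure_space interval_J1" "indiscrete interval_J1" "points interval_J1 = {0, 1}"
  by (simp_all add: interval_J1_def closure_space_indiscrete indiscrete_indiscrete_cspace)
    (simp add: indiscrete_cspace_def)

lemma simplex_J1: "closure_space (simplex_J1 n)" "indiscrete (simplex_J1 n)" "points (simplex_J1 n) = {0..n}"
  by (simp_all add: simplex_J1_def closure_space_indiscrete indiscrete_indiscrete_cspace)
    (simp add: indiscrete_cspace_def)

lemma simplicial_models_J1: "simplicial_models simplex_J1 vertex_face"
proof
  fix i n :: nat
  assume "i \<le> Suc n"
  show "cs_continuous (simplex_J1 n) (simplex_J1 (Suc n)) (vertex_face i)"
    by (rule cs_continuous_indiscrete) (auto simp: simplex_J1 vertex_face_def)
qed (auto simp: simplex_J1 vertex_face_vertex_face)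

lemma cubical_models_J1: "cubical_models interval_J1"
  by unfold_locales (auto simp: interval_J1)

lemma simplicially_acyclic_J1:
  assumes "indiscrete M" "v \<in> points M"
  shows "simplicially_acyclic simplex_J1 vertex_face M"
proof (rule model_acyclic_vertex_cone[OF simplicial_models_J1])
  fix m \<sigma> assume "cs_continuous (simplex_J1 m) M \<sigma>"
  then have "\<sigma> ` {0..m} \<subseteq> points M"
    by (simp add: cs_continuous_def simplex_J1)
  then show "cs_continuous (simplex_J1 (Suc m)) M (\<lambda>x. if x = 0 then v else \<sigma> (x - 1))"
    using assms by (intro cs_continuous_indiscrete simplex_J1) (auto simp: simplex_J1)
qed (rule simplex_J1)

lemma cubically_acyclic_J1:
  assumes "indiscrete M" "v \<in> points M"
  shows "cubically_acyclic interval_J1 M"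
proof (rule model_acyclic_switch_cone[OF cubical_models_J1])
  fix m \<sigma> assume "cs_continuous (cs_power interval_J1 m) M \<sigma>"
  then have "\<sigma> ` points (cs_power interval_J1 m) \<subseteq> points M"
    by (simp add: cs_continuous_def)
  then show "cs_continuous (cs_power interval_J1 (Suc m)) M (\<lambda>x. if x 1 = 0 then v else \<sigma> (tail_coords x))"
    using assms cubical_models.tail_points[OF cubical_models_J1]
    by (intro cs_continuous_indiscrete closure_space_cs_power interval_J1) auto
qed

lemma simplicial_chains_J1_equivalent: "simplicial_chains_J1 X \<simeq>\<^sub>c cubical_complex interval_J1 X"
  unfolding simplicial_chains_J1_def
proof (rule simplicial_cubical_equivalence[OF simplicial_models_J1 cubical_models_J1])
  have C: "indiscrete (cs_power interval_J1 n)" for n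
    by (intro indiscrete_cs_power interval_J1)
  have v: "0 \<in> points (simplex_J1 n)" "restrict (\<lambda>_. 0) {1..n} \<in> points (cs_power interval_J1 n)" for n
    by (auto simp: simplex_J1 points_cs_power interval_J1)
  show "simplicially_acyclic simplex_J1 vertex_face (simplex_J1 n)" "cubically_acyclic interval_J1 (simplex_J1 n)"
    "simplicially_acyclic simplex_J1 vertex_face (cs_power interval_J1 n)"
    "cubically_acyclic interval_J1 (cs_power interval_J1 n)" "0 \<in> points (simplex_J1 0)" for n
    using v C simplex_J1 by (blast intro: simplicially_acyclic_J1 cubically_acyclic_J1)+
qed

section \<open>The interval \<open>J\<^sub>+\<close>\<close>

lemma points_interval_Jplus: "points interval_Jplus = {0, 1}"
  by (simp add: interval_Jplus_def)

lemma points_simplex_Jplus: "points (simplex_Jplus n) = {0..n}"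
  by (simp add: simplex_Jplus_def)

text \<open>Closures in \<open>simplex_Jplus\<close> are upward closures, so continuity of a face
  map comes from its monotonicity.\<close>

lemma simplicial_models_Jplus: "simplicial_models simplex_Jplus vertex_face"
proof
  fix i n :: nat
  assume "i \<le> Suc n"
  have "vertex_face i a \<le> vertex_face i b" if "a \<le> b" for a b
    using that by (simp add: vertex_face_def)
  then show "cs_continuous (simplex_Jplus n) (simplex_Jplus (Suc n)) (vertex_face i)"
    by (auto simp: cs_continuous_def simplex_Jplus_def) (auto simp: vertex_face_def)
qed (auto simp: closure_space_simplex_Jplus vertex_face_vertex_face)

lemma cubical_models_Jplus: "cubical_models interval_Jplus"
  by unfold_locales (auto simp: points_interval_Jplus closure_space_interval_Jplus)

lemma clos_dense_point:
  assumes M: "closure_space M" and v: "v \<in> B" "clos M {v} = points M" and B: "B \<subseteq> points M"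
  shows "clos M B = points M"
proof -
  have "clos M {v} \<subseteq> clos M B"
    by (rule clos_mono[OF M]) (use v B in auto)
  then show ?thesis
    using v clos_subset_points[OF M B] by auto
qed

text \<open>The jump from \<open>v\<close> to \<open>\<sigma>\<close> is continuous: a set
  containing vertex 0 has \<open>v\<close> in its image, so its image has dense closure; a set
  avoiding 0 has 0 outside its closure, so that only the shifted \<open>\<sigma>\<close> is
  involved.\<close>

lemma simplicially_acyclic_Jplus:
  assumes M: "closure_space M" and v: "v \<in> points M" "clos M {v} = points M"
  shows "simplicially_acyclic simplex_Jplus vertex_face M"
proof (rule model_acyclic_vertex_cone[OF simplicial_models_Jplus])
  fix m \<sigma> assume \<sigma>: "cs_continuous (simplex_Jplus m) M \<sigma>"
  let ?f = "\<lambda>x. if x = 0 then v else \<sigma> (x - 1)"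
  have \<sigma>M: "\<sigma> x \<in> points M" if "x \<le> m" for x
    using \<sigma> that by (auto simp: cs_continuous_def points_simplex_Jplus)
  then have f: "?f x \<in> points M" if "x \<le> Suc m" for x
    using v that by auto
  show "cs_continuous (simplex_Jplus (Suc m)) M ?f"
    unfolding cs_continuous_def
  proof (intro conjI allI impI)
    fix A assume A: "A \<subseteq> points (simplex_Jplus (Suc m))"
    then have fA: "?f ` A \<subseteq> points M"
      by (intro image_subsetI f) (auto simp: points_simplex_Jplus)
    show "?f ` clos (simplex_Jplus (Suc m)) A \<subseteq> clos M (?f ` A)"
    proof (cases "0 \<in> A")
      case True
      then have "v \<in> ?f ` A"
        by force
      then have "clos M (?f ` A) = points M"
        by (rule clos_dense_point[OF M _ v(2) fA])
      moreover have "?f ` clos (simplex_Jplus (Suc m)) A \<subseteq> points M"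
        by (intro image_subsetI f) (auto simp: simplex_Jplus_def)
      ultimately show ?thesis
        by blast
    next
      case False
      let ?B = "(\<lambda>x. x - 1) ` A"
      have B: "?B \<subseteq> points (simplex_Jplus m)"
        using A by (auto simp: points_simplex_Jplus)
      have eq: "\<sigma> ` ?B = ?f ` A"
        unfolding image_image by (rule image_cong) (use False in \<open>auto intro!: gr0I\<close>)
      show ?thesis
      proof clarify
        fix x assume "x \<in> clos (simplex_Jplus (Suc m)) A"
        then obtain a where a: "a \<in> A" "a \<le> x" "x \<le> Suc m"
          by (auto simp: simplex_Jplus_def)
        then have "a \<noteq> 0"
          using False by metis
        then have "x - 1 \<in> clos (simplex_Jplus m) ?B"
          using a by (auto simp: simplex_Jplus_def intro!: bexI[of _ a])
        then have "\<sigma> (x - 1) \<in> clos M (\<sigma> ` ?B)"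
          by (rule cs_continuousD[OF \<sigma> B])
        then show "?f x \<in> clos M (?f ` A)"
          using \<open>a \<noteq> 0\<close> a unfolding eq by auto
      qed
    qed
  next
    show "?f ` points (simplex_Jplus (Suc m)) \<subseteq> points M"
      by (intro image_subsetI f) (simp add: points_simplex_Jplus)
  qed
qed (rule points_simplex_Jplus)

lemma cubically_acyclic_Jplus:
  assumes M: "closure_space M" and v: "v \<in> points M" "clos M {v} = points M"
  shows "cubically_acyclic interval_Jplus M"
proof (rule model_acyclic_switch_cone[OF cubical_models_Jplus])
  interpret cubical_models interval_Jplus
    by (rule cubical_models_Jplus)
  let ?C = "cs_power interval_Jplus"
  fix m \<sigma> assume \<sigma>: "cs_continuous (?C m) M \<sigma>"
  let ?f = "\<lambda>x. if x 1 = 0 then v else \<sigma> (tail_coords x)"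
  have f: "?f x \<in> points M" if "x \<in> points (?C (Suc m))" for x
    using \<sigma> v tail_points[OF that] by (auto simp: cs_continuous_def)
  show "cs_continuous (?C (Suc m)) M ?f"
    unfolding cs_continuous_def
  proof (intro conjI allI impI)
    show "?f ` points (?C (Suc m)) \<subseteq> points M"
      using f by blast
    fix A assume A: "A \<subseteq> points (?C (Suc m))"
    then have fA: "?f ` A \<subseteq> points M"
      using f by blast
    show "?f ` clos (?C (Suc m)) A \<subseteq> clos M (?f ` A)"
    proof (cases "\<exists>a\<in>A. a 1 = 0")
      case True
      then have "v \<in> ?f ` A"
        by force
      then have "clos M (?f ` A) = points M"
        by (rule clos_dense_point[OF M _ v(2) fA])
      then show ?thesis
        using f clos_subset_points[OF closure_space_cube A] by blast
    next
      case False
      have eq: "\<sigma> ` tail_coords ` A = ?f ` A"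
        using False by (auto simp: image_image intro!: image_cong)
      have T: "tail_coords ` A \<subseteq> points (?C m)"
        using A tail_points by blast
      show ?thesis
      proof clarify
        fix x assume x: "x \<in> clos (?C (Suc m)) A"
        \<comment> \<open>If the first coordinate never vanishes on \<open>A\<close>, then
          \<open>A\<close> projects into \<open>{1}\<close>, which is closed; so the closure of
          \<open>A\<close> stays where the cone is given by \<open>\<sigma>\<close>.\<close>
        have "x 1 \<in> clos interval_Jplus ((\<lambda>a. a 1) ` A)"
          using cs_continuous_proj[OF closure_space_interval_Jplus, of 1 "Suc m"] A x
          by (intro cs_continuousD) auto
        also have "\<dots> = (\<lambda>a. a 1) ` A"
          using False by (auto simp: interval_Jplus_def)
        finally have "x 1 \<noteq> 0"
          using False by auto
        have "tail_coords x \<in> clos (?C m) (tail_coords ` A)"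
          by (rule cs_continuousD[OF tail_continuous A x])
        then have "\<sigma> (tail_coords x) \<in> clos M (\<sigma> ` tail_coords ` A)"
          by (rule cs_continuousD[OF \<sigma> T])
        then show "?f x \<in> clos M (?f ` A)"
          using \<open>x 1 \<noteq> 0\<close> unfolding eq by auto
      qed
    qed
  qed
qed

lemma simplicial_chains_Jplus_equivalent: "simplicial_chains_Jplus X \<simeq>\<^sub>c cubical_complex interval_Jplus X"
  unfolding simplicial_chains_Jplus_def
proof (rule simplicial_cubical_equivalence[OF simplicial_models_Jplus cubical_models_Jplus])
  interpret cubical_models interval_Jplus
    by (rule cubical_models_Jplus)
  let ?o = "\<lambda>n. restrict (\<lambda>_. 0) {1..n}"
  have v: "0 \<in> points (simplex_Jplus n)" "?o n \<in> points (cs_power interval_Jplus n)" for n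
    by (auto simp: points_simplex_Jplus points_cs_power points_interval_Jplus)
  have cv: "clos (simplex_Jplus n) {0} = points (simplex_Jplus n)" for n
    by (auto simp: simplex_Jplus_def)
  \<comment> \<open>A set omitting 0 has 0 in its complement, whose closure is then the whole
    interval. Hence every neighbourhood contains 0, the origin lies in every neighbourhood box, and
    its closure is the whole cube.\<close>
  have nbhd: "0 \<in> U" if "cs_nbhd interval_Jplus t U" for t U
    using that by (auto simp: cs_nbhd_def cs_interior_def interval_Jplus_def split: if_splits)
  have "x \<in> clos (cs_power interval_Jplus n) {?o n}" if "x \<in> points (cs_power interval_Jplus n)" for x n
  proof -
    have "?o n \<in> (\<Pi>\<^sub>E i\<in>{1..n}. U i)" if "\<forall>i\<in>{1..n}. cs_nbhd interval_Jplus (x i) (U i)" for U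
      using that nbhd by auto
    then show ?thesis
      using that unfolding cs_power_def by auto
  qed
  then have cc: "clos (cs_power interval_Jplus n) {?o n} = points (cs_power interval_Jplus n)" for n
    using clos_subset_points[OF closure_space_cube, of "{?o n}" n] v(2)[of n] by blast
  show "simplicially_acyclic simplex_Jplus vertex_face (simplex_Jplus n)" for n
    by (rule simplicially_acyclic_Jplus[OF closure_space_simplex_Jplus v(1) cv])
  show "cubically_acyclic interval_Jplus (simplex_Jplus n)" for n
    by (rule cubically_acyclic_Jplus[OF closure_space_simplex_Jplus v(1) cv])
  show "simplicially_acyclic simplex_Jplus vertex_face (cs_power interval_Jplus n)" for n
    by (rule simplicially_acyclic_Jplus[OF closure_space_cube v(2) cc])
  show "cubically_acyclic interval_Jplus (cs_power interval_Jplus n)" for n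
    by (rule cubically_acyclic_Jplus[OF closure_space_cube v(2) cc])
  show "0 \<in> points (simplex_Jplus 0)"
    by (rule v(1))
qed

section \<open>The unit interval\<close>

lemma cs_nbhd_top_cspace: "cs_nbhd (top_cspace T) x V \<longleftrightarrow> V \<subseteq> topspace T \<and> x \<in> T interior_of V"
  by (simp add: cs_nbhd_def cs_interior_def top_cspace_def interior_of_closure_of)

text \<open>Shrinking the sides of a neighbourhood box to their interiors gives an open box, so both
  kinds of boxes define the same closure. Finiteness of the index set makes the box of interiors
  open.\<close>

lemma cs_power_top_cspace: "cs_power (top_cspace T) n = top_cspace (product_topology (\<lambda>_. T) {1..n})"
proof -
  let ?P = "product_topology (\<lambda>_. T) {1..n}"
  have points: "points (top_cspace T) = topspace T"
    by (simp add: top_cspace_def)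
  have "x \<in> ?P closure_of A \<longleftrightarrow> (\<forall>U. (\<forall>i\<in>{1..n}. cs_nbhd (top_cspace T) (x i) (U i)) \<longrightarrow> (\<Pi>\<^sub>E i\<in>{1..n}. U i) \<inter> A \<noteq> {})"
    if x: "x \<in> topspace ?P" for x A
  proof
    assume cl: "x \<in> ?P closure_of A"
    show "\<forall>U. (\<forall>i\<in>{1..n}. cs_nbhd (top_cspace T) (x i) (U i)) \<longrightarrow> (\<Pi>\<^sub>E i\<in>{1..n}. U i) \<inter> A \<noteq> {}"
    proof (intro allI impI)
      fix U assume U: "\<forall>i\<in>{1..n}. cs_nbhd (top_cspace T) (x i) (U i)"
      let ?B = "\<Pi>\<^sub>E i\<in>{1..n}. T interior_of U i"
      have "openin ?P ?B"
        by (simp add: openin_PiE_gen)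
      moreover have "x \<in> ?B"
        using U x by (auto simp: cs_nbhd_top_cspace PiE_iff)
      ultimately obtain y where "y \<in> A" "y \<in> ?B"
        using cl unfolding in_closure_of by blast
      moreover have "?B \<subseteq> (\<Pi>\<^sub>E i\<in>{1..n}. U i)"
        by (intro PiE_mono interior_of_subset)
      ultimately show "(\<Pi>\<^sub>E i\<in>{1..n}. U i) \<inter> A \<noteq> {}"
        by blast
    qed
  next
    assume meets: "\<forall>U. (\<forall>i\<in>{1..n}. cs_nbhd (top_cspace T) (x i) (U i)) \<longrightarrow> (\<Pi>\<^sub>E i\<in>{1..n}. U i) \<inter> A \<noteq> {}"
    show "x \<in> ?P closure_of A"
      unfolding in_closure_of
    proof (intro conjI x allI impI, elim conjE)
      fix W assume "x \<in> W" "openin ?P W"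
      then obtain V where V: "\<And>i. i \<in> {1..n} \<Longrightarrow> openin T (V i)" "x \<in> Pi\<^sub>E {1..n} V" "Pi\<^sub>E {1..n} V \<subseteq> W"
        unfolding openin_product_topology_alt by metis
      have "cs_nbhd (top_cspace T) (x i) (V i)" if "i \<in> {1..n}" for i
        using V(1)[OF that] PiE_mem[OF V(2) that]
        by (simp add: cs_nbhd_top_cspace interior_of_openin openin_subset)
      then have "Pi\<^sub>E {1..n} V \<inter> A \<noteq> {}"
        using meets[THEN spec, of V] by simp
      then show "\<exists>y. y \<in> A \<and> y \<in> W"
        using V(3) by blast
    qed
  qed
  then have "?P closure_of A = {x \<in> topspace ?P.
      \<forall>U. (\<forall>i\<in>{1..n}. cs_nbhd (top_cspace T) (x i) (U i)) \<longrightarrow> (\<Pi>\<^sub>E i\<in>{1..n}. U i) \<inter> A \<noteq> {}}" for A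
    using closure_of_subset_topspace[of ?P A] by blast
  then show ?thesis
    unfolding cs_power_def points by (simp add: top_cspace_def)
qed

section \<open>Topological simplices and cubes\<close>

abbreviation cube_topology :: "nat \<Rightarrow> (nat \<Rightarrow> real) topology" where
  "cube_topology n \<equiv> product_topology (\<lambda>_. top_of_set {0..1}) {1..n}"

abbreviation simplex_topology :: "nat \<Rightarrow> (nat \<Rightarrow> real) topology" where
  "simplex_topology n \<equiv> subtopology (powertop_real UNIV) (standard_simplex n)"

lemma cs_power_interval_I: "cs_power interval_I n = top_cspace (cube_topology n)"
  by (simp add: interval_I_def cs_power_top_cspace)

lemma points_simplex_I: "points (simplex_I n) = standard_simplex n"
  by (simp add: simplex_I_def top_cspace_def)

lemma cubical_models_I: "cubical_models interval_I"
  by unfold_locales (simp_all add: interval_I_def closure_space_top_cspace, simp_all add: top_cspace_def)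

lemma simplicial_models_I: "simplicial_models simplex_I simplical_face"
proof
  show "closure_space (simplex_I n)" for n
    by (simp add: simplex_I_def closure_space_top_cspace)
  show "cs_continuous (simplex_I n) (simplex_I (Suc n)) (simplical_face i)" if "i \<le> Suc n" for i n
  proof -
    have "continuous_map (powertop_real UNIV) euclideanreal (\<lambda>x. simplical_face i x j)" for j
      by (auto simp: simplical_face_def intro: continuous_map_product_projection)
    then show ?thesis
      using that simplical_face_in_standard_simplex[of "Suc n" i]
      unfolding simplex_I_def cs_continuous_top_cspace
      by (auto simp: continuous_map_in_subtopology continuous_map_componentwise_UNIV
          intro: continuous_map_from_subtopology)
  qed
  show "simplical_face i (simplical_face j x) = simplical_face j (simplical_face (i - 1) x)"
    if "j < i" for i j and x :: "nat \<Rightarrow> real"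
    using that by (auto simp: simplical_face_def fun_eq_iff)
qed

text \<open>At \<open>x 0 = 1\<close> the division yields \<open>0\<close>; this junk value is always multiplied by \<open>1 - x 0 = 0\<close>.\<close>

definition normalised_tail :: "(nat \<Rightarrow> real) \<Rightarrow> nat \<Rightarrow> real" where
  "normalised_tail x = (\<lambda>j. x (Suc j) / (1 - x 0))"

text \<open>This is the radial projection from vertex 0 onto the opposite face: the remaining
  coordinates sum to \<open>1 - x 0\<close>.\<close>

lemma normalised_tail_in_standard_simplex:
  assumes x: "x \<in> standard_simplex (Suc m)" and x0: "x 0 \<noteq> 1"
  shows "normalised_tail x \<in> standard_simplex m"
proof -
  have pos: "x i \<ge> 0" "x i \<le> 1" for i
    using x by (auto simp: standard_simplex_def)
  then have x1: "x 0 < 1"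
    using x0 by (simp add: order_less_le)
  have sum: "(\<Sum>i\<le>m. x (Suc i)) = 1 - x 0"
    using x unfolding standard_simplex_def by (simp add: sum.atMost_Suc_shift del: sum.atMost_Suc)
  have zero: "x (Suc j) = 0" if "j > m" for j
    using x that by (auto simp: standard_simplex_def)
  have "x (Suc j) \<le> 1 - x 0" for j
  proof (cases "j \<le> m")
    case True
    then have "x (Suc j) \<le> (\<Sum>i\<le>m. x (Suc i))"
      using pos by (intro member_le_sum) auto
    then show ?thesis
      by (simp add: sum)
  qed (use zero x1 in simp)
  moreover have "(\<Sum>i\<le>m. x (Suc i) / (1 - x 0)) = 1"
    using x1 by (simp add: sum flip: sum_divide_distrib)
  ultimately show ?thesis
    using pos x1 zero by (simp add: standard_simplex_def normalised_tail_def divide_le_eq)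
qed

text \<open>Away from the apex the normalised tail is continuous. At the apex it may have no limit,
  but the function differs from \<open>a\<close> by at most
  \<open>(1 - x 0) * (B + \<bar>a\<bar>)\<close>, so boundedness of \<open>s\<close>
  suffices.\<close>

lemma continuous_map_cone:
  assumes s: "continuous_map (simplex_topology m) euclideanreal s"
    and B: "\<And>y. y \<in> standard_simplex m \<Longrightarrow> \<bar>s y\<bar> \<le> B"
  shows "continuous_map (simplex_topology (Suc m)) euclideanreal
    (\<lambda>x. (1 - x 0) * s (normalised_tail x) + x 0 * a)"
proof -
  let ?S = "standard_simplex (Suc m)" and ?f = "\<lambda>x. (1 - x 0) * s (normalised_tail x) + x 0 * a"
  have s': "continuous_on (standard_simplex m) s"
    using s by (simp add: euclidean_product_topology)
  have coord: "continuous_on A (\<lambda>x. x i)" for A and i :: nat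
    by (rule continuous_on_product_coordinates[THEN continuous_on_subset]) simp
  have "(?f \<longlongrightarrow> ?f x) (at x within ?S)" if x: "x \<in> ?S" for x
  proof (cases "x 0 = 1")
    case False
    let ?V = "{x :: nat \<Rightarrow> real. x 0 < 1}"
    have V: "open ?V"
      using coord[of UNIV 0] by (intro open_Collect_less) auto
    have "x 0 \<le> 1"
      using x by (auto simp: standard_simplex_def)
    then have xV: "x \<in> ?V"
      using False by simp
    have "continuous_on (?S \<inter> ?V) normalised_tail"
      unfolding normalised_tail_def
      by (intro continuous_on_coordinatewise_then_product continuous_intros coord) auto
    moreover have "normalised_tail ` (?S \<inter> ?V) \<subseteq> standard_simplex m"
      using normalised_tail_in_standard_simplex by auto
    ultimately have "continuous_on (?S \<inter> ?V) (\<lambda>x. s (normalised_tail x))"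
      using continuous_on_compose2[OF s'] by blast
    then have "continuous_on (?S \<inter> ?V) ?f"
      by (intro continuous_intros coord)
    then have "(?f \<longlongrightarrow> ?f x) (at x within ?S \<inter> ?V)"
      using x xV by (simp add: continuous_on_def)
    moreover have "at x within ?S = at x within ?S \<inter> ?V"
      by (rule at_within_nhd[OF xV V]) auto
    ultimately show ?thesis
      by simp
  next
    case True
    have "((\<lambda>y. y 0) \<longlongrightarrow> x 0) (at x within ?S)"
      using coord[of ?S 0] x by (simp add: continuous_on_def)
    then have lim: "((\<lambda>y. (1 - y 0) * (B + \<bar>a\<bar>)) \<longlongrightarrow> (1 - x 0) * (B + \<bar>a\<bar>)) (at x within ?S)"
      by (intro tendsto_intros)
    have "norm (?f y - a) \<le> (1 - y 0) * (B + \<bar>a\<bar>)" if y: "y \<in> ?S" for y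
    proof (cases "y 0 = 1")
      case False
      have "y 0 \<le> 1"
        using y by (auto simp: standard_simplex_def)
      moreover have "\<bar>s (normalised_tail y) - a\<bar> \<le> B + \<bar>a\<bar>"
        using B[OF normalised_tail_in_standard_simplex[OF y False]] by linarith
      ultimately have "\<bar>(1 - y 0) * (s (normalised_tail y) - a)\<bar> \<le> (1 - y 0) * (B + \<bar>a\<bar>)"
        by (simp add: abs_mult mult_left_mono)
      moreover have "?f y - a = (1 - y 0) * (s (normalised_tail y) - a)"
        by (simp add: algebra_simps)
      ultimately show ?thesis
        by simp
    qed simp
    then have "\<forall>\<^sub>F y in at x within ?S. norm (?f y - a) \<le> (1 - y 0) * (B + \<bar>a\<bar>)"
      by (auto simp: eventually_at_topological)
    then have "((\<lambda>y. ?f y - a) \<longlongrightarrow> 0) (at x within ?S)"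
      by (rule Lim_null_comparison) (use lim True in simp)
    then have "(?f \<longlongrightarrow> a) (at x within ?S)"
      by (rule LIM_zero_cancel)
    then show ?thesis
      using True by simp
  qed
  then have "continuous_on ?S ?f"
    by (simp add: continuous_on_def)
  then show ?thesis
    by (simp add: euclidean_product_topology)
qed

text \<open>What the two contractions use of a model, stated so that simplices and cubes both fit:
  maps into it are checked coordinatewise, its coordinates are bounded (for continuity at the apex
  of a cone), and segments to \<open>v\<close> stay inside. The type of \<open>Y\<close> covers the
  sources that occur, simplices and cubes.\<close>

locale star_shaped =
  fixes T :: "(nat \<Rightarrow> real) topology" and v :: "nat \<Rightarrow> real"
  assumes into: "f ` topspace Y \<subseteq> topspace T \<Longrightarrow> (\<And>i. continuous_map Y euclideanreal (\<lambda>y. f y i)) \<Longrightarrow>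
      continuous_map (Y :: (nat \<Rightarrow> real) topology) T f"
    and coord: "continuous_map T euclideanreal (\<lambda>y. y i)"
    and bounded: "\<exists>B. \<forall>y\<in>topspace T. \<bar>y i\<bar> \<le> B"
    and centre: "v \<in> topspace T"
    and star: "y \<in> topspace T \<Longrightarrow> 0 \<le> t \<Longrightarrow> t \<le> 1 \<Longrightarrow> (\<lambda>i. (1 - t) * y i + t * v i) \<in> topspace T"
begin

lemma cubically_acyclic: "cubically_acyclic interval_I (top_cspace T)"
proof -
  interpret cubical_models interval_I
    by (rule cubical_models_I)
  \<comment> \<open>The cubical cone expects the identity at time 1 and the constant at time 0, so
    time weights \<open>y\<close> and its complement weights \<open>v\<close>.\<close>
  let ?H = "\<lambda>t y i. t * y i + (1 - t) * v i"
  show ?thesis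
  proof (rule model_acyclic_cubical_cone[where H = ?H and v = v])
    fix m \<sigma> assume "cs_continuous (cs_power interval_I m) (top_cspace T) \<sigma>"
    then have \<sigma>: "continuous_map (cube_topology m) T \<sigma>"
      by (simp add: cs_power_interval_I cs_continuous_top_cspace)
    have tail: "continuous_map (cube_topology (Suc m)) (cube_topology m) tail_coords"
      using tail_continuous[of m] by (simp add: cs_power_interval_I cs_continuous_top_cspace)
    have \<sigma>t: "continuous_map (cube_topology (Suc m)) T (\<lambda>x. \<sigma> (tail_coords x))"
      using continuous_map_compose[OF tail \<sigma>] by (simp add: o_def)
    have first: "continuous_map (cube_topology (Suc m)) (top_of_set {0..1}) (\<lambda>x. x 1)"
      by (rule continuous_map_product_projection) simp
    have "continuous_map (cube_topology (Suc m)) T (\<lambda>x. ?H (x 1) (\<sigma> (tail_coords x)))"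
    proof (rule into)
      show "(\<lambda>x. ?H (x 1) (\<sigma> (tail_coords x))) ` topspace (cube_topology (Suc m)) \<subseteq> topspace T"
      proof clarify
        fix x assume x: "x \<in> topspace (cube_topology (Suc m))"
        have "x 1 \<in> {0..1}" "\<sigma> (tail_coords x) \<in> topspace T"
          using x continuous_map_image_subset_topspace[OF first] continuous_map_image_subset_topspace[OF \<sigma>t]
          by auto
        then show "?H (x 1) (\<sigma> (tail_coords x)) \<in> topspace T"
          using star[of "\<sigma> (tail_coords x)" "1 - x 1"] by simp
      qed
      fix i
      have "continuous_map (cube_topology (Suc m)) euclideanreal (\<lambda>x. \<sigma> (tail_coords x) i)"
        using continuous_map_compose[OF \<sigma>t coord[of i]] by (simp add: o_def)
      moreover have "continuous_map (cube_topology (Suc m)) euclideanreal (\<lambda>x. x 1)"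
        using first by (simp add: continuous_map_in_subtopology)
      ultimately show "continuous_map (cube_topology (Suc m)) euclideanreal (\<lambda>x. ?H (x 1) (\<sigma> (tail_coords x)) i)"
        by (intro continuous_intros) auto
    qed
    then show "cs_continuous (cs_power interval_I (Suc m)) (top_cspace T) (\<lambda>x. ?H (x 1) (\<sigma> (tail_coords x)))"
      by (simp add: cs_power_interval_I cs_continuous_top_cspace)
  qed simp_all
qed

lemma simplicially_acyclic: "simplicially_acyclic simplex_I simplical_face (top_cspace T)"
proof -
  interpret simplicial_models simplex_I simplical_face
    by (rule simplicial_models_I)
  let ?S = standard_simplex
  define f where "f \<sigma> x = (\<lambda>i. (1 - x 0) * \<sigma> (normalised_tail x) i + x 0 * v i)"
    for \<sigma> and x :: "nat \<Rightarrow> real"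
  define k where "k m \<sigma> = restrict (f \<sigma>) (?S (Suc m))" for m \<sigma>
  have sing: "continuous_map (simplex_topology m) T \<sigma>" if "\<sigma> \<in> sing_maps (simplex_I m) (top_cspace T)" for m \<sigma>
    using that by (simp add: sing_maps_def simplex_I_def cs_continuous_top_cspace)
  show ?thesis
  proof (rule model_acyclic_simplicial_cone[where k = k and w = "restrict (\<lambda>_. v) (?S 0)"], unfold points_simplex_I)
    fix m \<sigma> assume \<sigma>: "\<sigma> \<in> sing_maps (simplex_I m) (top_cspace T)"
    have \<sigma>T: "\<sigma> y \<in> topspace T" if "y \<in> ?S m" for y
      using continuous_map_image_subset_topspace[OF sing[OF \<sigma>]] that by auto
    have "continuous_map (simplex_topology (Suc m)) T (f \<sigma>)"
    proof (rule into)
      show "f \<sigma> ` topspace (simplex_topology (Suc m)) \<subseteq> topspace T"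
      proof clarify
        fix x assume "x \<in> topspace (simplex_topology (Suc m))"
        then have x: "x \<in> ?S (Suc m)"
          by simp
        then have "0 \<le> x 0" "x 0 \<le> 1"
          by (auto simp: standard_simplex_def)
        \<comment> \<open>At \<open>x 0 = 1\<close> the normalised tail leaves the simplex, but the
          formula then gives \<open>v\<close>, which \<open>centre\<close> covers.\<close>
        then show "f \<sigma> x \<in> topspace T"
          using star[OF \<sigma>T[OF normalised_tail_in_standard_simplex[OF x]], of "x 0"] centre
          by (cases "x 0 = 1") (simp_all add: f_def)
      qed
      fix i
      obtain B where "\<And>y. y \<in> topspace T \<Longrightarrow> \<bar>y i\<bar> \<le> B"
        using bounded by blast
      moreover have "continuous_map (simplex_topology m) euclideanreal (\<lambda>y. \<sigma> y i)"
        using continuous_map_compose[OF sing[OF \<sigma>] coord[of i]] by (simp add: o_def)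
      ultimately show "continuous_map (simplex_topology (Suc m)) euclideanreal (\<lambda>x. f \<sigma> x i)"
        unfolding f_def using \<sigma>T by (intro continuous_map_cone[where s = "\<lambda>y. \<sigma> y i" and B = B]) auto
    qed
    then show "k m \<sigma> \<in> sing_maps (simplex_I (Suc m)) (top_cspace T)"
      using restrict_in_sing_maps[OF closure_space_simplex, of "f \<sigma>" "Suc m"]
      by (simp add: k_def points_simplex_I) (simp add: simplex_I_def cs_continuous_top_cspace)
    have "f \<sigma> (simplical_face 0 x) = \<sigma> x" for x
      by (simp add: f_def normalised_tail_def simplical_face_def)
    then show "compose (?S m) (k m \<sigma>) (simplical_face 0) = \<sigma>"
      using sing_maps_extensional[OF \<sigma>] simplical_face_in_standard_simplex[of "Suc m" 0]
      by (auto simp: compose_def k_def points_simplex_I fun_eq_iff extensional_def)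
  next
    fix \<sigma>
    show "compose (?S 0) (k 0 \<sigma>) (simplical_face 1) = restrict (\<lambda>_. v) (?S 0)"
      using simplical_face_in_standard_simplex[of "Suc 0" "Suc 0"]
      by (auto simp: compose_def k_def f_def fun_eq_iff standard_simplex_0 simplical_face_def)
  next
    fix m \<sigma> i assume i: "i \<le> Suc m"
    have "f \<sigma> (simplical_face (Suc i) x) = f (compose (?S (Suc m - 1)) \<sigma> (simplical_face i)) x"
      if x: "x \<in> ?S (Suc m)" for x
    proof -
      have "normalised_tail (simplical_face (Suc i) x) = simplical_face i (normalised_tail x)"
        by (auto simp: normalised_tail_def simplical_face_def fun_eq_iff)
      moreover have "simplical_face (Suc i) x 0 = x 0"
        by (simp add: simplical_face_def)
      \<comment> \<open>At the apex both sides are \<open>v\<close>: the tail, there outside the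
        simplex, has weight 0.\<close>
      ultimately show ?thesis
        using normalised_tail_in_standard_simplex[OF x]
        by (cases "x 0 = 1") (simp_all add: f_def compose_def)
    qed
    then show "compose (?S (Suc m)) (k (Suc m) \<sigma>) (simplical_face (Suc i)) =
        k m (compose (?S m) \<sigma> (simplical_face i))"
      using i simplical_face_in_standard_simplex[of "Suc (Suc m)" "Suc i"]
      by (auto simp: compose_def k_def fun_eq_iff)
  qed
qed

end

lemma star_shaped_simplex: "star_shaped (simplex_topology n) (\<lambda>j. if j = 0 then 1 else 0)"
proof
  fix f and Y :: "(nat \<Rightarrow> real) topology"
  assume "f ` topspace Y \<subseteq> topspace (simplex_topology n)" "\<And>i. continuous_map Y euclideanreal (\<lambda>y. f y i)"
  then show "continuous_map Y (simplex_topology n) f"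
    by (auto simp: continuous_map_in_subtopology continuous_map_componentwise_UNIV)
next
  show "continuous_map (simplex_topology n) euclideanreal (\<lambda>y. y i)" for i
    by (intro continuous_map_from_subtopology continuous_map_product_projection) simp
  show "\<exists>B. \<forall>y\<in>topspace (simplex_topology n). \<bar>y i\<bar> \<le> B" for i
    by (rule exI[of _ 1]) (auto simp: standard_simplex_def)
  show "(\<lambda>j. if j = 0 then 1 else 0) \<in> topspace (simplex_topology n)"
    by simp
  show "(\<lambda>i. (1 - t) * y i + t * (if i = 0 then 1 else 0)) \<in> topspace (simplex_topology n)"
    if "y \<in> topspace (simplex_topology n)" "0 \<le> t" "t \<le> 1" for y t
    using convex_standard_simplex[of y n "\<lambda>j. if j = 0 then 1 else 0" t] that by simp
qed

text \<open>Coordinates outside \<open>{1..n}\<close> have the constant value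
  \<open>undefined\<close>, so they too are continuous and bounded. The centre carries the same
  value there, which keeps segments extensional.\<close>

lemma star_shaped_cube: "star_shaped (cube_topology n) (\<lambda>j\<in>{1..n}. 0)"
proof
  fix f and Y :: "(nat \<Rightarrow> real) topology"
  assume f: "f ` topspace Y \<subseteq> topspace (cube_topology n)" "\<And>i. continuous_map Y euclideanreal (\<lambda>y. f y i)"
  then show "continuous_map Y (cube_topology n) f"
    by (fastforce simp: continuous_map_componentwise continuous_map_in_subtopology PiE_iff)
next
  show "continuous_map (cube_topology n) euclideanreal (\<lambda>y. y i)" for i
  proof (cases "i \<in> {1..n}")
    case True
    then have "continuous_map (cube_topology n) (top_of_set {0..1}) (\<lambda>y. y i)"
      by (rule continuous_map_product_projection)
    then show ?thesis
      by (simp add: continuous_map_in_subtopology)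
  next
    case False
    show ?thesis
      by (rule continuous_map_eq[of _ _ "\<lambda>_. undefined"]) (use False in \<open>auto simp: PiE_iff extensional_def\<close>)
  qed
  show "\<exists>B. \<forall>y\<in>topspace (cube_topology n). \<bar>y i\<bar> \<le> B" for i
  proof (cases "i \<in> {1..n}")
    case True
    then show ?thesis
      by (intro exI[of _ 1]) (auto simp: PiE_iff)
  next
    case False
    then show ?thesis
      by (intro exI[of _ "\<bar>undefined\<bar>"]) (auto simp: PiE_iff extensional_def)
  qed
  show "(\<lambda>j\<in>{1..n}. 0) \<in> topspace (cube_topology n)"
    by auto
  show "(\<lambda>i. (1 - t) * y i + t * restrict (\<lambda>_. 0) {1..n} i) \<in> topspace (cube_topology n)"
    if "y \<in> topspace (cube_topology n)" "0 \<le> t" "t \<le> 1" for y t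
  proof -
    have "(1 - t) * c + t * c = c" for c :: real
      by (simp add: algebra_simps)
    then show ?thesis
      using that by (auto simp: PiE_iff extensional_def mult_le_one)
  qed
qed

lemma simplicial_chains_I_equivalent: "simplicial_chains_I X \<simeq>\<^sub>c cubical_complex interval_I X"
  unfolding simplicial_chains_I_def
proof (rule simplicial_cubical_equivalence[OF simplicial_models_I cubical_models_I])
  show "simplicially_acyclic simplex_I simplical_face (simplex_I n)" for n
    using star_shaped.simplicially_acyclic[OF star_shaped_simplex, of n] by (simp add: simplex_I_def)
  show "cubically_acyclic interval_I (simplex_I n)" for n
    using star_shaped.cubically_acyclic[OF star_shaped_simplex, of n] by (simp add: simplex_I_def)
  show "simplicially_acyclic simplex_I simplical_face (cs_power interval_I n)" for n
    using star_shaped.simplicially_acyclic[OF star_shaped_cube, of n] by (simp add: cs_power_interval_I)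
  show "cubically_acyclic interval_I (cs_power interval_I n)" for n
    using star_shaped.cubically_acyclic[OF star_shaped_cube, of n] by (simp add: cs_power_interval_I)
  show "(\<lambda>j. if j = 0 then 1 else 0) \<in> points (simplex_I 0)"
    by (simp add: points_simplex_I)
qed

theorem theorem1p2:
  fixes X :: "'a cspace"
  assumes "closure_space X"
  shows "simplicial_chains_I X \<simeq>\<^sub>c cubical_complex interval_I X \<and>
         simplicial_chains_J1 X \<simeq>\<^sub>c cubical_complex interval_J1 X \<and>
         simplicial_chains_Jplus X \<simeq>\<^sub>c cubical_complex interval_Jplus X"
  by (simp add: simplicial_chains_I_equivalent simplicial_chains_J1_equivalent simplicial_chains_Jplus_equivalent)

end
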